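(* In the setting described in the context, let $f_1(z,q),\dots,f_m(z,q)$ and $\widetilde f_1,\dots,\widetilde f_m$ satisfy (H1), (H2), (H3), let $\lambda\in\mathbb{C}^*$ with $d:=\arg(\lambda)\in\mathbb{R}\setminus\widetilde\Sigma$, let $a,\varepsilon>0$, and let $z\mapsto\Lambda(z,q)\in \mathrm{GL}_m(\mathcal{M}(\mathbb{C}^* ))$ be a family of diagonal matrices satisfying $\sigma_q\Lambda=D\Lambda=\Lambda D$ such that (H4) and (H5) hold. Then the upper triangular matrix $\widetilde U^d_\Lambda=(\widetilde u^d_{\Lambda,j,k})\in\mathrm{GL}_m(\mathcal{A}(d-\varepsilon,d+\varepsilon))$, whose diagonal entries $\widetilde u^d_{\Lambda,j,j}$ are the limits in (H4) and whose other entries are given, for $1\le j<k\le m$ and $z\in D_{d,a,\varepsilon}$, by $$\widetilde u^d_{\Lambda,j,k}(z):=\widetilde u^d_{\Lambda,j,j}(z)\int_0^z\frac{\widetilde u^d_{\Lambda,j+1,k}(t)}{\widetilde u^d_{\Lambda,j,j}(t)}\frac{dt}{t},$$ is well defined, and $$\lim_{q\to1}U_\Lambda^{[\lambda]}(z,q)=\widetilde U_\Lambda^d(z)$$ uniformly on every compact subset of $D_{d,a,\varepsilon}$.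
   Context: Basic notation. $q$ is a real parameter in $]1,\infty[$; "for $q$ close to $1$" means for all $q$ in some interval $]1,q_0[$. $\sigma_q f(z):=f(qz)$, $\delta_q:=\frac{\sigma_q-\mathrm{Id}}{q-1}$, $\delta:=z\frac{d}{dz}$. $\mathbb{C}(\{z\})$ is the field of germs of meromorphic functions at $0$; $\mathcal{M}(\mathbb{C}^* )$ is the field of meromorphic functions on $\mathbb{C}^*$ and $\mathcal{M}(\mathbb{C}^*,0)$ the field of functions meromorphic on some punctured neighbourhood of $0$. $v_0$ is the $z$-valuation; for nonzero $g=\sum_{\ell\ge n}g_\ell z^\ell$ with $g_n\ne0$, $t_0(g):=g_n$, and $t_0(0):=0$. For invertible matrices, $P[B]_{\sigma_q}:=(\sigma_qP)BP^{-1}$. $\widetilde{\mathbb{C}}$ is the Riemann surface of the logarithm. For $a<b$ real, $\overline S(a,b):=\{z\in\widetilde{\mathbb C}: \arg(z)\in]a,b[\}$ and $\mathcal{A}(a,b)$ is the ring of functions analytic in some punctured neighbourhood of $0$ in $\overline S(a,b)$. $D_{d,a,\varepsilon}:=\{z\in\overline S(d-\varepsilon,d+\varepsilon): |z|<a\}$; functions of $z\in\mathbb{C}^*$ are viewed on $D_{d,a,\varepsilon}$ by pullback. The class $\mathbb{B}_{d,a,\varepsilon}$: a family $z\mapsto f(z,q)$, meromorphic on any compact subset of $D_{d,a,\varepsilon}$ for $q$ close to $1$, belongs to $\mathbb{B}_{d,a,\varepsilon}$ if for every compact $K\subset D_{d,a,\varepsilon}$ there exist $q_0>1$, $N_0\in\mathbb{N}^*$,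 $M_0>0$ such that $|f(q^{-N}z,q)|<M_0$ for all $q\in]1,q_0[$, $N>N_0$, $z\in K$. The equations. Consider $\Delta_q:=(\delta_q-f_m(z,q))\cdots(\delta_q-f_1(z,q))$ and $\widetilde\Delta:=(\delta-\widetilde f_m(z))\cdots(\delta-\widetilde f_1(z))$. They are equivalent to the systems $\sigma_qY=CY$ and $\delta\widetilde Y=\widetilde C\widetilde Y$, where $C$ is the upper bidiagonal matrix with diagonal $1+(q-1)f_1,\dots,1+(q-1)f_m$ and all superdiagonal entries $q-1$, and $\widetilde C$ is the upper bidiagonal matrix with diagonal $\widetilde f_1,\dots,\widetilde f_m$ and all superdiagonal entries $1$. Put $\kappa_j:=v_0(1+(q-1)f_j)$, $\tau_j:=t_0(1+(q-1)f_j)$ (with $1+(q-1)f_j\neq 0$), $D:=\mathrm{Diag}(z^{\kappa_1}\tau_1,\dots,z^{\kappa_m}\tau_m)$. (H1) For all $q$, $z\mapsto f_j(z,q)\in\mathbb{C}(\{z\})$ for $1\le j\le m$; $\widetilde\Delta$ (expanded) has coefficients in $\mathbb{C}(\{z\})$ and $\widetilde f_1,\dots,\widetilde f_m\in\mathbb{C}((z))$. (H2) For all $j$, $t_0(f_j)$ and $\arg(t_0(f_j))$ converge when $q\to1$. For $q$ sufficiently close to $1$: each $\kappa_j$ is constant in $q$, $\kappa_j\le\kappa_k$ for $j<k$, and the non resonance condition holds: for $j\ne k$, $\kappa_j=\kappa_k$ implies $\tau_j\notin q^{\mathbb{Z}}\tau_k$. (H3) $v_0(\widetilde f_j)\le v_0(\widetilde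 f_k)$ for all $1\le j<k\le m$. The meromorphic solution $U_\Lambda^{[\lambda]}$ (for fixed $q$). There is a unique upper triangular $\hat G=(\hat g_{j,k})\in\mathrm{GL}_m(\mathbb{C}((z)))$ with $v_0(\hat g_{j,j})=0$, $t_0(\hat g_{j,j})=1$ and $C=\hat G[D]_{\sigma_q}$. Let $\mu_1<\dots<\mu_r$ be the distinct values of the $\kappa_j$, $m_i$ the number of $j$ with $\kappa_j=\mu_i$, and $B_i$ the diagonal matrix of the corresponding $\tau_j$, so $D=\mathrm{Diag}(B_1z^{\mu_1},\dots,B_rz^{\mu_r})$. There is a unique pair $(F,T)$ with $F\in\mathrm{GL}_m(\mathbb{C}(\{z\}))$, $C=F[T]_{\sigma_q}$, $T$ block upper triangular with diagonal blocks $z^{\mu_i}B_i$ and $(i,k)$ block ($i<k$) with entries in $\sum_{\nu=\mu_i}^{\mu_k-1}\mathbb{C}z^\nu$, normalised by $F\hat H=\hat G$, where $\hat H\in\mathrm{GL}_m(\mathbb{C}[[z]])$ is the unique block upper triangular matrix with identity diagonal blocks and $T=\hat H[D]_{\sigma_q}$. Let $$\Sigma_q:=\bigcup_{1\le i<k\le r}\{-\alpha\in\mathbb{C}^*: q^{\mathbb Z}\alpha^{-\mu_i}\mathrm{Sp}(B_i)\cap q^{\mathbb Z}\alpha^{-\mu_k}\mathrm{Sp}(B_k)\ne\varnothing\}$$ ($\mathrm{Sp}$ = spectrum). For $\lambda\in\mathbb{C}^*\setminus\Sigma_q$, $\hat H^{[\lambda]}\in\mathrm{GL}_m(\mathcal{M}(\mathbb{C}^*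 ))$ is the unique block upper triangular matrix with identity diagonal blocks, $T=\hat H^{[\lambda]}[D]_{\sigma_q}$, such that for $i<k$ the germs at $0$ of the entries of the $(i,k)$ block have all their poles on $-\lambda q^{\mathbb Z}$ with multiplicities at most $\mu_k-\mu_i$. For a diagonal $\Lambda\in\mathrm{GL}_m(\mathcal{M}(\mathbb{C}^* ))$ with $\sigma_q\Lambda=D\Lambda=\Lambda D$, put $U_\Lambda^{[\lambda]}=(u_{\Lambda,j,k}^{[\lambda]}):=F\hat H^{[\lambda]}\Lambda\in\mathrm{GL}_m(\mathcal{M}(\mathbb{C}^*,0))$, a fundamental solution of $\sigma_qY=CY$. Singular directions. $\widetilde\Sigma\subset\mathbb{R}$ is a set, finite modulo $2\pi\mathbb{Z}$, such that for every $\lambda\in\mathbb{C}^*$ with $d=\arg(\lambda)\notin\widetilde\Sigma$: $\lambda\notin\Sigma_q$ for all $q$ close to $1$, and $d$ is not a singular direction of $\delta\widetilde Y=\widetilde C\widetilde Y$, i.e. the series $\widetilde f_1,\dots,\widetilde f_m$ and the entries of the formal gauge matrix $\widetilde H\in\mathrm{GL}_m(\mathbb{C}((z)))$ of the Hukuhara–Turrittin theorem are, up to multiplication by a power of $z$, finite sums of series that are $k$-summable (Borel–Laplace) in the direction $d$ for various $k\in\mathbb{N}^*$. (H4) For all $1\le j\le m$, uniformly on every compact subset of $D_{d,a,\varepsilon}$, $\lim_{q\to1}u_{\Lambda,j,j}^{[\lambda]}(z,q)=:\widetilde u_{\Lambda,j,j}^d(z)\in\mathcal{A}(d-\varepsilon,d+\varepsilon)$,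 a function without zeros on $D_{d,a,\varepsilon}$. (H5) For all $1\le j<m$, $\dfrac{u_{\Lambda,j+1,j+1}^{[\lambda]}}{z\,\sigma_q(u_{\Lambda,j,j}^{[\lambda]})}\in\mathbb{B}_{d,a,\varepsilon}$. *)

theory Defs
  imports "HOL-Complex_Analysis.Complex_Analysis" "Jordan_Normal_Form.Spectral_Radius"
begin

no_notation fls_nth (infixl "$$" 75)

text \<open>
  Conventions.
  \<^item> The field \<open>C((z))\<close> is the type \<^typ>\<open>complex fls\<close>; \<open>C({z})\<close> consists of those
    series whose \<^const>\<open>fls_conv_radius\<close> is positive.
  \<^item> Matrices are indexed from \<open>0\<close>, so \<open>f q 0, \<dots>, f q (m - 1)\<close> stand for
    \<open>f\<^sub>1, \<dots>, f\<^sub>m\<close>.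
  \<^item> A meromorphic function on \<open>S\<close> is a total function that is \<^const>\<open>meromorphic_on\<close>
    \<open>S\<close>; its values at poles are irrelevant, and equality of two of them means equality off a
    sparse subset of \<open>S\<close>.
  \<^item> The Riemann surface of the logarithm is identified with the complex plane by
    \<open>z = exp w\<close>: \<open>Im w\<close> is the argument of \<open>z\<close> and \<open>Re w\<close> is \<open>ln |z|\<close>. A
    function \<open>g\<close> of \<open>z\<close> is pulled back to \<open>\<lambda>w. g (exp w)\<close>.
  \<^item> ``For \<open>q\<close> close to 1'' and \<open>q \<rightarrow> 1\<close> refer to the filter \<open>at_right 1\<close>.
\<close>

section \<open>Series\<close>

definition conv_fls :: "complex fls \<Rightarrow> bool" where
  "conv_fls g \<longleftrightarrow> fls_conv_radius g > 0"

definition v0 :: "complex fls \<Rightarrow> ereal" where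
  "v0 g = (if g = 0 then \<infinity> else ereal (of_int (fls_subdegree g)))"

text \<open>This is \<open>0\<close> for \<open>g = 0\<close>.\<close>
definition t0 :: "complex fls \<Rightarrow> complex" where
  "t0 g = fls_nth g (fls_subdegree g)"

text \<open>\<open>\<sigma>\<^sub>q\<close>, that is, substitution of \<open>q z\<close> for \<open>z\<close>.\<close>
definition fls_sigma :: "real \<Rightarrow> complex fls \<Rightarrow> complex fls" where
  "fls_sigma q g = fls_compose_fps g (fps_const (of_real q) * fps_X)"

text \<open>\<open>\<delta> = z d/dz\<close>.\<close>
definition fls_delta :: "complex fls \<Rightarrow> complex fls" where
  "fls_delta g = fls_X * fls_deriv g"

section \<open>Gauge transformations\<close>

text \<open>
  \<open>C = P' B P\<^sup>-\<^sup>1\<close>, where \<open>P'\<close> is \<open>\<sigma>\<^sub>q P\<close>; in particular \<open>P\<close> is invertible.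
\<close>
definition gauge_rel :: "'a::semiring_1 mat \<Rightarrow> 'a mat \<Rightarrow> 'a mat \<Rightarrow> 'a mat \<Rightarrow> bool" where
  "gauge_rel P' P B C \<longleftrightarrow> (\<exists>R. inverts_mat P R \<and> inverts_mat R P \<and> C = P' * B * R)"

definition q_gauge :: "real \<Rightarrow> complex fls mat \<Rightarrow> complex fls mat \<Rightarrow> complex fls mat \<Rightarrow> bool" where
  "q_gauge q P B C \<longleftrightarrow> gauge_rel (map_mat (fls_sigma q) P) P B C"

section \<open>The equations\<close>

text \<open>
  The factored operators \<open>(\<delta>\<^sub>q - f\<^sub>m) \<cdots> (\<delta>\<^sub>q - f\<^sub>1)\<close> and \<open>(\<delta> - ft\<^sub>m) \<cdots> (\<delta> - ft\<^sub>1)\<close> correspond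
  to the systems \<open>\<sigma>\<^sub>q Y = C Y\<close> and \<open>\<delta> Y = A Y\<close> with \<open>C = Cq m f q\<close> and \<open>A = Ctilde m ft\<close>: for
  \<open>y\<^sub>1\<close> in the kernel put \<open>y\<^sub>j\<^sub>+\<^sub>1 = (\<delta>\<^sub>q - f\<^sub>j) y\<^sub>j\<close>, respectively \<open>y\<^sub>j\<^sub>+\<^sub>1 = (\<delta> - ft\<^sub>j) y\<^sub>j\<close>.
\<close>
definition Cq :: "nat \<Rightarrow> (real \<Rightarrow> nat \<Rightarrow> complex fls) \<Rightarrow> real \<Rightarrow> complex fls mat" where
  "Cq m f q = mat m m (\<lambda>(i,j). if j = i then 1 + fls_const (of_real (q - 1)) * f q i
                                else if j = Suc i then fls_const (of_real (q - 1)) else 0)"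

definition Ctilde :: "nat \<Rightarrow> (nat \<Rightarrow> complex fls) \<Rightarrow> complex fls mat" where
  "Ctilde m ft = mat m m (\<lambda>(i,j). if j = i then ft i else if j = Suc i then 1 else 0)"

definition kappa :: "(real \<Rightarrow> nat \<Rightarrow> complex fls) \<Rightarrow> real \<Rightarrow> nat \<Rightarrow> int" where
  "kappa f q j = fls_subdegree (1 + fls_const (of_real (q - 1)) * f q j)"

definition tau :: "(real \<Rightarrow> nat \<Rightarrow> complex fls) \<Rightarrow> real \<Rightarrow> nat \<Rightarrow> complex" where
  "tau f q j = t0 (1 + fls_const (of_real (q - 1)) * f q j)"

definition Dq :: "nat \<Rightarrow> (real \<Rightarrow> nat \<Rightarrow> complex fls) \<Rightarrow> real \<Rightarrow> complex fls mat" where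
  "Dq m f q = mat m m (\<lambda>(i,j). if i = j then fls_const (tau f q i) * fls_X_intpow (kappa f q i) else 0)"

text \<open>The operator \<open>(\<delta> - ft (n - 1)) \<cdots> (\<delta> - ft 0)\<close> acting on \<open>C((z))\<close>.\<close>
primrec Delta_tilde :: "(nat \<Rightarrow> complex fls) \<Rightarrow> nat \<Rightarrow> complex fls \<Rightarrow> complex fls" where
  "Delta_tilde ft 0 y = y"
| "Delta_tilde ft (Suc n) y = fls_delta (Delta_tilde ft n y) - ft n * Delta_tilde ft n y"

section \<open>The hypotheses on the equations\<close>

text \<open>
  The last conjunct of \<open>hyp_H1\<close> says that the expanded operator, \<open>\<Sum> c\<^sub>i \<delta>\<^sup>i\<close>, has its
  (uniquely determined) coefficients in \<open>C({z})\<close>.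
\<close>
definition hyp_H1 :: "nat \<Rightarrow> (real \<Rightarrow> nat \<Rightarrow> complex fls) \<Rightarrow> (nat \<Rightarrow> complex fls) \<Rightarrow> bool" where
  "hyp_H1 m f ft \<longleftrightarrow>
     (\<forall>q>1. \<forall>j<m. conv_fls (f q j)) \<and>
     (\<exists>c. (\<forall>i\<le>m. conv_fls (c i)) \<and>
          (\<forall>y. Delta_tilde ft m y = (\<Sum>i\<le>m. c i * (fls_delta ^^ i) y)))"

text \<open>
  The argument of \<open>t\<^sub>0(f\<^sub>j)\<close> converges if some determination \<open>\<theta>\<close> of it does.
\<close>
definition hyp_H2 :: "nat \<Rightarrow> (real \<Rightarrow> nat \<Rightarrow> complex fls) \<Rightarrow> bool" where
  "hyp_H2 m f \<longleftrightarrow>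
     (\<forall>j<m. (\<exists>l. ((\<lambda>q. t0 (f q j)) \<longlongrightarrow> l) (at_right 1)) \<and>
            (\<exists>\<theta> :: real \<Rightarrow> real. \<exists>l.
               (\<forall>\<^sub>F q in at_right 1. t0 (f q j) = of_real (cmod (t0 (f q j))) * cis (\<theta> q)) \<and>
               (\<theta> \<longlongrightarrow> l) (at_right 1))) \<and>
     (\<exists>k0. \<forall>\<^sub>F q in at_right 1. \<forall>j<m. kappa f q j = k0 j) \<and>
     (\<forall>\<^sub>F q in at_right 1. \<forall>j<m. \<forall>k<m. j < k \<longrightarrow> kappa f q j \<le> kappa f q k) \<and>
     (\<forall>\<^sub>F q in at_right 1. \<forall>j<m. \<forall>k<m. j \<noteq> k \<longrightarrow> kappa f q j = kappa f q k \<longrightarrow>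
        (\<forall>n::int. tau f q j \<noteq> of_real q powi n * tau f q k))"

definition hyp_H3 :: "nat \<Rightarrow> (nat \<Rightarrow> complex fls) \<Rightarrow> bool" where
  "hyp_H3 m ft \<longleftrightarrow> (\<forall>j k. j < k \<and> k < m \<longrightarrow> v0 (ft j) \<le> v0 (ft k))"

section \<open>The set \<open>\<Sigma>\<^sub>q\<close>\<close>

definition mus :: "nat \<Rightarrow> (real \<Rightarrow> nat \<Rightarrow> complex fls) \<Rightarrow> real \<Rightarrow> int list" where
  "mus m f q = sorted_list_of_set (kappa f q ` {..<m})"

definition Bblock :: "nat \<Rightarrow> (real \<Rightarrow> nat \<Rightarrow> complex fls) \<Rightarrow> real \<Rightarrow> nat \<Rightarrow> complex mat" where
  "Bblock m f q i =
     (let ts = map (tau f q) (filter (\<lambda>j. kappa f q j = mus m f q ! i) [0..<m])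
      in mat (length ts) (length ts) (\<lambda>(a,b). if a = b then ts ! a else 0))"

definition Sigma_q :: "nat \<Rightarrow> (real \<Rightarrow> nat \<Rightarrow> complex fls) \<Rightarrow> real \<Rightarrow> complex set" where
  "Sigma_q m f q =
     {- \<alpha> | \<alpha>. \<alpha> \<noteq> 0 \<and> (\<exists>i k. i < k \<and> k < length (mus m f q) \<and>
        {of_real q powi n * \<alpha> powi (- (mus m f q ! i)) * s | n s. s \<in> spectrum (Bblock m f q i)} \<inter>
        {of_real q powi n * \<alpha> powi (- (mus m f q ! k)) * s | n s. s \<in> spectrum (Bblock m f q k)}
        \<noteq> {})}"

section \<open>The meromorphic solution\<close>

definition eval_mat :: "complex fls mat \<Rightarrow> complex \<Rightarrow> complex mat" where
  "eval_mat A z = map_mat (\<lambda>g. eval_fls g z) A"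

definition near0 :: "(complex \<Rightarrow> bool) \<Rightarrow> bool" where
  "near0 P \<longleftrightarrow> (\<exists>r>0. \<forall>\<^sub>\<approx>z\<in>ball 0 r - {0}. P z)"

definition GL_merom :: "nat \<Rightarrow> complex set \<Rightarrow> (complex \<Rightarrow> complex mat) \<Rightarrow> bool" where
  "GL_merom m S P \<longleftrightarrow>
     (\<forall>z. P z \<in> carrier_mat m m) \<and>
     (\<forall>i<m. \<forall>j<m. (\<lambda>z. P z $$ (i,j)) meromorphic_on S) \<and>
     (\<forall>\<^sub>\<approx>z\<in>S. invertible_mat (P z))"

text \<open>
  The block of an index \<open>j\<close> is determined by the value \<open>\<kappa> j\<close>.
\<close>
definition block_unipotent :: "nat \<Rightarrow> (nat \<Rightarrow> int) \<Rightarrow> 'a::{zero,one} mat \<Rightarrow> bool" where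
  "block_unipotent m \<kappa> H \<longleftrightarrow>
     (\<forall>i<m. \<forall>j<m. (\<kappa> j < \<kappa> i \<longrightarrow> H $$ (i,j) = 0) \<and>
                   (\<kappa> i = \<kappa> j \<longrightarrow> H $$ (i,j) = (if i = j then 1 else 0)))"

definition is_Ghat :: "nat \<Rightarrow> (real \<Rightarrow> nat \<Rightarrow> complex fls) \<Rightarrow> real \<Rightarrow> complex fls mat \<Rightarrow> bool" where
  "is_Ghat m f q G \<longleftrightarrow>
     G \<in> carrier_mat m m \<and> upper_triangular G \<and>
     (\<forall>j<m. v0 (G $$ (j,j)) = 0 \<and> t0 (G $$ (j,j)) = 1) \<and>
     q_gauge q G (Dq m f q) (Cq m f q)"

text \<open>The shape required of \<open>T\<close>; its entries are Laurent polynomials.\<close>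
definition is_T :: "nat \<Rightarrow> (real \<Rightarrow> nat \<Rightarrow> complex fls) \<Rightarrow> real \<Rightarrow> complex fls mat \<Rightarrow> bool" where
  "is_T m f q T \<longleftrightarrow>
     T \<in> carrier_mat m m \<and>
     (\<forall>i<m. \<forall>j<m.
        (kappa f q i = kappa f q j \<longrightarrow> T $$ (i,j) = Dq m f q $$ (i,j)) \<and>
        (kappa f q j < kappa f q i \<longrightarrow> T $$ (i,j) = 0) \<and>
        (kappa f q i < kappa f q j \<longrightarrow>
           (\<forall>n. n < kappa f q i \<or> kappa f q j \<le> n \<longrightarrow> fls_nth (T $$ (i,j)) n = 0)))"

definition is_Hhat :: "nat \<Rightarrow> (real \<Rightarrow> nat \<Rightarrow> complex fls) \<Rightarrow> real \<Rightarrow> complex fls mat \<Rightarrow> complex fls mat \<Rightarrow> bool" where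
  "is_Hhat m f q T H \<longleftrightarrow>
     H \<in> carrier_mat m m \<and>
     (\<forall>i<m. \<forall>j<m. \<forall>n<0. fls_nth (H $$ (i,j)) n = 0) \<and>
     block_unipotent m (kappa f q) H \<and>
     q_gauge q H (Dq m f q) T"

definition is_Hlambda ::
  "nat \<Rightarrow> (real \<Rightarrow> nat \<Rightarrow> complex fls) \<Rightarrow> real \<Rightarrow> complex \<Rightarrow> complex fls mat \<Rightarrow> (complex \<Rightarrow> complex mat) \<Rightarrow> bool" where
  "is_Hlambda m f q lam T Hl \<longleftrightarrow>
     GL_merom m (- {0}) Hl \<and>
     (\<forall>\<^sub>\<approx>z\<in>- {0}. block_unipotent m (kappa f q) (Hl z)) \<and>
     (\<forall>\<^sub>\<approx>z\<in>- {0}. gauge_rel (Hl (of_real q * z)) (Hl z) (eval_mat (Dq m f q) z) (eval_mat T z)) \<and>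
     (\<forall>i<m. \<forall>j<m. kappa f q i < kappa f q j \<longrightarrow>
        (\<exists>r>0. \<forall>z\<in>ball 0 r - {0}. is_pole (\<lambda>z. Hl z $$ (i,j)) z \<longrightarrow>
           (\<exists>n::int. z = - lam * of_real q powi n) \<and>
           - zorder (\<lambda>z. Hl z $$ (i,j)) z \<le> kappa f q j - kappa f q i))"

definition is_Lambda ::
  "nat \<Rightarrow> (real \<Rightarrow> nat \<Rightarrow> complex fls) \<Rightarrow> real \<Rightarrow> (complex \<Rightarrow> complex mat) \<Rightarrow> bool" where
  "is_Lambda m f q Lam \<longleftrightarrow>
     GL_merom m (- {0}) Lam \<and>
     (\<forall>\<^sub>\<approx>z\<in>- {0}. diagonal_mat (Lam z) \<and>
        Lam (of_real q * z) = eval_mat (Dq m f q) z * Lam z \<and>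
        eval_mat (Dq m f q) z * Lam z = Lam z * eval_mat (Dq m f q) z)"

text \<open>
  \<open>U\<close> represents, near \<open>0\<close>, the solution \<open>F H\<^sup>[\<^sup>\<lambda>\<^sup>] \<Lambda>\<close>. The matrices \<open>G\<close>, \<open>F\<close>, \<open>T\<close>, \<open>H\<close>,
  \<open>Hl\<close> are characterised by the stated properties, for \<open>lam \<notin> Sigma_q m f q\<close>.
\<close>
definition is_U ::
  "nat \<Rightarrow> (real \<Rightarrow> nat \<Rightarrow> complex fls) \<Rightarrow> real \<Rightarrow> complex \<Rightarrow> (complex \<Rightarrow> complex mat) \<Rightarrow>
   (complex \<Rightarrow> complex mat) \<Rightarrow> bool" where
  "is_U m f q lam Lam U \<longleftrightarrow>
     (\<exists>G F T H Hl.
        is_Ghat m f q G \<and>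
        F \<in> carrier_mat m m \<and> (\<forall>i<m. \<forall>j<m. conv_fls (F $$ (i,j))) \<and>
        q_gauge q F T (Cq m f q) \<and> is_T m f q T \<and>
        is_Hhat m f q T H \<and> F * H = G \<and>
        is_Hlambda m f q lam T Hl \<and>
        near0 (\<lambda>z. U z = eval_mat F z * Hl z * Lam z))"

section \<open>Singular directions of the differential system\<close>

text \<open>
  Borel--Laplace \<open>k\<close>-summability in the direction \<open>d\<close>: the formal Borel transform of order \<open>k\<close>
  converges and continues to a sector bisected by \<open>d\<close> with exponential growth of order \<open>k\<close>.
\<close>
definition k_summable :: "nat \<Rightarrow> real \<Rightarrow> complex fps \<Rightarrow> bool" where
  "k_summable k d h \<longleftrightarrow>
     (let b = Abs_fps (\<lambda>n. fps_nth h n / of_real (Gamma (1 + real n / real k)))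
      in fps_conv_radius b > 0 \<and>
         (\<exists>\<eta>>0. \<exists>\<rho>>0. \<exists>J c :: real. \<exists>g.
            (let S = {of_real r * cis \<theta> | r \<theta>. r > 0 \<and> \<bar>\<theta> - d\<bar> < \<eta>}
             in g holomorphic_on S \<and>
                (\<forall>\<zeta>\<in>S. cmod \<zeta> < \<rho> \<longrightarrow> g \<zeta> = eval_fps b \<zeta>) \<and>
                (\<forall>\<zeta>\<in>S. cmod (g \<zeta>) \<le> J * exp (c * cmod \<zeta> ^ k)))))"

text \<open>Up to a power of \<open>z\<close>, a finite sum of \<open>k\<close>-summable series for various \<open>k \<ge> 1\<close>.\<close>
definition summable_dir :: "real \<Rightarrow> complex fls \<Rightarrow> bool" where
  "summable_dir d g \<longleftrightarrow>
     (\<exists>(N::int) (l::nat) k h. (\<forall>i<l. k i \<ge> 1 \<and> k_summable (k i) d (h i)) \<and>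
        g = fls_X_intpow N * (\<Sum>i<l. fps_to_fls (h i)))"

text \<open>
  \<open>H\<close> is a formal gauge matrix as in the Hukuhara--Turrittin theorem: it transforms
  \<open>\<delta> Y = (Q + L) Y\<close> into \<open>\<delta> Y = A Y\<close>, where \<open>Q\<close> is diagonal with entries in
  \<open>z\<^sup>-\<^sup>1 C[z\<^sup>-\<^sup>1]\<close> and \<open>L\<close> is a constant matrix commuting with \<open>Q\<close>.
  (No ramification is needed for a triangular \<open>A\<close> over \<open>C((z))\<close>.)
\<close>
definition hukuhara_turrittin :: "nat \<Rightarrow> complex fls mat \<Rightarrow> complex fls mat \<Rightarrow> bool" where
  "hukuhara_turrittin m A H \<longleftrightarrow>
     H \<in> carrier_mat m m \<and>
     (\<exists>Q \<in> carrier_mat m m. \<exists>L \<in> carrier_mat m m.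
        diagonal_mat Q \<and> (\<forall>i<m. \<forall>n\<ge>0. fls_nth (Q $$ (i,i)) n = 0) \<and>
        Q * map_mat fls_const L = map_mat fls_const L * Q \<and>
        (\<exists>R. inverts_mat H R \<and> inverts_mat R H \<and>
             A = H * (Q + map_mat fls_const L) * R + map_mat fls_delta H * R))"

text \<open>
  The choice of the gauge matrix does not affect the summability of its entries: two choices
  differ by a matrix of Laurent polynomials.
\<close>
definition nonsingular_dir :: "nat \<Rightarrow> (nat \<Rightarrow> complex fls) \<Rightarrow> real \<Rightarrow> bool" where
  "nonsingular_dir m ft d \<longleftrightarrow>
     (\<forall>j<m. summable_dir d (ft j)) \<and>
     (\<exists>H. hukuhara_turrittin m (Ctilde m ft) H \<and> (\<forall>i<m. \<forall>j<m. summable_dir d (H $$ (i,j))))"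

text \<open>Finiteness modulo \<open>2\<pi>\<int>\<close> is finiteness of the image on the unit circle.\<close>
definition sing_dir_set ::
  "nat \<Rightarrow> (real \<Rightarrow> nat \<Rightarrow> complex fls) \<Rightarrow> (nat \<Rightarrow> complex fls) \<Rightarrow> real set \<Rightarrow> bool" where
  "sing_dir_set m f ft Sig \<longleftrightarrow>
     finite (cis ` Sig) \<and>
     (\<forall>lam d. lam \<noteq> 0 \<and> lam = of_real (cmod lam) * cis d \<and> d \<notin> Sig \<longrightarrow>
        (\<forall>\<^sub>F q in at_right 1. lam \<notin> Sigma_q m f q) \<and> nonsingular_dir m ft d)"

section \<open>Functions on sectors\<close>

definition Dom :: "real \<Rightarrow> real \<Rightarrow> real \<Rightarrow> complex set" where
  "Dom d a \<epsilon> = {w. Re w < ln a \<and> d - \<epsilon> < Im w \<and> Im w < d + \<epsilon>}"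

definition Aring :: "real \<Rightarrow> real \<Rightarrow> (complex \<Rightarrow> complex) \<Rightarrow> bool" where
  "Aring \<alpha> \<beta> \<phi> \<longleftrightarrow> (\<exists>r>0. \<phi> analytic_on {w. Re w < ln r \<and> \<alpha> < Im w \<and> Im w < \<beta>})"

definition GL_Aring :: "nat \<Rightarrow> real \<Rightarrow> real \<Rightarrow> (complex \<Rightarrow> complex mat) \<Rightarrow> bool" where
  "GL_Aring m \<alpha> \<beta> P \<longleftrightarrow>
     (\<forall>w. P w \<in> carrier_mat m m) \<and>
     (\<forall>i<m. \<forall>j<m. Aring \<alpha> \<beta> (\<lambda>w. P w $$ (i,j))) \<and>
     (\<exists>R. (\<forall>w. R w \<in> carrier_mat m m) \<and> (\<forall>i<m. \<forall>j<m. Aring \<alpha> \<beta> (\<lambda>w. R w $$ (i,j))) \<and>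
          (\<exists>r>0. \<forall>w. Re w < ln r \<and> \<alpha> < Im w \<and> Im w < \<beta> \<longrightarrow>
             inverts_mat (P w) (R w) \<and> inverts_mat (R w) (P w)))"

text \<open>
  For fixed \<open>q\<close> the functions of interest are only given in a punctured neighbourhood of \<open>0\<close>,
  possibly shrinking as \<open>q \<rightarrow> 1\<close>. Their value at a point \<open>z\<close> of a fixed domain is that of
  the meromorphic continuation along the segment \<open>]0, z]\<close>. This segment contains all the points
  \<open>q\<^sup>-\<^sup>N z\<close>. Since \<open>h\<close> is nicely meromorphic, removable singularities are removed, and the value
  at a pole is \<open>0\<close>; a uniform limit on all compact subsets of an open set, or a uniform bound as
  in \<open>classB\<close>, excludes such poles near \<open>q = 1\<close>.
\<close>
definition continuation :: "(complex \<Rightarrow> complex) \<Rightarrow> complex \<Rightarrow> (complex \<Rightarrow> complex) \<Rightarrow> bool" where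
  "continuation g z h \<longleftrightarrow>
     h nicely_meromorphic_on ((\<lambda>t. of_real t * z) ` {0<..1}) \<and> near0 (\<lambda>x. h x = g x)"

definition continues_to :: "(complex \<Rightarrow> complex) \<Rightarrow> complex \<Rightarrow> bool" where
  "continues_to g z \<longleftrightarrow> (\<exists>h. continuation g z h)"

definition cont_val :: "(complex \<Rightarrow> complex) \<Rightarrow> complex \<Rightarrow> complex" where
  "cont_val g z = (THE c. \<exists>h. continuation g z h \<and> c = h z)"

text \<open>The family \<open>g q\<close> is meromorphic on any compact subset of \<open>Dom d a \<epsilon>\<close> for \<open>q\<close> close to 1.\<close>
definition merom_family :: "real \<Rightarrow> real \<Rightarrow> real \<Rightarrow> (real \<Rightarrow> complex \<Rightarrow> complex) \<Rightarrow> bool" where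
  "merom_family d a \<epsilon> g \<longleftrightarrow>
     (\<forall>K. compact K \<and> K \<subseteq> Dom d a \<epsilon> \<longrightarrow>
        (\<forall>\<^sub>F q in at_right 1. \<forall>w\<in>K. continues_to (g q) (exp w)))"

definition lim_on_compacts ::
  "real \<Rightarrow> real \<Rightarrow> real \<Rightarrow> (real \<Rightarrow> complex \<Rightarrow> complex) \<Rightarrow> (complex \<Rightarrow> complex) \<Rightarrow> bool" where
  "lim_on_compacts d a \<epsilon> g l \<longleftrightarrow>
     merom_family d a \<epsilon> g \<and>
     (\<forall>K. compact K \<and> K \<subseteq> Dom d a \<epsilon> \<longrightarrow>
        uniform_limit K (\<lambda>q w. cont_val (g q) (exp w)) l (at_right 1))"

definition classB :: "real \<Rightarrow> real \<Rightarrow> real \<Rightarrow> (real \<Rightarrow> complex \<Rightarrow> complex) \<Rightarrow> bool" where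
  "classB d a \<epsilon> g \<longleftrightarrow>
     merom_family d a \<epsilon> g \<and>
     (\<forall>K. compact K \<and> K \<subseteq> Dom d a \<epsilon> \<longrightarrow>
        (\<exists>q0>1. \<exists>N0\<ge>1. \<exists>M0>0. \<forall>q\<in>{1<..<q0}. \<forall>N>N0. \<forall>w\<in>K.
           cmod (cont_val (g q) (of_real (q powi (- int N)) * exp w)) < M0))"

section \<open>The limit matrix\<close>

text \<open>
  The integral from \<open>0\<close> to \<open>z\<close> is taken along the ray \<open>t = exp (w - s)\<close>, \<open>s \<ge> 0\<close>, where
  \<open>z = exp w\<close>; up to orientation \<open>dt/t\<close> becomes \<open>ds\<close>.
\<close>
function Utilde :: "(nat \<Rightarrow> complex \<Rightarrow> complex) \<Rightarrow> nat \<Rightarrow> nat \<Rightarrow> complex \<Rightarrow> complex" where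
  "Utilde ut j k =
     (if k < j then (\<lambda>w. 0)
      else if j = k then ut j
      else (\<lambda>w. ut j w * (LINT s:{0..}|lborel.
                  Utilde ut (Suc j) k (w - of_real s) / ut j (w - of_real s))))"
  by pat_completeness auto
termination
  by (relation "Wellfounded.measure (\<lambda>(ut,j,k). k - j)") auto

declare Utilde.simps [simp del]

definition Utilde_mat :: "nat \<Rightarrow> (nat \<Rightarrow> complex \<Rightarrow> complex) \<Rightarrow> complex \<Rightarrow> complex mat" where
  "Utilde_mat m ut w = mat m m (\<lambda>(j,k). Utilde ut j k w)"

end

theory Submission
  imports Defs "HOL-Real_Asymp.Real_Asymp"
begin

text \<open>
  The matrix \<open>U\<close> is upper triangular, and \<open>v\<^sub>j\<^sub>k = u\<^sub>j\<^sub>k / u\<^sub>j\<^sub>j\<close> satisfies the first order equation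
  \<open>v\<^sub>j\<^sub>k(q x) - v\<^sub>j\<^sub>k(x) = (q - 1) x w\<^sub>j(x) v\<^sub>j\<^sub>+\<^sub>1\<^sub>,\<^sub>k(x)\<close>, where
  \<open>w\<^sub>j(x) = u\<^sub>j\<^sub>+\<^sub>1\<^sub>,\<^sub>j\<^sub>+\<^sub>1(x) / (x u\<^sub>j\<^sub>j(q x))\<close> is the bounded quotient of (H5). If \<open>v\<^sub>j\<^sub>k(q\<^sup>-\<^sup>N x)\<close> tends
  to \<open>0\<close>, then \<open>v\<^sub>j\<^sub>k(x)\<close> is the sum of \<open>(q - 1) y w\<^sub>j(y) v\<^sub>j\<^sub>+\<^sub>1\<^sub>,\<^sub>k(y)\<close> over \<open>y = q\<^sup>-\<^sup>n x\<close>, \<open>n \<ge> 1\<close>. In the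
  logarithmic coordinate this is a Riemann sum of step \<open>ln q\<close> for the integral along the ray, and
  dominated convergence gives the limit.

  The decay at \<open>0\<close> also comes from (H5). As \<open>w\<^sub>j\<close> is bounded on \<open>q\<^sup>-\<^sup>N x\<close>, the growth of
  \<open>\<Lambda>\<^sub>j\<^sub>+\<^sub>1 / \<Lambda>\<^sub>j\<close> along this sequence forces all the \<open>\<kappa>\<^sub>j\<close> to be equal and
  \<open>|\<tau>\<^sub>j / \<tau>\<^sub>j\<^sub>+\<^sub>1| \<le> q powi -(1 + \<kappa>)\<close>. Hence \<open>T = D\<close>, the matrix \<open>H\<^sup>\<lambda>\<close> is the identity, and
  \<open>U = F \<Lambda>\<close>. Non resonance bounds the order of the pole of \<open>F\<^sub>j\<^sub>k\<close> at \<open>0\<close> by \<open>(k - j) \<kappa>\<close>, which is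
  less than the decay of \<open>\<Lambda>\<^sub>k / \<Lambda>\<^sub>j\<close>.
\<close>

section \<open>Germs at the origin\<close>

text \<open>The solution is known only near 0, off a sparse set, on a disc that may shrink as q
  tends to 1, whereas the limit lives on a fixed domain; everything must be transported along rays
  by \<open>cont_val\<close>. At a pole \<open>cont_val\<close> is 0, so a bound at a point does not
  show that the point is regular. Estimates are therefore proved at points x whose whole orbit x /
  q^n avoids a countable set, and are then spread by continuity, which at the same time excludes
  poles. Decay is used twice. For fixed q it comes from algebra: with kappa the common exponent,
  F_jk contributes at most q^(n kappa (k-j)) along the orbit and Lambda_k / Lambda_j at most q^(-n
  (1+kappa) (k-j)), so that q^(-n (k-j)) remains whatever the sign of kappa. The constants involved
  depend on q and x without control. This decay only starts the series; the weights (q-1) q^(-n), n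
  >= 1, sum to 1, so the series gives |v_jk(x)| <= (M |x|)^(k-j) with M from (H5), uniformly in q.
  The second bound is what feeds dominated convergence.\<close>

lemma near0_altdef:
  "near0 P \<longleftrightarrow> (\<exists>r>0. \<forall>x. x \<noteq> 0 \<and> norm x < r \<longrightarrow> eventually P (at x))"
proof -
  have "(\<forall>\<^sub>\<approx>z\<in>ball 0 r - {0}. P z) \<longleftrightarrow> (\<forall>x. x \<noteq> 0 \<and> norm x < r \<longrightarrow> eventually P (at x))" for r
    by (subst eventually_cosparse_open_eq) auto
  then show ?thesis unfolding near0_def by simp
qed

text \<open>At a point x other than z, the neighbourhood with z deleted is still a neighbourhood of
  x. This openness is needed because meromorphic identities hold off isolated points only.\<close>

lemma eventually_eventually_at:
  fixes z :: complex
  assumes "eventually P (at z)"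
  shows "eventually (\<lambda>x. eventually P (at x)) (nhds z)"
proof -
  obtain S where S: "open S" "z \<in> S" "\<And>x. x \<in> S \<Longrightarrow> x \<noteq> z \<Longrightarrow> P x"
    using assms unfolding eventually_at_topological by blast
  have "eventually P (at x)" if "x \<in> S" for x
  proof -
    have "eventually (\<lambda>y. y \<in> S - {z}) (at x)"
    proof (cases "x = z")
      case True
      then show ?thesis using S(1,2) by (simp add: eventually_at_topological) blast
    next
      case False
      then have "eventually (\<lambda>y. y \<in> S - {z}) (nhds x)"
        using S(1) that by (intro eventually_nhds_in_open) auto
      then show ?thesis by (auto simp: eventually_at_filter elim: eventually_mono)
    qed
    then show ?thesis by eventually_elim (use S(3) in auto)
  qed
  moreover have "eventually (\<lambda>x. x \<in> S) (nhds z)"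
    using S by (intro eventually_nhds_in_open)
  ultimately show ?thesis by (metis (mono_tags, lifting) eventually_mono)
qed

lemma near0_eventually:
  assumes "eventually P (at 0)"
  shows "near0 P"
proof -
  have "eventually (\<lambda>x. eventually P (at x)) (nhds 0)"
    using assms by (rule eventually_eventually_at)
  then show ?thesis
    unfolding near0_altdef eventually_nhds_metric by (auto simp: dist_norm)
qed

lemma near0_mono:
  assumes "near0 P" "\<And>x. x \<noteq> 0 \<Longrightarrow> P x \<Longrightarrow> Q x"
  shows "near0 Q"
proof -
  obtain r where r: "r > 0" "\<And>x. x \<noteq> 0 \<Longrightarrow> norm x < r \<Longrightarrow> eventually P (at x)"
    using assms(1) unfolding near0_altdef by blast
  have "eventually Q (at x)" if "x \<noteq> 0" "norm x < r" for x
  proof -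
    have "eventually (\<lambda>y. y \<noteq> 0) (at x)"
      using that(1) by (metis eventually_neq_at_within)
    with r(2)[OF that] show ?thesis
      by eventually_elim (use assms(2) in auto)
  qed
  then show ?thesis unfolding near0_altdef using r(1) by blast
qed

lemma near0_conj:
  assumes "near0 P" "near0 Q"
  shows "near0 (\<lambda>x. P x \<and> Q x)"
proof -
  obtain r where r: "r > 0" "\<And>x. x \<noteq> 0 \<Longrightarrow> norm x < r \<Longrightarrow> eventually P (at x)"
    using assms(1) unfolding near0_altdef by blast
  obtain s where s: "s > 0" "\<And>x. x \<noteq> 0 \<Longrightarrow> norm x < s \<Longrightarrow> eventually Q (at x)"
    using assms(2) unfolding near0_altdef by blast
  show ?thesis unfolding near0_altdef
    by (rule exI[of _ "min r s"]) (use r s in \<open>auto intro: eventually_conj\<close>)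
qed

lemma near0_all_less:
  assumes "\<And>j. j < (m::nat) \<Longrightarrow> near0 (P j)"
  shows "near0 (\<lambda>x. \<forall>j<m. P j x)"
  using assms
proof (induction m)
  case 0
  show ?case by (rule near0_eventually) simp
next
  case (Suc m)
  then have "near0 (\<lambda>x. (\<forall>j<m. P j x) \<and> P m x)"
    by (intro near0_conj) auto
  then show ?case by (rule near0_mono) (auto simp: less_Suc_eq)
qed

lemma eventually_at_scale:
  fixes c x :: complex
  assumes "c \<noteq> 0" "eventually P (at (c * x))"
  shows "eventually (\<lambda>y. P (c * y)) (at x)"
proof -
  have "filterlim (\<lambda>y. c * y) (at (c * x)) (at x)"
    unfolding filterlim_at using assms(1)
    by (auto intro!: tendsto_intros simp: eventually_at_filter)
  then show ?thesis using assms(2) unfolding filterlim_iff by blast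
qed

lemma near0_scale:
  fixes c :: complex
  assumes "c \<noteq> 0" "near0 P"
  shows "near0 (\<lambda>x. P (c * x))"
proof -
  obtain r where r: "r > 0" "\<And>x. x \<noteq> 0 \<Longrightarrow> norm x < r \<Longrightarrow> eventually P (at x)"
    using assms(2) unfolding near0_altdef by blast
  have "eventually (\<lambda>y. P (c * y)) (at x)" if "x \<noteq> 0" "norm x < r / norm c" for x
    by (rule eventually_at_scale)
      (use that assms(1) r in \<open>auto simp: norm_mult field_simps intro!: r(2)\<close>)
  then show ?thesis unfolding near0_altdef
    using r(1) assms(1) by (intro exI[of _ "r / norm c"]) auto
qed

lemma cosparse_imp_near0:
  assumes "\<forall>\<^sub>\<approx>z\<in>- {0}. P z"
  shows "near0 P"
proof -
  have "eventually P (at x)" if "x \<noteq> 0" for x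
    using assms that by (subst (asm) eventually_cosparse_open_eq) auto
  then show ?thesis unfolding near0_altdef by (intro exI[of _ 1]) auto
qed

text \<open>The radius is existential because the germ of the solution is only given on a disc
  depending on q.\<close>

definition merom0 :: "(complex \<Rightarrow> complex) \<Rightarrow> bool" where
  "merom0 g \<longleftrightarrow> (\<exists>r>0. g meromorphic_on ball 0 r - {0})"

lemma merom0_near0_cong:
  assumes "near0 (\<lambda>x. h x = g x)" "merom0 g"
  shows "merom0 h"
proof -
  obtain r where r: "r > 0" "\<And>x. x \<noteq> 0 \<Longrightarrow> norm x < r \<Longrightarrow> eventually (\<lambda>x. h x = g x) (at x)"
    using assms(1) unfolding near0_altdef by blast
  obtain s where s: "s > 0" "g meromorphic_on ball 0 s - {0}"
    using assms(2) unfolding merom0_def by blast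
  have "g meromorphic_on ball 0 (min r s) - {0}"
    by (rule meromorphic_on_subset[OF s(2)]) auto
  then have "h meromorphic_on ball 0 (min r s) - {0}"
    by (subst meromorphic_on_cong[where g = g and B = "ball 0 (min r s) - {0}"]) (auto intro: r(2))
  then show ?thesis unfolding merom0_def using r(1) s(1) by (intro exI[of _ "min r s"]) auto
qed

lemma merom0_meromorphic_on: "g meromorphic_on - {0} \<Longrightarrow> merom0 g"
  unfolding merom0_def by (intro exI[of _ 1]) (auto intro: meromorphic_on_subset)

lemma merom0_mult: "merom0 f \<Longrightarrow> merom0 g \<Longrightarrow> merom0 (\<lambda>x. f x * g x)"
  and merom0_divide: "merom0 f \<Longrightarrow> merom0 g \<Longrightarrow> merom0 (\<lambda>x. f x / g x)"
proof -
  assume "merom0 f" "merom0 g"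
  then obtain r s where "r > 0" "f meromorphic_on ball 0 r - {0}" "s > 0" "g meromorphic_on ball 0 s - {0}"
    unfolding merom0_def by blast
  then have "min r s > 0" "f meromorphic_on ball 0 (min r s) - {0}" "g meromorphic_on ball 0 (min r s) - {0}"
    by (auto intro: meromorphic_on_subset)
  then show "merom0 (\<lambda>x. f x * g x)" "merom0 (\<lambda>x. f x / g x)"
    unfolding merom0_def by (intro exI[of _ "min r s"]; simp add: meromorphic_on_mult meromorphic_on_divide)+
qed

lemma merom0_id: "merom0 (\<lambda>x. x)"
  by (intro merom0_meromorphic_on meromorphic_intros)

lemma merom0_scale:
  assumes "merom0 g" "c \<noteq> 0"
  shows "merom0 (\<lambda>x. g (c * x))"
proof -
  obtain s where s: "s > 0" "g meromorphic_on ball 0 s - {0}"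
    using assms(1) unfolding merom0_def by blast
  have "(\<lambda>x. g (c * x)) meromorphic_on ball 0 (s / norm c) - {0}"
    by (rule meromorphic_on_compose[OF s(2)])
      (use assms(2) in \<open>auto simp: norm_mult field_simps intro!: analytic_intros\<close>)
  then show ?thesis unfolding merom0_def using s(1) assms(2) by (intro exI[of _ "s / norm c"]) auto
qed

lemma merom0_eval_fls:
  assumes "fls_conv_radius G > 0"
  shows "merom0 (eval_fls G)"
proof -
  obtain r :: real where r: "r > 0" "ereal r < fls_conv_radius G"
    using ereal_dense2[of 0 "fls_conv_radius G"] assms by (auto simp: zero_ereal_def)
  have "eval_fls G meromorphic_on ball 0 r - {0}"
  proof -
    have "ball (0::complex) r - {0} \<subseteq> eball 0 (fls_conv_radius G) - (if fls_subdegree G \<ge> 0 then {} else {0})"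
    proof (rule subsetI)
      fix x :: complex assume x: "x \<in> ball 0 r - {0}"
      then have "ereal (norm x) < ereal r" by simp
      also note r(2)
      finally show "x \<in> eball 0 (fls_conv_radius G) - (if fls_subdegree G \<ge> 0 then {} else {0})"
        using x by (simp add: in_eball_iff)
    qed
    then show ?thesis by (intro analytic_on_imp_meromorphic_on analytic_on_eval_fls)
  qed
  then show ?thesis unfolding merom0_def using r(1) by blast
qed

section \<open>Continuation along rays\<close>

text \<open>Domains star-shaped about the origin with the origin removed: the segments ]0,x] used by
  \<open>continuation\<close> and the orbits x / q^n stay inside.\<close>

definition ray_star :: "complex set \<Rightarrow> bool" where
  "ray_star X \<longleftrightarrow> open X \<and> 0 \<notin> X \<and> (\<forall>x\<in>X. \<forall>t\<in>{0<..1}. of_real t * x \<in> X)"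

lemma ray_star_Int: "ray_star X \<Longrightarrow> ray_star Y \<Longrightarrow> ray_star (X \<inter> Y)"
  unfolding ray_star_def by auto

lemma ray_star_ball: "ray_star (ball 0 r - {0})"
  unfolding ray_star_def
proof (intro conjI ballI)
  fix x :: complex and t :: real
  assume "x \<in> ball 0 r - {0}" "t \<in> {0<..1}"
  then have *: "t \<le> 1" "norm x < r" "x \<noteq> 0" "t > 0" by auto
  have "t * norm x \<le> 1 * norm x" by (rule mult_right_mono) (use * in auto)
  moreover have "norm (of_real t * x) = t * norm x" using * by (simp add: norm_mult)
  ultimately have "norm (of_real t * x) < r" using *(2) by linarith
  with * show "of_real t * x \<in> ball 0 r - {0}" by simp
qed auto

text \<open>A nicely meromorphic function takes its limit at a regular point and 0 at a pole, so its
  value is determined by the punctured germ.\<close>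

lemma nicely_meromorphic_eqI:
  assumes "f nicely_meromorphic_on {z}" "g nicely_meromorphic_on {z}"
    and "eventually (\<lambda>x. f x = g x) (at z)"
  shows "f z = g z"
proof -
  have pole: "is_pole f z \<longleftrightarrow> is_pole g z"
    using assms(3) by (intro is_pole_cong) auto
  have lim: "(f \<longlongrightarrow> l) (at z) \<longleftrightarrow> (g \<longlongrightarrow> l) (at z)" for l
    using assms(3) by (rule tendsto_cong)
  have no: "\<not> (f \<longlongrightarrow> l) (at z)" if "is_pole f z" for l
    using that unfolding is_pole_def by (meson at_neq_bot not_tendsto_and_filterlim_at_infinity)
  show ?thesis
  proof (cases "is_pole f z")
    case True
    then show ?thesis
      using assms(1,2) pole lim no unfolding nicely_meromorphic_on_def by auto
  next
    case False
    then have "(f \<longlongrightarrow> f z) (at z)" "(f \<longlongrightarrow> g z) (at z)"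
      using assms(1,2) pole lim unfolding nicely_meromorphic_on_def by auto
    then show ?thesis by (meson at_neq_bot tendsto_unique)
  qed
qed

text \<open>Connectedness of ]0,1]: by the dichotomy for Laurent expansions, near each point of the
  segment the difference either vanishes identically or has no zero in a punctured neighbourhood, so
  the parameters of the first kind form an open and closed set. Agreement near 0 makes it
  nonempty.\<close>

lemma meromorphic_identity_ray:
  assumes f: "f meromorphic_on ((\<lambda>t. of_real t * z) ` {0<..1})"
    and g: "g meromorphic_on ((\<lambda>t. of_real t * z) ` {0<..1})"
    and eq: "near0 (\<lambda>x. f x = g x)" and z: "z \<noteq> 0"
  shows "eventually (\<lambda>x. f x = g x) (at z)"
proof -
  let ?D = "\<lambda>x. f x - g x"
  let ?P = "\<lambda>t::real. eventually (\<lambda>x. ?D x = 0) (at (of_real t * z))"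
  obtain r where r: "r > 0" "\<And>x. x \<noteq> 0 \<Longrightarrow> norm x < r \<Longrightarrow> eventually (\<lambda>x. f x = g x) (at x)"
    using eq unfolding near0_altdef by blast
  \<comment> \<open>The factor 2 puts \<open>t0 * z\<close> strictly inside the ball where f and g
    agree.\<close>
  define t0 where "t0 = min 1 (r / (2 * norm z))"
  have t0: "t0 \<in> {0<..1}" using r(1) z by (auto simp: t0_def)
  have "t0 * norm z \<le> r / (2 * norm z) * norm z"
    by (intro mult_right_mono) (auto simp: t0_def)
  also have "\<dots> < r" using r(1) z by (simp add: field_simps)
  finally have "norm (of_real t0 * z) < r" using t0 by (simp add: norm_mult)
  then have Pt0: "?P t0"
    using r(2)[of "of_real t0 * z"] t0 z by auto
  have "?P 1"
  proof (rule connected_induction_simple[where S = "{0<..1::real}" and P = ?P and a = t0])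
    show "connected {0<..1::real}" by simp
    show "t0 \<in> {0<..1}" "(1::real) \<in> {0<..1}" using t0 by auto
    show "?P t0" by fact
    fix t :: real assume t: "t \<in> {0<..1}"
    have mer: "?D meromorphic_on {of_real t * z}"
      by (rule meromorphic_on_diff; rule meromorphic_on_subset[OF f] meromorphic_on_subset[OF g])
        (use t in auto)
    have cont: "continuous_on UNIV (\<lambda>t. of_real t * z)" by (intro continuous_intros)
    have dich: "eventually (\<lambda>x. ?D x = 0) (at (of_real t * z)) \<or> eventually (\<lambda>x. ?D x \<noteq> 0) (at (of_real t * z))"
    proof -
      obtain F where F: "(\<lambda>w. ?D (of_real t * z + w)) has_laurent_expansion F"
        using mer unfolding meromorphic_on_def by blast
      show ?thesis
      proof (cases "F = 0")
        case True
        then have "eventually (\<lambda>w. ?D (of_real t * z + w) = 0) (at 0)"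
          using F unfolding has_laurent_expansion_def by (auto elim: eventually_mono)
        then show ?thesis
          by (subst (1) at_to_0) (simp add: eventually_filtermap add.commute)
      next
        case False
        then show ?thesis
          using has_laurent_expansion_eventually_nonzero_iff[OF F] by blast
      qed
    qed
    show "\<exists>T. openin (top_of_set {0<..1}) T \<and> t \<in> T \<and> (\<forall>x\<in>T. \<forall>y\<in>T. ?P x \<longrightarrow> ?P y)"
      using dich
    proof
      assume "eventually (\<lambda>x. ?D x = 0) (at (of_real t * z))"
      from eventually_eventually_at[OF this] obtain S where S: "open S" "of_real t * z \<in> S"
        "\<And>x. x \<in> S \<Longrightarrow> eventually (\<lambda>x. ?D x = 0) (at x)"
        unfolding eventually_nhds by blast
      have "open ((\<lambda>t. of_real t * z) -` S)"
        using open_vimage[OF S(1) cont] .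
      then show ?thesis
        using S t by (intro exI[of _ "{0<..1} \<inter> (\<lambda>t. of_real t * z) -` S"]) (auto simp: openin_open)
    next
      assume ne: "eventually (\<lambda>x. ?D x \<noteq> 0) (at (of_real t * z))"
      from eventually_eventually_at[OF ne] obtain S where S: "open S" "of_real t * z \<in> S"
        "\<And>x. x \<in> S \<Longrightarrow> eventually (\<lambda>x. ?D x \<noteq> 0) (at x)"
        unfolding eventually_nhds by blast
      have "open ((\<lambda>t. of_real t * z) -` S)"
        using open_vimage[OF S(1) cont] .
      moreover have "\<not> eventually (\<lambda>x. ?D x = 0) (at x)" if "x \<in> S" for x
      proof
        assume "eventually (\<lambda>x. ?D x = 0) (at x)"
        with S(3)[OF that] have "eventually (\<lambda>x. False) (at x)" by eventually_elim auto
        then show False by simp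
      qed
      ultimately show ?thesis
        using S t by (intro exI[of _ "{0<..1} \<inter> (\<lambda>t. of_real t * z) -` S"]) (auto simp: openin_open)
    qed
  qed
  then show ?thesis by simp
qed

lemma meromorphic_identity:
  assumes "ray_star X" "f meromorphic_on X" "g meromorphic_on X" "near0 (\<lambda>x. f x = g x)" "z \<in> X"
  shows "eventually (\<lambda>x. f x = g x) (at z)"
proof (rule meromorphic_identity_ray)
  have sub: "(\<lambda>t. of_real t * z) ` {0<..1} \<subseteq> X" and "z \<noteq> 0"
    using assms(1,5) unfolding ray_star_def by auto
  show "f meromorphic_on (\<lambda>t. of_real t * z) ` {0<..1}" "g meromorphic_on (\<lambda>t. of_real t * z) ` {0<..1}"
    using sub assms(2,3) meromorphic_on_subset by blast+
  show "z \<noteq> 0" by fact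
qed fact

text \<open>The description in \<open>cont_val\<close> is unique by the identity theorem along the
  ray: two continuations agree in a punctured neighbourhood of z and, being nicely meromorphic, at z
  itself.\<close>

lemma cont_val_eq:
  assumes h: "continuation g z h" and z: "z \<noteq> 0"
  shows "cont_val g z = h z"
  unfolding cont_val_def
proof (rule the_equality)
  show "\<exists>h'. continuation g z h' \<and> h z = h' z" using h by blast
  fix c assume "\<exists>h. continuation g z h \<and> c = h z"
  then obtain k where k: "continuation g z k" "c = k z" by blast
  have near: "near0 (\<lambda>x. k x = h x)"
    by (rule near0_mono[OF near0_conj[of "\<lambda>x. k x = g x" "\<lambda>x. h x = g x"]])
      (use h k in \<open>auto simp: continuation_def\<close>)
  have "eventually (\<lambda>x. k x = h x) (at z)"
    by (rule meromorphic_identity_ray[OF _ _ near z])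
      (use h k in \<open>auto simp: continuation_def nicely_meromorphic_on_def\<close>)
  moreover have "{z} \<subseteq> (\<lambda>t. of_real t * z) ` {0<..1}"
    using image_eqI[of z "\<lambda>t. of_real t * z" 1] by auto
  ultimately show "c = h z"
    unfolding k(2) using h k(1) unfolding continuation_def
    by (intro nicely_meromorphic_eqI) (auto intro: nicely_meromorphic_on_subset)
qed

lemma cont_val_remove_sings:
  assumes X: "ray_star X" and h: "h meromorphic_on X" "near0 (\<lambda>x. h x = g x)"
    and g: "merom0 g" and z: "z \<in> X"
  shows "continues_to g z" "cont_val g z = remove_sings h z"
proof -
  have "near0 (\<lambda>x. remove_sings h x = h x)"
  proof -
    obtain r where r: "r > 0" "h meromorphic_on ball 0 r - {0}"
      using merom0_near0_cong[OF h(2) g] unfolding merom0_def by blast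
    then show ?thesis
      unfolding near0_def using eventually_remove_sings_eq[OF r(2)] by blast
  qed
  from near0_conj[OF this h(2)] have near: "near0 (\<lambda>x. remove_sings h x = g x)"
    by (rule near0_mono) auto
  have "(\<lambda>t. of_real t * z) ` {0<..1} \<subseteq> X"
    using X z unfolding ray_star_def by auto
  then have c: "continuation g z (remove_sings h)"
    unfolding continuation_def using near h(1)
    by (auto intro: remove_sings_nicely_meromorphic meromorphic_on_subset)
  then show "continues_to g z" unfolding continues_to_def by blast
  show "cont_val g z = remove_sings h z"
    by (rule cont_val_eq[OF c]) (use X z in \<open>auto simp: ray_star_def\<close>)
qed

text \<open>The segment is not open, so it is thickened. Its part near 0 lies in a punctured disc
  where h inherits meromorphy from g, and the compact remainder has a tube of fixed radius inside
  the domain of h. Shrinking one ball around z towards 0 gives a star-shaped set covered by the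
  two.\<close>

lemma continuation_ray_star:
  assumes h: "continuation g z h" and z: "z \<noteq> 0" and g: "merom0 g"
  obtains X where "ray_star X" "z \<in> X" "h meromorphic_on X"
proof -
  have "merom0 h"
    by (rule merom0_near0_cong[OF _ g]) (use h in \<open>simp add: continuation_def\<close>)
  then obtain r where r: "r > 0" "h meromorphic_on ball 0 r - {0}"
    unfolding merom0_def by blast
  have "h meromorphic_on (\<lambda>t. of_real t * z) ` {0<..1}"
    using h unfolding continuation_def nicely_meromorphic_on_def by blast
  then obtain B where B: "open B" "(\<lambda>t. of_real t * z) ` {0<..1} \<subseteq> B" "h meromorphic_on B"
    by (rule meromorphic_on_open_nhd)
  \<comment> \<open>For t < s and |y| < |z| + 1 the point t y lies in the disc of radius r.\<close>
  define s where "s = min 1 (r / (norm z + 1))"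
  have s: "0 < s" "s \<le> 1" using r(1) by (auto simp: s_def add_nonneg_pos)
  have sr: "s * (norm z + 1) \<le> r"
  proof -
    have "s * (norm z + 1) \<le> r / (norm z + 1) * (norm z + 1)"
      by (intro mult_right_mono) (auto simp: s_def)
    also have "\<dots> = r" using norm_ge_zero[of z] by (simp add: field_simps add_nonneg_eq_0_iff)
    finally show ?thesis .
  qed
  let ?C = "(\<lambda>t. of_real t * z) ` {s..1}"
  have "compact ?C" by (intro compact_continuous_image continuous_intros) auto
  moreover have "?C \<subseteq> B" using B(2) s by force
  ultimately obtain e where e: "e > 0" "(\<Union>x\<in>?C. cball x e) \<subseteq> B"
    by (rule compact_subset_open_imp_cball_epsilon_subset[OF _ B(1)])
  \<comment> \<open>At most e for the tube, at most |z| so that 0 is not in X, at most 1 for the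
    estimate |y| < |z| + 1.\<close>
  define \<delta> where "\<delta> = Min {e, norm z, 1}"
  have \<delta>: "\<delta> > 0" "\<delta> \<le> e" "\<delta> \<le> norm z" "\<delta> \<le> 1" using e z by (auto simp: \<delta>_def)
  define X where "X = (\<Union>t\<in>{0<..1}. (\<lambda>x. t *\<^sub>R x) ` ball z \<delta>)"
  have "open X" unfolding X_def
    by (intro open_UN ballI open_scaling open_ball) auto
  moreover have "0 \<notin> X" unfolding X_def using \<delta>(3) by (auto simp: dist_norm)
  moreover have "of_real t * x \<in> X" if x: "x \<in> X" and t: "t \<in> {0<..1}" for x t
  proof -
    obtain u y where u: "u \<in> {0<..1}" "y \<in> ball z \<delta>" "x = of_real u * y"
      using x unfolding X_def scaleR_conv_of_real by blast
    have "of_real t * x = of_real (t * u) * y" using u by simp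
    moreover have "t * u \<in> {0<..1}"
      using t u(1) by (auto intro: mult_le_one)
    ultimately show ?thesis using u(2) unfolding X_def scaleR_conv_of_real by blast
  qed
  ultimately have "ray_star X" unfolding ray_star_def by blast
  moreover have "z \<in> X" unfolding X_def
    using \<delta>(1) by (intro UN_I[of 1]) auto
  moreover have "X \<subseteq> B \<union> (ball 0 r - {0})"
  proof
    fix x assume "x \<in> X"
    then obtain t y where t: "t \<in> {0<..1}" "y \<in> ball z \<delta>" "x = of_real t * y"
      unfolding X_def scaleR_conv_of_real by blast
    show "x \<in> B \<union> (ball 0 r - {0})"
    proof (cases "t < s")
      case False
      have "dist (of_real t * z) x = t * dist z y"
        using t by (simp add: dist_norm norm_mult flip: right_diff_distrib)
      also have "\<dots> \<le> 1 * dist z y" using t by (intro mult_right_mono) auto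
      also have "\<dots> \<le> e" using t(2) \<delta>(2) by auto
      finally have "x \<in> cball (of_real t * z) e" by simp
      moreover have "of_real t * z \<in> ?C" using False t(1) by auto
      ultimately show ?thesis using e(2) by blast
    next
      case True
      have "norm y \<le> norm z + norm (y - z)" using norm_triangle_sub[of y z] by simp
      also have "\<dots> < norm z + 1" using t(2) \<delta>(4) by (auto simp: dist_norm norm_minus_commute)
      finally have y: "norm y < norm z + 1" .
      have "norm x = t * norm y" using t by (simp add: norm_mult)
      also have "\<dots> \<le> s * norm y" using True by (intro mult_right_mono) auto
      also have "\<dots> < s * (norm z + 1)" using y s by simp
      finally have "norm x < r" using sr by linarith
      moreover have "x \<noteq> 0" using \<open>0 \<notin> X\<close> \<open>x \<in> X\<close> by blast
      ultimately show ?thesis by auto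
    qed
  qed
  then have "h meromorphic_on X"
    by (rule meromorphic_on_subset[rotated]) (use B(3) r(2) in \<open>simp add: meromorphic_on_Un\<close>)
  ultimately show ?thesis using that by blast
qed

text \<open>For a germ with \<open>merom0 g\<close> this is the union of all star-shaped domains of
  continuation and is a \<open>ray_star\<close> itself, hence a single domain on which
  \<open>cont_val g\<close> can be studied.\<close>

definition cont_dom :: "(complex \<Rightarrow> complex) \<Rightarrow> complex set" where
  "cont_dom g = {z. z \<noteq> 0 \<and> continues_to g z}"

lemma ray_star_subset_cont_dom:
  assumes "ray_star X" "h meromorphic_on X" "near0 (\<lambda>x. h x = g x)" "merom0 g"
  shows "X \<subseteq> cont_dom g"
  using cont_val_remove_sings(1)[OF assms] assms(1) unfolding cont_dom_def ray_star_def by auto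

lemma ray_star_cont_dom:
  assumes "merom0 g"
  shows "ray_star (cont_dom g)"
proof -
  have ex: "\<exists>X. ray_star X \<and> z \<in> X \<and> X \<subseteq> cont_dom g" if "z \<in> cont_dom g" for z
  proof -
    from that obtain h where h: "continuation g z h" "z \<noteq> 0"
      unfolding cont_dom_def continues_to_def by blast
    obtain X where X: "ray_star X" "z \<in> X" "h meromorphic_on X"
      using continuation_ray_star[OF h assms] .
    have "X \<subseteq> cont_dom g"
      using ray_star_subset_cont_dom[OF X(1,3)] h(1) assms unfolding continuation_def by blast
    with X show ?thesis by blast
  qed
  have "open (cont_dom g)"
  proof (subst open_subopen, rule ballI)
    fix z assume "z \<in> cont_dom g"
    from ex[OF this] obtain X where "ray_star X" "z \<in> X" "X \<subseteq> cont_dom g" by blast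
    then show "\<exists>T. open T \<and> z \<in> T \<and> T \<subseteq> cont_dom g"
      unfolding ray_star_def by (intro exI[of _ X]) simp
  qed
  moreover have "of_real t * x \<in> cont_dom g" if "x \<in> cont_dom g" "t \<in> {0<..1}" for x t
    using ex[OF that(1)] that(2) unfolding ray_star_def by blast
  ultimately show ?thesis unfolding ray_star_def cont_dom_def by auto
qed

text \<open>Locally \<open>cont_val g\<close> coincides with \<open>remove_sings\<close> of one
  continuation on a \<open>ray_star\<close>, and being nicely meromorphic is a local
  property.\<close>

lemma cont_val_nicely_meromorphic:
  assumes "merom0 g"
  shows "cont_val g nicely_meromorphic_on cont_dom g"
proof -
  have *: "cont_val g nicely_meromorphic_on {z}" if "z \<in> cont_dom g" for z
  proof -
    from that obtain h where h: "continuation g z h" "z \<noteq> 0"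
      unfolding cont_dom_def continues_to_def by blast
    obtain X where X: "ray_star X" "z \<in> X" "h meromorphic_on X"
      using continuation_ray_star[OF h assms] .
    have eq: "cont_val g x = remove_sings h x" if "x \<in> X" for x
      using cont_val_remove_sings(2)[OF X(1,3) _ assms that] h(1) unfolding continuation_def by blast
    have "eventually (\<lambda>x. x \<in> X) (nhds z)"
      using X by (intro eventually_nhds_in_open) (auto simp: ray_star_def)
    then have ev: "eventually (\<lambda>x. cont_val g x = remove_sings h x) (nhds z)"
      by eventually_elim (rule eq)
    have ev': "eventually (\<lambda>x. cont_val g x = remove_sings h x) (at z)"
      using ev by (rule eventually_nhds_conv_at[THEN iffD1, THEN conjunct1])
    have nm: "remove_sings h nicely_meromorphic_on {z}"
      by (rule remove_sings_nicely_meromorphic) (use X in \<open>auto intro: meromorphic_on_subset\<close>)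
    have "cont_val g meromorphic_on {z}"
      using nm ev' unfolding nicely_meromorphic_on_def
      by (subst meromorphic_on_cong[where g = "remove_sings h" and B = "{z}"]) auto
    moreover have "is_pole (cont_val g) z \<longleftrightarrow> is_pole (remove_sings h) z"
      using ev' by (intro is_pole_cong) auto
    moreover have "(cont_val g \<longlongrightarrow> l) (at z) \<longleftrightarrow> (remove_sings h \<longlongrightarrow> l) (at z)" for l
      using ev' by (rule tendsto_cong)
    moreover have "cont_val g z = remove_sings h z" by (rule eq[OF X(2)])
    ultimately show ?thesis
      using nm unfolding nicely_meromorphic_on_def by auto
  qed
  show ?thesis
    unfolding nicely_meromorphic_on_def
  proof (intro conjI ballI)
    show "cont_val g meromorphic_on cont_dom g"
      using * unfolding nicely_meromorphic_on_def meromorphic_on_def by blast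
  qed (use * in \<open>auto simp: nicely_meromorphic_on_def\<close>)
qed

lemma near0_cont_val:
  assumes "merom0 g"
  shows "near0 (\<lambda>x. cont_val g x = g x)"
proof -
  obtain r where r: "r > 0" "g meromorphic_on ball 0 r - {0}"
    using assms unfolding merom0_def by blast
  have 1: "cont_val g x = remove_sings g x" if "x \<in> ball 0 r - {0}" for x
    by (rule cont_val_remove_sings(2)[OF ray_star_ball r(2) _ assms that])
      (auto intro!: near0_eventually)
  have "\<forall>\<^sub>\<approx>x\<in>ball 0 r - {0}. cont_val g x = g x"
    using eventually_remove_sings_eq[OF r(2)] eventually_in_cosparse[of "ball 0 r - {0}" "ball 0 r - {0}"]
    by (auto elim!: eventually_elim2 simp: 1 open_delete)
  then show ?thesis unfolding near0_def using r(1) by blast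
qed

lemma cont_val_eq_analytic:
  assumes X: "ray_star X" and h: "h meromorphic_on X" "near0 (\<lambda>x. h x = g x)"
    and g: "merom0 g" and z: "z \<in> X" "h analytic_on {z}"
  shows "cont_val g z = h z" "cont_val g analytic_on {z}"
proof -
  show "cont_val g z = h z"
    using cont_val_remove_sings(2)[OF X h g z(1)] z(2) by simp
  have "eventually (\<lambda>x. x \<in> X) (nhds z)"
    using X z by (intro eventually_nhds_in_open) (auto simp: ray_star_def)
  moreover have "eventually (\<lambda>x. remove_sings h x = h x) (nhds z)"
    using z(2) by (rule eventually_remove_sings_eq_nhds)
  ultimately have "eventually (\<lambda>x. cont_val g x = h x) (nhds z)"
    by eventually_elim (use cont_val_remove_sings(2)[OF X h g] in auto)
  then show "cont_val g analytic_on {z}"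
    using z(2) analytic_at_cong by blast
qed

text \<open>Exceptional sets are kept countable rather than sparse: the dilates of a sparse set by
  the powers of q may accumulate, but countability survives the union over all powers.\<close>

lemma countable_not_eventually:
  fixes X :: "complex set"
  assumes "open X" "\<And>x. x \<in> X \<Longrightarrow> eventually P (at x)"
  shows "countable {x \<in> X. \<not> P x}"
proof -
  have "{x. \<not> P x} sparse_in X"
    using assms by (subst sparse_in_eventually_iff) auto
  from sparse_imp_countable[OF assms(1) this] show ?thesis
    by (rule back_subst[of countable]) auto
qed

section \<open>The system near the origin for fixed \<open>q\<close>\<close>

text \<open>\<open>inverts_mat\<close> does not fix the size of the inverse R; the two products
  determine it, after which R can be cancelled.\<close>

lemma gauge_relD:
  assumes "gauge_rel P' P B C" "P \<in> carrier_mat m m" "P' \<in> carrier_mat m m" "B \<in> carrier_mat m m"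
  shows "C * P = P' * B"
proof -
  obtain R where R: "inverts_mat P R" "inverts_mat R P" "C = P' * B * R"
    using assms(1) unfolding gauge_rel_def by blast
  have PR: "P * R = 1\<^sub>m m" and RP: "R * P = 1\<^sub>m (dim_row R)"
    using R(1,2) assms(2) unfolding inverts_mat_def by auto
  have "dim_col R = m" using arg_cong[OF PR, of dim_col] by simp
  moreover have "dim_row R = m" using arg_cong[OF RP, of dim_col] assms(2) by simp
  ultimately have Rc: "R \<in> carrier_mat m m" by auto
  have "C * P = P' * B * (R * P)"
    unfolding R(3) using assms Rc by (simp add: assoc_mult_mat[of _ m m _ m _ m])
  also have "\<dots> = P' * B"
    unfolding RP using assms Rc by simp
  finally show ?thesis .
qed

lemma mat_mult_entry:
  assumes "A \<in> carrier_mat m m" "B \<in> carrier_mat m m" "i < m" "j < m"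
  shows "(A * B) $$ (i,j) = (\<Sum>l<m. A $$ (i,l) * B $$ (l,j))"
  using assms by (auto simp: scalar_prod_def lessThan_atLeast0 intro!: sum.cong)

lemma sum_single:
  assumes "finite A" "i \<in> A" "\<And>l. l \<in> A \<Longrightarrow> l \<noteq> i \<Longrightarrow> f l = 0"
  shows "sum f A = (f i :: 'a :: comm_monoid_add)"
  using assms sum.mono_neutral_right[of A "{i}" f] by auto

text \<open>F is normalised only through F H = G. Solving column by column against the unitriangular
  H shows that F inherits the zeros and the normalised diagonal of G.\<close>

lemma upper_triangular_of_mult:
  fixes F H G :: "'a :: semiring_1 mat"
  assumes c: "F \<in> carrier_mat m m" "H \<in> carrier_mat m m"
    and H: "\<And>i j. i < m \<Longrightarrow> j < m \<Longrightarrow> j \<le> i \<Longrightarrow> H $$ (i,j) = (if i = j then 1 else 0)"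
    and G: "F * H = G" "\<And>i j. i < m \<Longrightarrow> j < i \<Longrightarrow> G $$ (i,j) = 0"
    and ij: "i < m" "j \<le> i"
  shows "F $$ (i,j) = G $$ (i,j)"
  using ij
proof (induction j rule: less_induct)
  case (less j)
  have "G $$ (i,j) = (\<Sum>l<m. F $$ (i,l) * H $$ (l,j))"
    unfolding G(1)[symmetric] by (rule mat_mult_entry[OF c]) (use less in auto)
  also have "\<dots> = F $$ (i,j) * H $$ (j,j)"
  proof (rule sum_single)
    fix l assume l: "l \<in> {..<m}" "l \<noteq> j"
    show "F $$ (i,l) * H $$ (l,j) = 0"
    proof (cases "l < j")
      case True
      then show ?thesis using less l G(2)[of i l] by simp
    next
      case False
      then show ?thesis using H[of l j] l less.prems by auto
    qed
  qed (use less.prems in auto)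
  finally show ?case using H[of j j] less.prems by auto
qed

lemma eval_fls_eventually_eq:
  assumes "f has_laurent_expansion F" shows "near0 (\<lambda>x. eval_fls F x = f x)"
  using assms unfolding has_laurent_expansion_def by (intro near0_eventually) auto

lemma fls_sigma_has_laurent_expansion:
  assumes "f has_laurent_expansion F" "q > 0"
  shows "(\<lambda>x. f (of_real q * x)) has_laurent_expansion fls_sigma q F"
proof -
  have "(\<lambda>x. of_real q * x) has_laurent_expansion fps_to_fls (fps_const (of_real q) * fps_X)"
    by (simp add: fls_times_fps_to_fls has_laurent_expansion_fps_X has_laurent_expansion_cmult_left)
  from has_laurent_expansion_compose[OF assms(1) this] show ?thesis
    using assms(2) unfolding fls_sigma_def o_def by simp
qed

lemma fls_sigma_nth:
  "q > 0 \<Longrightarrow> fls_nth (fls_sigma q F) n = fls_nth F n * of_real q powi n"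
  unfolding fls_sigma_def by (rule fls_nth_fls_compose_fps_linear) auto

lemma X_intpow_has_laurent_expansion:
  "(\<lambda>x. t * x powi n) has_laurent_expansion fls_const t * fls_X_intpow n"
proof -
  have "(\<lambda>x::complex. x powi n) has_laurent_expansion fls_X_intpow n"
    using has_laurent_expansion_fps_X_power_int[of n] by simp
  then show ?thesis by (intro laurent_expansion_intros)
qed

lemma eval_fls_X_intpow:
  assumes "x \<noteq> 0" shows "eval_fls (fls_const t * fls_X_intpow n) x = t * x powi n"
proof -
  have "fls_const t * fls_X_intpow n = fls_shift (-n) (fls_const t)"
    by (simp add: fls_shifted_times_simps(1) fls_X_intpow_times_conv_shift)
  then show ?thesis using assms by (simp add: eval_fls_shift)
qed

lemma tau_nonzero:
  "1 + fls_const (of_real (q - 1)) * f q j \<noteq> 0 \<Longrightarrow> tau f q j \<noteq> 0"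
  unfolding tau_def t0_def by (rule nth_fls_subdegree_nonzero)

lemma Lambda_properties:
  assumes "is_Lambda m f q L"
  shows "\<And>j. j < m \<Longrightarrow> (\<lambda>x. L x $$ (j,j)) meromorphic_on - {0}"
    and "\<forall>\<^sub>\<approx>x\<in>- {0}. L x \<in> carrier_mat m m \<and> diagonal_mat (L x) \<and> (\<forall>j<m. L x $$ (j,j) \<noteq> 0 \<and>
          L (of_real q * x) $$ (j,j) = tau f q j * x powi kappa f q j * L x $$ (j,j))"
proof -
  have c: "\<And>x. L x \<in> carrier_mat m m"
    and inv: "\<forall>\<^sub>\<approx>x\<in>- {0}. invertible_mat (L x)"
    and d: "\<forall>\<^sub>\<approx>x\<in>- {0}. diagonal_mat (L x) \<and> L (of_real q * x) = eval_mat (Dq m f q) x * L x \<and>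
        eval_mat (Dq m f q) x * L x = L x * eval_mat (Dq m f q) x"
    and mer: "\<And>j. j < m \<Longrightarrow> (\<lambda>x. L x $$ (j,j)) meromorphic_on - {0}"
    using assms unfolding is_Lambda_def GL_merom_def by auto
  show "\<And>j. j < m \<Longrightarrow> (\<lambda>x. L x $$ (j,j)) meromorphic_on - {0}" by fact
  have n0: "\<forall>\<^sub>\<approx>x\<in>- {0::complex}. x \<noteq> 0"
    using eventually_in_cosparse[of "- {0::complex}" "- {0}"] by auto
  show "\<forall>\<^sub>\<approx>x\<in>- {0}. L x \<in> carrier_mat m m \<and> diagonal_mat (L x) \<and> (\<forall>j<m. L x $$ (j,j) \<noteq> 0 \<and>
          L (of_real q * x) $$ (j,j) = tau f q j * x powi kappa f q j * L x $$ (j,j))"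
    using inv d n0
  proof eventually_elim
    case (elim x)
    have D: "eval_mat (Dq m f q) x \<in> carrier_mat m m" by (simp add: eval_mat_def Dq_def)
    obtain B where B: "inverts_mat (L x) B" "inverts_mat B (L x)"
      using elim(1) unfolding invertible_mat_def by blast
    have LB: "L x * B = 1\<^sub>m m" and BL: "B * L x = 1\<^sub>m (dim_row B)"
      using B c[of x] unfolding inverts_mat_def by auto
    have "dim_col B = m" using arg_cong[OF LB, of dim_col] by simp
    moreover have "dim_row B = m" using arg_cong[OF BL, of dim_col] c[of x] by simp
    ultimately have Bc: "B \<in> carrier_mat m m" by auto
    have diag: "L x $$ (i,j) = 0" if "i < m" "j < m" "i \<noteq> j" for i j
      using elim(2) c[of x] that unfolding diagonal_mat_def by auto
    have "L x $$ (j,j) \<noteq> 0" if "j < m" for j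
    proof -
      have "1 = (\<Sum>l<m. L x $$ (j,l) * B $$ (l,j))"
        using mat_mult_entry[OF c[of x] Bc that that] that LB by simp
      also have "\<dots> = L x $$ (j,j) * B $$ (j,j)"
        using that by (intro sum_single) (auto simp: diag)
      finally show ?thesis by auto
    qed
    moreover have "L (of_real q * x) $$ (j,j) = tau f q j * x powi kappa f q j * L x $$ (j,j)"
      if "j < m" for j
    proof -
      have "L (of_real q * x) $$ (j,j) = (\<Sum>l<m. eval_mat (Dq m f q) x $$ (j,l) * L x $$ (l,j))"
        using elim(2) mat_mult_entry[OF D c[of x] that that] by simp
      also have "\<dots> = eval_mat (Dq m f q) x $$ (j,j) * L x $$ (j,j)"
        using that by (intro sum_single) (auto simp: diag)
      also have "eval_mat (Dq m f q) x $$ (j,j) = tau f q j * x powi kappa f q j"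
        using that elim(3) by (simp add: eval_mat_def Dq_def eval_fls_X_intpow)
      finally show ?thesis .
    qed
    ultimately show ?case using c elim(2) by auto
  qed
qed

text \<open>As the exponents are sorted, block unipotent matrices are upper unitriangular, which
  settles the diagonal and the zeros below it. The last two facts are conditional on a common
  exponent, when \<open>block_unipotent\<close> forces \<open>Hl\<close> to be the identity and
  \<open>is_T\<close> forces T = D; that condition is itself deduced later from the unconditional
  part.\<close>

lemma U_structure:
  fixes f :: "real \<Rightarrow> nat \<Rightarrow> complex fls"
  assumes U: "is_U m f q lam L U" and L: "is_Lambda m f q L"
    and sorted: "\<And>j k. j < k \<Longrightarrow> k < m \<Longrightarrow> kappa f q j \<le> kappa f q k"
  obtains F where
    "\<And>i j. i < m \<Longrightarrow> j < m \<Longrightarrow> fls_conv_radius (F i j) > 0"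
    "\<And>i j. i < m \<Longrightarrow> j < i \<Longrightarrow> F i j = 0"
    "\<And>j. j < m \<Longrightarrow> F j j \<noteq> 0 \<and> fls_subdegree (F j j) = 0 \<and> fls_nth (F j j) 0 = 1"
    "near0 (\<lambda>x. (\<forall>j<m. U x $$ (j,j) = eval_fls (F j j) x * L x $$ (j,j)) \<and>
        (\<forall>i<m. \<forall>j<i. U x $$ (i,j) = 0))"
    "(\<And>j k. j < m \<Longrightarrow> k < m \<Longrightarrow> kappa f q j = kappa f q k) \<Longrightarrow>
      near0 (\<lambda>x. \<forall>i<m. \<forall>j<m. U x $$ (i,j) = eval_fls (F i j) x * L x $$ (j,j))"
    "(\<And>j k. j < m \<Longrightarrow> k < m \<Longrightarrow> kappa f q j = kappa f q k) \<Longrightarrow>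
      (\<And>j k. j < m \<Longrightarrow> k < m \<Longrightarrow>
        (1 + fls_const (of_real (q - 1)) * f q j) * F j k +
          (if Suc j < m then fls_const (of_real (q - 1)) * F (Suc j) k else 0) =
        fls_sigma q (F j k) * (fls_const (tau f q k) * fls_X_intpow (kappa f q k)))"
proof -
  obtain G F T H Hl where
    G: "is_Ghat m f q G" and
    Fc: "F \<in> carrier_mat m m" and conv: "\<forall>i<m. \<forall>j<m. conv_fls (F $$ (i,j))" and
    FT: "q_gauge q F T (Cq m f q)" and T: "is_T m f q T" and
    H: "is_Hhat m f q T H" and FHG: "F * H = G" and
    Hl: "is_Hlambda m f q lam T Hl" and
    UF: "near0 (\<lambda>x. U x = eval_mat F x * Hl x * L x)"
    using U unfolding is_U_def by blast
  have le: "kappa f q j \<le> kappa f q i" if "j \<le> i" "i < m" for i j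
    using sorted[of j i] that by (cases "j = i") auto
  \<comment> \<open>Stated for an arbitrary type of entries, because it is applied to the formal H
    and to the values of \<open>Hl\<close>.\<close>
  have unip: "A $$ (i,j) = (if i = j then 1 else 0)"
    if A: "block_unipotent m (kappa f q) A" and ij: "i < m" "j < m" "j \<le> i"
    for i j and A :: "'b :: {zero,one} mat"
    using A le[OF ij(3,1)] ij(1,2) unfolding block_unipotent_def by (cases "kappa f q j = kappa f q i") auto
  have Hc: "H \<in> carrier_mat m m" and Hu: "block_unipotent m (kappa f q) H"
    using H unfolding is_Hhat_def by auto
  have Gc: "G \<in> carrier_mat m m" and Gu: "upper_triangular G"
    and Gd: "\<forall>j<m. v0 (G $$ (j,j)) = 0 \<and> t0 (G $$ (j,j)) = 1"
    using G unfolding is_Ghat_def by auto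
  have G0: "G $$ (i,j) = 0" if "i < m" "j < i" for i j
    using Gu Gc that by auto
  have FG: "F $$ (i,j) = G $$ (i,j)" if "i < m" "j \<le> i" for i j
    by (rule upper_triangular_of_mult[OF Fc Hc unip[OF Hu] FHG G0 that])
  have F0: "F $$ (i,j) = 0" if "i < m" "j < i" for i j
    using FG[of i j] G0[of i j] that by simp
  have Fd: "F $$ (j,j) \<noteq> 0 \<and> fls_subdegree (F $$ (j,j)) = 0 \<and> fls_nth (F $$ (j,j)) 0 = 1" if "j < m" for j
  proof -
    have *: "v0 (F $$ (j,j)) = 0" "t0 (F $$ (j,j)) = 1"
      using FG[of j j] Gd that by auto
    from *(1) have "F $$ (j,j) \<noteq> 0" "fls_subdegree (F $$ (j,j)) = 0"
      unfolding v0_def by (auto simp: zero_ereal_def split: if_splits)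
    then show ?thesis using *(2) unfolding t0_def by auto
  qed
  have Lprop: "near0 (\<lambda>x. L x \<in> carrier_mat m m \<and> diagonal_mat (L x))"
    by (rule near0_mono[OF cosparse_imp_near0[OF Lambda_properties(2)[OF L]]]) auto
  have Hlc: "Hl x \<in> carrier_mat m m" for x
    using Hl unfolding is_Hlambda_def GL_merom_def by auto
  have Hlu: "near0 (\<lambda>x. block_unipotent m (kappa f q) (Hl x))"
    using Hl unfolding is_Hlambda_def by (auto intro: cosparse_imp_near0)
  have evc: "eval_mat F x \<in> carrier_mat m m" for x using Fc by (simp add: eval_mat_def)
  have evF: "eval_mat F x $$ (i,j) = eval_fls (F $$ (i,j)) x" if "i < m" "j < m" for i j x
    using Fc that by (simp add: eval_mat_def)
  have Uent: "near0 (\<lambda>x. block_unipotent m (kappa f q) (Hl x) \<and>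
      (\<forall>i<m. \<forall>j<m. U x $$ (i,j) = (\<Sum>l<m. eval_fls (F $$ (i,l)) x * Hl x $$ (l,j)) * L x $$ (j,j)))"
  proof (rule near0_mono[OF near0_conj[OF near0_conj[OF Lprop Hlu] UF]], intro conjI allI impI)
    fix x i j assume *: "((L x \<in> carrier_mat m m \<and> diagonal_mat (L x)) \<and>
      block_unipotent m (kappa f q) (Hl x)) \<and> U x = eval_mat F x * Hl x * L x" and ij: "i < m" "j < m"
    have c: "eval_mat F x * Hl x \<in> carrier_mat m m" using evc[of x] Hlc[of x] by auto
    have "U x $$ (i,j) = (\<Sum>l<m. (eval_mat F x * Hl x) $$ (i,l) * L x $$ (l,j))"
      using * mat_mult_entry[OF c _ ij, of "L x"] by simp
    also have "\<dots> = (eval_mat F x * Hl x) $$ (i,j) * L x $$ (j,j)"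
      using ij * by (intro sum_single) (auto simp: diagonal_mat_def)
    also have "(eval_mat F x * Hl x) $$ (i,j) = (\<Sum>l<m. eval_fls (F $$ (i,l)) x * Hl x $$ (l,j))"
      using mat_mult_entry[OF evc Hlc ij, of x x] by (simp add: evF ij)
    finally show "U x $$ (i,j) = (\<Sum>l<m. eval_fls (F $$ (i,l)) x * Hl x $$ (l,j)) * L x $$ (j,j)" .
  qed auto
  show thesis
  proof (rule that[of "\<lambda>i j. F $$ (i,j)"])
    show "fls_conv_radius (F $$ (i,j)) > 0" if "i < m" "j < m" for i j
      using conv that unfolding conv_fls_def by auto
    show "F $$ (i,j) = 0" if "i < m" "j < i" for i j using F0 that .
    show "F $$ (j,j) \<noteq> 0 \<and> fls_subdegree (F $$ (j,j)) = 0 \<and> fls_nth (F $$ (j,j)) 0 = 1" if "j < m" for j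
      using Fd that .
    show "near0 (\<lambda>x. (\<forall>j<m. U x $$ (j,j) = eval_fls (F $$ (j,j)) x * L x $$ (j,j)) \<and>
        (\<forall>i<m. \<forall>j<i. U x $$ (i,j) = 0))"
    proof (rule near0_mono[OF Uent])
      fix x assume x: "block_unipotent m (kappa f q) (Hl x) \<and>
      (\<forall>i<m. \<forall>j<m. U x $$ (i,j) = (\<Sum>l<m. eval_fls (F $$ (i,l)) x * Hl x $$ (l,j)) * L x $$ (j,j))"
      have un: "Hl x $$ (i,j) = (if i = j then 1 else 0)" if "i < m" "j < m" "j \<le> i" for i j
        using unip[of "Hl x" i j] x that by auto
      have "(\<Sum>l<m. eval_fls (F $$ (j,l)) x * Hl x $$ (l,j)) = eval_fls (F $$ (j,j)) x * Hl x $$ (j,j)"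
        if "j < m" for j
      proof (intro sum_single)
        fix l assume "l \<in> {..<m}" "l \<noteq> j"
        then show "eval_fls (F $$ (j,l)) x * Hl x $$ (l,j) = 0"
          using F0[of j l] un[of l j] that by (cases "l < j") auto
      qed (use that in auto)
      moreover have "(\<Sum>l<m. eval_fls (F $$ (i,l)) x * Hl x $$ (l,j)) = 0" if "j < i" "i < m" for i j
      proof (intro sum.neutral ballI)
        fix l assume "l \<in> {..<m}"
        then show "eval_fls (F $$ (i,l)) x * Hl x $$ (l,j) = 0"
          using F0[of i l] un[of l j] that by (cases "l < i") auto
      qed
      ultimately show "(\<forall>j<m. U x $$ (j,j) = eval_fls (F $$ (j,j)) x * L x $$ (j,j)) \<and>
        (\<forall>i<m. \<forall>j<i. U x $$ (i,j) = 0)"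
        using x un by auto
    qed
  next
    assume eq: "\<And>j k. j < m \<Longrightarrow> k < m \<Longrightarrow> kappa f q j = kappa f q k"
    show "near0 (\<lambda>x. \<forall>i<m. \<forall>j<m. U x $$ (i,j) = eval_fls (F $$ (i,j)) x * L x $$ (j,j))"
    proof (rule near0_mono[OF Uent])
      fix x assume x: "block_unipotent m (kappa f q) (Hl x) \<and>
      (\<forall>i<m. \<forall>j<m. U x $$ (i,j) = (\<Sum>l<m. eval_fls (F $$ (i,l)) x * Hl x $$ (l,j)) * L x $$ (j,j))"
      have un: "Hl x $$ (i,j) = (if i = j then 1 else 0)" if "i < m" "j < m" for i j
        using x eq[OF that] that unfolding block_unipotent_def by auto
      have "(\<Sum>l<m. eval_fls (F $$ (i,l)) x * Hl x $$ (l,j)) = eval_fls (F $$ (i,j)) x * Hl x $$ (j,j)"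
        if "i < m" "j < m" for i j
        by (intro sum_single) (use un that in auto)
      then show "\<forall>i<m. \<forall>j<m. U x $$ (i,j) = eval_fls (F $$ (i,j)) x * L x $$ (j,j)"
        using x un by auto
    qed
    have TD: "T $$ (i,j) = Dq m f q $$ (i,j)" if "i < m" "j < m" for i j
      using T eq[OF that] that unfolding is_T_def by auto
    have Tc: "T \<in> carrier_mat m m" using T unfolding is_T_def by auto
    have Cc: "Cq m f q \<in> carrier_mat m m" by (simp add: Cq_def)
    have Sc: "map_mat (fls_sigma q) F \<in> carrier_mat m m" using Fc by simp
    have CF: "Cq m f q * F = map_mat (fls_sigma q) F * T"
      using FT unfolding q_gauge_def by (rule gauge_relD) (use Fc Tc in auto)
    show "(1 + fls_const (of_real (q - 1)) * f q j) * F $$ (j,k) +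
          (if Suc j < m then fls_const (of_real (q - 1)) * F $$ (Suc j,k) else 0) =
        fls_sigma q (F $$ (j,k)) * (fls_const (tau f q k) * fls_X_intpow (kappa f q k))"
      if jk: "j < m" "k < m" for j k
    proof -
      have "(map_mat (fls_sigma q) F * T) $$ (j,k) = (\<Sum>l<m. map_mat (fls_sigma q) F $$ (j,l) * T $$ (l,k))"
        by (rule mat_mult_entry[OF Sc Tc jk])
      also have "\<dots> = map_mat (fls_sigma q) F $$ (j,k) * T $$ (k,k)"
        by (intro sum_single) (use TD jk in \<open>auto simp: Dq_def\<close>)
      also have "\<dots> = fls_sigma q (F $$ (j,k)) * (fls_const (tau f q k) * fls_X_intpow (kappa f q k))"
        using TD[of k k] jk Fc by (simp add: Dq_def)
      finally have R: "(map_mat (fls_sigma q) F * T) $$ (j,k) = \<dots>" .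
      have "(Cq m f q * F) $$ (j,k) = (\<Sum>l<m. Cq m f q $$ (j,l) * F $$ (l,k))"
        by (rule mat_mult_entry[OF Cc Fc jk])
      also have "\<dots> = (\<Sum>l<m. (if l = j then (1 + fls_const (of_real (q - 1)) * f q j) * F $$ (j,k) else 0) +
          (if l = Suc j then fls_const (of_real (q - 1)) * F $$ (Suc j,k) else 0))"
        using jk by (intro sum.cong) (auto simp: Cq_def)
      also have "\<dots> = (1 + fls_const (of_real (q - 1)) * f q j) * F $$ (j,k) +
          (if Suc j < m then fls_const (of_real (q - 1)) * F $$ (Suc j,k) else 0)"
        using jk by (simp add: sum.distrib)
      finally show ?thesis using R CF by simp
    qed
  qed
qed

section \<open>Ratio test and decay along the sequences x / q^n\<close>

lemma bounded_ratio_contradiction: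
  fixes b :: "nat \<Rightarrow> complex"
  assumes bd: "eventually (\<lambda>n. norm (b n) \<le> M) sequentially"
    and nz: "\<And>n. n \<ge> n1 \<Longrightarrow> b n \<noteq> 0"
    and step: "\<And>n. n \<ge> n1 \<Longrightarrow> norm (b (Suc n)) = norm (b n) * (E n * R n)"
    and E: "E \<longlonglongrightarrow> (1::real)" and R: "eventually (\<lambda>n. R n \<ge> \<rho>) sequentially" and \<rho>: "\<rho> > 1"
  shows False
proof -
  \<comment> \<open>Any c strictly between 1 and \<rho> works: eventually E n > c / \<rho>, and the
    ratio E n R n is then at least c.\<close>
  define c where "c = (1 + \<rho>) / 2"
  have c: "1 < c" "c < \<rho>" using \<rho> by (auto simp: c_def)
  have "eventually (\<lambda>n. E n > c / \<rho>) sequentially"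
    using order_tendstoD(1)[OF E, of "c / \<rho>"] c \<rho> by simp
  from eventually_conj[OF this eventually_conj[OF R eventually_conj[OF bd eventually_ge_at_top[of n1]]]]
  obtain N where N: "\<And>n. n \<ge> N \<Longrightarrow> E n > c / \<rho> \<and> R n \<ge> \<rho> \<and> norm (b n) \<le> M \<and> n \<ge> n1"
    unfolding eventually_sequentially by blast
  have grow: "norm (b (N + n)) \<ge> c ^ n * norm (b N)" for n
  proof (induction n)
    case (Suc n)
    have "c / \<rho> > 0" using \<rho> c by simp
    then have Ep: "E (N + n) > 0" using N[of "N + n"] by linarith
    have "c = c / \<rho> * \<rho>" using \<rho> by simp
    also have "\<dots> \<le> E (N + n) * R (N + n)"
      using N[of "N + n"] \<rho> c Ep by (intro mult_mono) (auto intro: less_imp_le)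
    finally have "c * norm (b (N + n)) \<le> E (N + n) * R (N + n) * norm (b (N + n))"
      by (intro mult_right_mono) auto
    also have "\<dots> = norm (b (N + Suc n))" using step[of "N + n"] N[of "N + n"] by simp
    finally have "c * norm (b (N + n)) \<le> norm (b (N + Suc n))" .
    moreover have "c * (c ^ n * norm (b N)) \<le> c * norm (b (N + n))"
      using Suc c by (intro mult_left_mono) auto
    ultimately have "c * (c ^ n * norm (b N)) \<le> norm (b (N + Suc n))" by (rule order.trans[rotated])
    then show ?case by (simp only: power_Suc mult.assoc)
  qed auto
  have b0: "norm (b N) > 0" using nz N[of N] by simp
  obtain n where n: "M / norm (b N) < c ^ n" using real_arch_pow[OF c(1)] by blast
  then have "M < c ^ n * norm (b N)" using b0 by (simp add: field_simps)
  also have "\<dots> \<le> M" using grow[of n] N[of "N + n"] by simp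
  finally show False by simp
qed

lemma filterlim_geometric_at_0:
  fixes z :: complex
  assumes "q > (1::real)" "z \<noteq> 0"
  shows "filterlim (\<lambda>n. z / of_real q ^ n) (at 0) sequentially"
proof -
  have "(\<lambda>n. z * (inverse (of_real q)) ^ n) \<longlonglongrightarrow> z * 0"
    using assms(1) by (intro tendsto_intros LIMSEQ_power_zero) (simp add: norm_inverse inverse_less_1_iff)
  then have "(\<lambda>n. z / of_real q ^ n) \<longlonglongrightarrow> 0" by (simp add: divide_inverse power_inverse)
  then show ?thesis using assms by (auto simp: filterlim_at)
qed

text \<open>A and B are diagonal entries of F, L and L' the matching entries of Lambda, and the
  bounded sequence is the quotient of (H5) at \<open>x (Suc n)\<close>. Its consecutive ratios have
  modulus E n R n with E tending to 1 and R n = |tau / tau'| q^(1+kappa) |x (n+2)|^(kappa-kappa').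
  Were kappa' > kappa, R would tend to infinity; for equal exponents R is constant, hence at most
  1.\<close>

lemma kappa_tau_bound:
  fixes A B L L' :: "complex \<Rightarrow> complex"
  assumes q: "q > 1" and z: "z \<noteq> 0"
    and A: "A \<midarrow>0\<rightarrow> 1" and B: "B \<midarrow>0\<rightarrow> 1"
    and \<tau>: "\<tau> \<noteq> 0" "\<tau>' \<noteq> 0"
    and x: "x = (\<lambda>n. z / of_real q ^ n)"
    and L: "\<And>n. L (x n) \<noteq> 0" "\<And>n. L (x n) = \<tau> * x (Suc n) powi \<kappa> * L (x (Suc n))"
    and L': "\<And>n. L' (x n) \<noteq> 0" "\<And>n. L' (x n) = \<tau>' * x (Suc n) powi \<kappa>' * L' (x (Suc n))"
    and bd: "eventually (\<lambda>n. norm (B (x (Suc n)) * L' (x (Suc n)) / (x (Suc n) * (A (x n) * L (x n)))) \<le> M) sequentially"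
  shows "\<kappa>' \<le> \<kappa>" "\<kappa>' = \<kappa> \<Longrightarrow> norm \<tau> \<le> norm \<tau>' * q powi (- (1 + \<kappa>))"
proof -
  have x0: "x n \<noteq> 0" for n using z q by (simp add: x)
  have nx: "norm (x n) = norm z / q ^ n" for n using q by (simp add: x norm_divide norm_power)
  have xl: "filterlim x (at 0) sequentially" unfolding x by (rule filterlim_geometric_at_0[OF q z])
  have Ax: "(\<lambda>n. A (x n)) \<longlonglongrightarrow> 1" and Bx: "(\<lambda>n. B (x n)) \<longlonglongrightarrow> 1"
    using filterlim_compose[OF A xl] filterlim_compose[OF B xl] by auto
  define b where "b = (\<lambda>n. B (x (Suc n)) * L' (x (Suc n)) / (x (Suc n) * (A (x n) * L (x n))))"
  define E where "E = (\<lambda>n. norm (B (x (Suc (Suc n))) / B (x (Suc n)) * (A (x n) / A (x (Suc n)))))"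
  define R where "R = (\<lambda>n. norm \<tau> / norm \<tau>' * q powi (1 + \<kappa>) * norm (x (Suc (Suc n))) powi (\<kappa> - \<kappa>'))"
  have E: "E \<longlonglongrightarrow> 1"
  proof -
    have "(\<lambda>n. B (x (Suc (Suc n))) / B (x (Suc n)) * (A (x n) / A (x (Suc n)))) \<longlonglongrightarrow> 1 / 1 * (1 / 1)"
      using LIMSEQ_Suc[OF Ax] LIMSEQ_Suc[OF Bx] LIMSEQ_Suc[OF LIMSEQ_Suc[OF Bx]] Ax
      by (intro tendsto_intros) auto
    from tendsto_norm[OF this] show ?thesis by (simp add: E_def)
  qed
  obtain n1 where n1: "\<And>n. n \<ge> n1 \<Longrightarrow> A (x n) \<noteq> 0 \<and> B (x n) \<noteq> 0"
    using eventually_conj[OF tendsto_imp_eventually_ne[OF Ax, of 0] tendsto_imp_eventually_ne[OF Bx, of 0]]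
    unfolding eventually_sequentially by auto
  have step: "norm (b (Suc n)) = norm (b n) * (E n * R n)" if n: "n \<ge> n1" for n
  proof -
    let ?y = "x (Suc (Suc n))"
    have nz: "A (x n) \<noteq> 0" "A (x (Suc n)) \<noteq> 0" "B (x (Suc n)) \<noteq> 0" "B ?y \<noteq> 0"
      using n1 n by auto
    have yq: "x (Suc n) = of_real q * ?y" using q by (simp add: x)
    have e1: "b (Suc n) = B ?y * L' ?y / (?y * (A (x (Suc n)) * L (x (Suc n))))"
      by (simp add: b_def)
    have e2: "b n = B (x (Suc n)) * (\<tau>' * ?y powi \<kappa>' * L' ?y) /
        (of_real q * ?y * (A (x n) * (\<tau> * (of_real q * ?y) powi \<kappa> * L (x (Suc n)))))"
      unfolding b_def using L(2)[of n] L'(2)[of "Suc n"] yq by simp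
    \<comment> \<open>Stated for arbitrary numbers, so that the integer powers, here p, p' and k,
      become atoms for the simplifier.\<close>
    have alg: "B2 * L2 / (y * (A1 * L1)) = B1 * (t' * p' * L2) / (Q * y * (A0 * (t * (k * p) * L1))) *
        ((B2 / B1 * (A0 / A1)) * (t / t' * (Q * k) * (p / p')))"
      if "B1 \<noteq> 0" "Q \<noteq> 0" "k \<noteq> 0" "y \<noteq> 0" "A0 \<noteq> 0" "A1 \<noteq> 0" "t \<noteq> 0" "t' \<noteq> 0" "p \<noteq> 0" "p' \<noteq> 0"
      for B1 B2 L1 L2 y A0 A1 t t' p p' Q k :: complex
      using that by (simp add: field_simps)
    have "b (Suc n) = b n * ((B ?y / B (x (Suc n)) * (A (x n) / A (x (Suc n)))) *
      (\<tau> / \<tau>' * (of_real q * of_real q powi \<kappa>) * (?y powi \<kappa> / ?y powi \<kappa>')))"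
      unfolding e1 e2 power_int_mult_distrib using nz \<tau> q x0
      by (intro alg) auto
    moreover have "norm (\<tau> / \<tau>' * (of_real q * of_real q powi \<kappa>) * (?y powi \<kappa> / ?y powi \<kappa>')) = R n"
    proof -
      have "q powi (1 + \<kappa>) = q * q powi \<kappa>" using q by (simp add: power_int_add)
      moreover have "norm ?y powi (\<kappa> - \<kappa>') = norm ?y powi \<kappa> / norm ?y powi \<kappa>'"
        using x0 by (intro power_int_diff) auto
      ultimately show ?thesis unfolding R_def using q by (simp add: norm_mult norm_divide norm_power_int)
    qed
    ultimately show ?thesis unfolding E_def by (simp only: norm_mult)
  qed
  have bnz: "b n \<noteq> 0" if "n \<ge> n1" for n
    using n1 that x0 L(1) L'(1) by (simp add: b_def)
  have bd': "eventually (\<lambda>n. norm (b n) \<le> M) sequentially" using bd by (simp only: b_def)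
  note contra = bounded_ratio_contradiction[OF bd' _ _ E]
  show le: "\<kappa>' \<le> \<kappa>"
  proof (rule ccontr)
    assume "\<not> \<kappa>' \<le> \<kappa>"
    define e where "e = nat (\<kappa>' - \<kappa>)"
    have e: "e \<ge> 1" "\<kappa> - \<kappa>' = - int e" using \<open>\<not> \<kappa>' \<le> \<kappa>\<close> by (auto simp: e_def)
    define c where "c = norm \<tau> / norm \<tau>' * q powi (1 + \<kappa>)"
    have c: "c > 0" using \<tau> q by (simp add: c_def)
    have "filterlim (\<lambda>n. q ^ n / norm z) at_top sequentially"
    proof -
      have "filterlim (\<lambda>n. q ^ n) at_top sequentially" using q by real_asymp
      from filterlim_tendsto_pos_mult_at_top[OF tendsto_const[of "inverse (norm z)"] _ this] z
      show ?thesis by (simp add: divide_inverse mult.commute)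
    qed
    \<comment> \<open>The bound 1 lets t^e dominate t, and the bound 2 / c makes c t at least
      2.\<close>
    then have "eventually (\<lambda>n. q ^ n / norm z \<ge> max 1 (2 / c)) sequentially"
      unfolding filterlim_at_top by blast
    then have "eventually (\<lambda>n. q ^ Suc (Suc n) / norm z \<ge> max 1 (2 / c)) sequentially"
      using eventually_sequentially_Suc[of "\<lambda>n. q ^ n / norm z \<ge> max 1 (2 / c)"]
        eventually_sequentially_Suc[of "\<lambda>n. q ^ Suc n / norm z \<ge> max 1 (2 / c)"] by blast
    then have "eventually (\<lambda>n. R n \<ge> 2) sequentially"
    proof eventually_elim
      case (elim n)
      let ?t = "q ^ Suc (Suc n) / norm z"
      have t: "?t \<ge> 1" "?t \<ge> 2 / c" using elim by auto
      have "norm (x (Suc (Suc n))) powi (\<kappa> - \<kappa>') = ?t ^ e"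
        unfolding e(2) nx power_int_minus by (simp add: power_inverse[symmetric])
      then have "R n = c * ?t ^ e" by (simp add: R_def c_def)
      moreover have "?t ^ e \<ge> ?t ^ 1" using t(1) e(1) by (intro power_increasing) auto
      then have "c * ?t ^ e \<ge> c * (2 / c)" using t c by (intro mult_left_mono) auto
      then have "c * ?t ^ e \<ge> 2" using c by simp
      ultimately show ?case by simp
    qed
    from contra[OF bnz step this] show False by simp
  qed
  show "norm \<tau> \<le> norm \<tau>' * q powi (- (1 + \<kappa>))" if eq: "\<kappa>' = \<kappa>"
  proof (rule ccontr)
    assume *: "\<not> norm \<tau> \<le> norm \<tau>' * q powi (- (1 + \<kappa>))"
    have qp: "q powi (1 + \<kappa>) > 0" using q by simp
    have R: "R n = norm \<tau> / norm \<tau>' * q powi (1 + \<kappa>)" for n by (simp add: R_def eq)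
    have "norm \<tau> / norm \<tau>' * q powi (1 + \<kappa>) > 1"
    proof -
      have "norm \<tau>' * inverse (q powi (1 + \<kappa>)) < norm \<tau>"
        using * by (simp only: power_int_minus not_le)
      then show ?thesis using qp \<tau> by (simp add: field_simps del: power_int_add_1 power_int_add_1')
    qed
    from contra[OF bnz step _ this] show False unfolding R by simp
  qed
qed

lemma eval_fls_bound:
  fixes F :: "complex fls"
  assumes conv: "fls_conv_radius F > 0" and van: "\<And>n. n < p \<Longrightarrow> fls_nth F n = 0"
  shows "\<exists>C r. r > 0 \<and> C \<ge> 0 \<and> (\<forall>x. x \<noteq> 0 \<and> norm x < r \<longrightarrow> norm (eval_fls F x) \<le> C * norm x powi p)"
proof -
  let ?G = "fls_shift p F"
  have G: "eval_fls ?G has_laurent_expansion ?G"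
    using conv by (intro eval_fls_has_laurent_expansion) simp
  have "fls_subdegree ?G \<ge> 0"
    by (cases "?G = 0") (auto intro!: fls_subdegree_geI simp: van)
  then have "eval_fls ?G \<midarrow>0\<rightarrow> fls_nth ?G 0"
    using has_laurent_expansion_imp_tendsto_0[OF G] by simp
  then have "eventually (\<lambda>x. norm (eval_fls ?G x) < norm (fls_nth ?G 0) + 1) (at 0)"
    by (intro order_tendstoD(2)[OF tendsto_norm]) auto
  then obtain r where r: "r > 0" "\<And>x. x \<noteq> 0 \<Longrightarrow> norm x < r \<Longrightarrow> norm (eval_fls ?G x) < norm (fls_nth ?G 0) + 1"
    unfolding eventually_at by (auto simp: dist_norm)
  show ?thesis
  proof (rule exI[of _ "norm (fls_nth ?G 0) + 1"], rule exI[of _ r], intro conjI allI impI)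
    fix x :: complex assume x: "x \<noteq> 0 \<and> norm x < r"
    have "eval_fls F x = eval_fls ?G x * x powi p"
      using x by (simp add: eval_fls_shift power_int_minus)
    then have "norm (eval_fls F x) = norm (eval_fls ?G x) * norm x powi p"
      by (simp add: norm_mult norm_power_int)
    also have "\<dots> \<le> (norm (fls_nth ?G 0) + 1) * norm x powi p"
      using r(2)[of x] x by (intro mult_right_mono) auto
    finally show "norm (eval_fls F x) \<le> (norm (fls_nth ?G 0) + 1) * norm x powi p" .
  qed (use r in auto)
qed

text \<open>Let n0 be the valuation of F_jk. If n0 < -(k-j) kappa, then in the coefficient of
  z^(kappa+n0) the term of F_(j+1)k vanishes by induction, as kappa + n0 < -(k-j-1) kappa. What
  remains is tau_j = q^n0 tau_k, a resonance. The induction starts from F_kk, of valuation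
  0.\<close>

lemma coefficients_vanish:
  fixes F :: "nat \<Rightarrow> nat \<Rightarrow> complex fls" and c :: "nat \<Rightarrow> complex fls"
  assumes q: "q > 0"
    and c: "\<And>j. j < m \<Longrightarrow> fls_subdegree (c j) = \<kappa> \<and> fls_nth (c j) \<kappa> = \<tau> j"
    and d: "\<And>k. k < m \<Longrightarrow> fls_subdegree (F k k) = 0"
    and eq: "\<And>j k. j < k \<Longrightarrow> k < m \<Longrightarrow> c j * F j k + fls_const s * F (Suc j) k =
      fls_sigma q (F j k) * (fls_const (\<tau> k) * fls_X_intpow \<kappa>)"
    and nonres: "\<And>j k n. j < m \<Longrightarrow> k < m \<Longrightarrow> j \<noteq> k \<Longrightarrow> \<tau> j \<noteq> of_real q powi n * \<tau> k"
    and jk: "j \<le> k" "k < m" and n: "n < - int (k - j) * \<kappa>"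
  shows "fls_nth (F j k) n = 0"
  using jk(1) n
proof (induction "k - j" arbitrary: j n)
  case 0
  then show ?case using d[OF jk(2)] by (simp add: fls_eq0_below_subdegree)
next
  case (Suc d)
  then have j: "j < k" "j < m" "Suc j \<le> k" "d = k - Suc j" "k - j = Suc d" using jk(2) by auto
  show ?case
  proof (rule ccontr)
    assume nz: "fls_nth (F j k) n \<noteq> 0"
    define n0 where "n0 = fls_subdegree (F j k)"
    have "n0 \<le> n" using nz unfolding n0_def by (rule fls_subdegree_leI)
    then have n0: "n0 < - int (Suc d) * \<kappa>" using Suc.prems(2) j(5) by simp
    then have "n0 + \<kappa> < - int d * \<kappa>" by (simp add: algebra_simps)
    then have z: "fls_nth (F (Suc j) k) (\<kappa> + n0) = 0"
      using Suc.hyps(1)[OF j(4) j(3)] j(4) by (simp add: add.commute)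
    have "fls_nth (c j * F j k) (\<kappa> + n0) = \<tau> j * fls_nth (F j k) n0"
      using fls_times_base[of "c j" "F j k"] c[OF j(2)] by (simp add: n0_def)
    moreover have "fls_nth (fls_sigma q (F j k) * (fls_const (\<tau> k) * fls_X_intpow \<kappa>)) (\<kappa> + n0) =
       \<tau> k * (fls_nth (F j k) n0 * of_real q powi n0)"
    proof -
      have "fls_sigma q (F j k) * (fls_const (\<tau> k) * fls_X_intpow \<kappa>) =
        fls_const (\<tau> k) * (fls_sigma q (F j k) * fls_X_intpow \<kappa>)"
        by (rule mult.left_commute)
      also have "fls_sigma q (F j k) * fls_X_intpow \<kappa> = fls_shift (- \<kappa>) (fls_sigma q (F j k))"
        by (rule fls_X_intpow_times_conv_shift)
      finally have *: "fls_sigma q (F j k) * (fls_const (\<tau> k) * fls_X_intpow \<kappa>) =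
        fls_const (\<tau> k) * fls_shift (- \<kappa>) (fls_sigma q (F j k))" .
      show ?thesis unfolding * using q by (simp add: fls_sigma_nth)
    qed
    ultimately have "\<tau> j * fls_nth (F j k) n0 = \<tau> k * (fls_nth (F j k) n0 * of_real q powi n0)"
      using arg_cong[OF eq[OF j(1) jk(2)], of "\<lambda>g. fls_nth g (\<kappa> + n0)"] z by simp
    moreover have "fls_nth (F j k) n0 \<noteq> 0"
      unfolding n0_def by (rule nth_fls_subdegree_nonzero) (use nz in auto)
    ultimately have "\<tau> j = of_real q powi n0 * \<tau> k" by (simp add: field_simps)
    then show False using nonres[of j k n0] j jk by simp
  qed
qed

text \<open>Along the sequence, |L' / L| is a geometric progression of ratio |tau / tau'| <=
  q^(-(1+kappa) d), while F is at most of order |x n|^(-d kappa), that is q^(n d kappa). The product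
  is O(q^(-n d)), and d >= 1.\<close>

lemma quotient_tendsto_0:
  fixes A L L' :: "complex \<Rightarrow> complex"
  assumes q: "q > 1" and z: "z \<noteq> 0" and x: "x = (\<lambda>n. z / of_real q ^ n)"
    and A: "A \<midarrow>0\<rightarrow> 1"
    and F: "fls_conv_radius F > 0" "\<And>n. n < - int d * \<kappa> \<Longrightarrow> fls_nth F n = 0"
    and d: "d \<ge> 1" and \<tau>: "\<tau> \<noteq> 0" "\<tau>' \<noteq> 0" "norm \<tau> \<le> norm \<tau>' * (q powi (- (1 + \<kappa>))) ^ d"
    and L: "\<And>n. L (x n) \<noteq> 0" "\<And>n. L (x n) = \<tau> * x (Suc n) powi \<kappa> * L (x (Suc n))"
    and L': "\<And>n. L' (x n) \<noteq> 0" "\<And>n. L' (x n) = \<tau>' * x (Suc n) powi \<kappa> * L' (x (Suc n))"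
  shows "(\<lambda>n. eval_fls F (x n) * L' (x n) / (A (x n) * L (x n))) \<longlonglongrightarrow> 0"
proof -
  have x0: "x n \<noteq> 0" for n using z q by (simp add: x)
  have nx: "norm (x n) = norm z / q ^ n" for n using q by (simp add: x norm_divide norm_power)
  have xl: "filterlim x (at 0) sequentially" unfolding x by (rule filterlim_geometric_at_0[OF q z])
  then have xl0: "x \<longlonglongrightarrow> 0" unfolding filterlim_at by blast
  have Ax: "(\<lambda>n. A (x n)) \<longlonglongrightarrow> 1" using filterlim_compose[OF A xl] by auto
  have ratio: "norm (L' (x n) / L (x n)) = (norm \<tau> / norm \<tau>') ^ n * norm (L' (x 0) / L (x 0))" for n
  proof (induction n)
    case (Suc n)
    have "L' (x n) / L (x n) = \<tau>' / \<tau> * (L' (x (Suc n)) / L (x (Suc n)))"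
      using L(2)[of n] L'(2)[of n] x0 by simp
    then have "L' (x (Suc n)) / L (x (Suc n)) = \<tau> / \<tau>' * (L' (x n) / L (x n))"
      using \<tau> by simp
    then have "norm (L' (x (Suc n)) / L (x (Suc n))) = norm \<tau> / norm \<tau>' * norm (L' (x n) / L (x n))"
      by (simp only: norm_mult norm_divide)
    then show ?case unfolding Suc by simp
  qed auto
  obtain C r where C: "r > 0" "C \<ge> 0" "\<And>y. y \<noteq> 0 \<Longrightarrow> norm y < r \<Longrightarrow> norm (eval_fls F y) \<le> C * norm y powi (- int d * \<kappa>)"
    using eval_fls_bound[OF F] by blast
  define K where "K = C * norm z powi (- int d * \<kappa>) * norm (L' (x 0) / L (x 0))"
  have ev: "eventually (\<lambda>n. norm (eval_fls F (x n) * (L' (x n) / L (x n))) \<le> K * (inverse q ^ d) ^ n) sequentially"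
  proof -
    have "eventually (\<lambda>n. norm (x n) < r) sequentially"
      using order_tendstoD(2)[OF tendsto_norm[OF xl0]] C(1) by simp
    then show ?thesis
    proof eventually_elim
      case (elim n)
      have "norm \<tau> / norm \<tau>' \<le> norm \<tau>' * (q powi (- (1 + \<kappa>))) ^ d / norm \<tau>'"
        by (rule divide_right_mono[OF \<tau>(3)]) (rule norm_ge_zero)
      also have "\<dots> = (q powi (- (1 + \<kappa>))) ^ d" by (rule nonzero_mult_div_cancel_left) (use \<tau>(2) in simp)
      finally have "norm \<tau> / norm \<tau>' \<le> (q powi (- (1 + \<kappa>))) ^ d" .
      then have "(norm \<tau> / norm \<tau>') ^ n \<le> ((q powi (- (1 + \<kappa>))) ^ d) ^ n"
        by (rule power_mono) (rule divide_nonneg_nonneg; rule norm_ge_zero)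
      then have 1: "norm (L' (x n) / L (x n)) \<le> ((q powi (- (1 + \<kappa>))) ^ d) ^ n * norm (L' (x 0) / L (x 0))"
        by (subst ratio[of n]) (rule mult_right_mono, assumption, rule norm_ge_zero)
      have 2: "norm (eval_fls F (x n)) \<le> C * (norm z powi (- int d * \<kappa>) * ((q powi \<kappa>) ^ d) ^ n)"
      proof -
        have "(q ^ n) powi (- int d * \<kappa>) = inverse (((q powi \<kappa>) ^ d) ^ n)"
        proof -
          have e: "int n * (- int d * \<kappa>) = - (\<kappa> * int d * int n)" by simp
          have "(q ^ n) powi (- int d * \<kappa>) = q powi (int n * (- int d * \<kappa>))"
            by (simp only: power_int_mult power_int_of_nat)
          also have "\<dots> = inverse (q powi (\<kappa> * int d * int n))"
            unfolding e by (rule power_int_minus)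
          also have "q powi (\<kappa> * int d * int n) = ((q powi \<kappa>) ^ d) ^ n"
            by (simp only: power_int_mult power_int_of_nat)
          finally show ?thesis .
        qed
        then have "norm (x n) powi (- int d * \<kappa>) = norm z powi (- int d * \<kappa>) * ((q powi \<kappa>) ^ d) ^ n"
          unfolding nx power_int_divide_distrib by (simp only: divide_inverse inverse_inverse_eq)
        then show ?thesis using C(3)[OF x0 elim] by simp
      qed
      have qq: "((q powi \<kappa>) ^ d) ^ n * ((q powi (- (1 + \<kappa>))) ^ d) ^ n = (inverse q ^ d) ^ n"
      proof -
        have "q powi \<kappa> * q powi (- (1 + \<kappa>)) = q powi (\<kappa> + - (1 + \<kappa>))"
          using q by (intro power_int_add[symmetric]) auto
        also have "\<dots> = inverse q" by simp
        finally show ?thesis by (simp only: power_mult_distrib[symmetric])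
      qed
      have "norm (eval_fls F (x n) * (L' (x n) / L (x n))) \<le>
        C * (norm z powi (- int d * \<kappa>) * ((q powi \<kappa>) ^ d) ^ n) *
        (((q powi (- (1 + \<kappa>))) ^ d) ^ n * norm (L' (x 0) / L (x 0)))"
        unfolding norm_mult[of "eval_fls F (x n)"] using q
        by (intro mult_mono 1 2) (auto intro!: mult_nonneg_nonneg C(2))
      also have "\<dots> = K * (inverse q ^ d) ^ n"
        unfolding qq[symmetric] K_def by (simp only: mult_ac)
      finally show ?case .
    qed
  qed
  have "inverse q ^ d < 1" using q d by (intro power_Suc_less_one power_less_one_iff[THEN iffD2]) (auto simp: inverse_less_1_iff)
  then have "(\<lambda>n. K * (inverse q ^ d) ^ n) \<longlonglongrightarrow> K * 0"
    using q by (intro tendsto_intros LIMSEQ_power_zero) (auto simp: abs_if)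
  then have "(\<lambda>n. eval_fls F (x n) * (L' (x n) / L (x n))) \<longlonglongrightarrow> 0"
    using ev by (intro Lim_null_comparison[OF ev]) auto
  from tendsto_divide[OF this Ax] show ?thesis by (simp add: field_simps)
qed

section \<open>Generic points and exclusion of poles\<close>

text \<open>The orbit x / q^n meets B only when x lies in one of the countably many dilates q^n
  B.\<close>

lemma countable_scaled:
  fixes B :: "complex set"
  assumes "countable B" "q > (1::real)"
  shows "\<exists>B'. countable B' \<and> (\<forall>x. x \<notin> B' \<longrightarrow> (\<forall>n. x / of_real q ^ n \<notin> B))"
proof (intro exI[of _ "\<Union>n. (\<lambda>y. y * of_real q ^ n) ` B"] conjI allI impI notI)
  show "countable (\<Union>n. (\<lambda>y. y * of_real q ^ n) ` B)"
    using assms(1) by (intro countable_UN countable_image) auto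
  fix x n assume x: "x \<notin> (\<Union>n. (\<lambda>y. y * of_real q ^ n) ` B)" "x / of_real q ^ n \<in> B"
  have "x = x / of_real q ^ n * of_real q ^ n" using assms(2) by simp
  then show False using x by blast
qed

text \<open>Only the points of the orbit that have entered the small disc are controlled, hence a
  statement for large n.\<close>

lemma generic_near0:
  assumes "near0 P" "q > (1::real)"
  shows "\<exists>B. countable B \<and> (\<forall>x. x \<notin> B \<longrightarrow> x \<noteq> 0 \<longrightarrow> (\<forall>\<^sub>F n in sequentially. P (x / of_real q ^ n)))"
proof -
  obtain r where r: "r > 0" "\<And>x. x \<noteq> 0 \<Longrightarrow> norm x < r \<Longrightarrow> eventually P (at x)"
    using assms(1) unfolding near0_altdef by blast
  have "countable {x \<in> ball 0 r - {0}. \<not> P x}"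
    by (rule countable_not_eventually) (auto intro: r(2))
  from countable_scaled[OF this assms(2)] obtain B where B: "countable B"
    "\<And>x n. x \<notin> B \<Longrightarrow> x / of_real q ^ n \<notin> {x \<in> ball 0 r - {0}. \<not> P x}" by blast
  show ?thesis
  proof (intro exI[of _ B] conjI allI impI B(1))
    fix x assume x: "x \<notin> B" "x \<noteq> 0"
    have "(\<lambda>n. norm x * inverse q ^ n) \<longlonglongrightarrow> norm x * 0"
      using assms(2) by (intro tendsto_intros LIMSEQ_power_zero) (simp add: inverse_less_1_iff)
    then have "eventually (\<lambda>n. norm x * inverse q ^ n < r) sequentially"
      using r(1) by (intro order_tendstoD(2)) auto
    then show "\<forall>\<^sub>F n in sequentially. P (x / of_real q ^ n)"
    proof eventually_elim
      case (elim n)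
      have "norm (x / of_real q ^ n) < r"
        using elim assms(2) by (simp add: norm_mult norm_inverse norm_power divide_inverse power_inverse)
      then show ?case using B(2)[OF x(1), of n] x(2) assms(2) by auto
    qed
  qed
qed

lemma generic_at:
  fixes X :: "complex set"
  assumes "open X" "\<And>x. x \<in> X \<Longrightarrow> eventually P (at x)" "q > (1::real)"
  shows "\<exists>B. countable B \<and> (\<forall>x. x \<notin> B \<longrightarrow> (\<forall>n. x / of_real q ^ n \<in> X \<longrightarrow> P (x / of_real q ^ n)))"
  using countable_scaled[OF countable_not_eventually[OF assms(1,2)] assms(3)] by blast

lemma open_minus_countable_nonempty:
  fixes V :: "complex set"
  assumes "open V" "x \<in> V" "countable B"
  shows "\<exists>y\<in>V. y \<notin> B"
proof -
  obtain r where "r > 0" "ball x r \<subseteq> V" using assms(1,2) open_contains_ball by blast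
  then show ?thesis using uncountable_ball[of r x] countable_subset[OF _ assms(3)] by blast
qed

text \<open>Every neighbourhood of a point is uncountable and so contains points off B; a pole would
  contradict the bound there. Once f is continuous, the bound extends to B. The bound C is a
  function because it is applied to powers of M |x|.\<close>

lemma nicely_meromorphic_bounded:
  assumes W: "open W" and f: "f nicely_meromorphic_on W" and B: "countable B"
    and C: "continuous_on W C" and bd: "\<And>x. x \<in> W \<Longrightarrow> x \<notin> B \<Longrightarrow> norm (f x) \<le> C x"
  shows "f analytic_on W" and "\<And>x. x \<in> W \<Longrightarrow> norm (f x) \<le> C x"
proof -
  have an: "f analytic_on {x}" if x: "x \<in> W" for x
  proof (rule nicely_meromorphic_on_imp_analytic_at[OF f x])
    show "\<not> is_pole f x"
    proof
      assume "is_pole f x"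
      then have "\<forall>r>0. eventually (\<lambda>y. r \<le> norm (f y)) (at x)"
        unfolding is_pole_def filterlim_at_infinity[OF order_refl] .
      from this[rule_format, of "max 1 (C x + 1)"]
      have "eventually (\<lambda>y. norm (f y) \<ge> max 1 (C x + 1)) (at x)" by simp
      then have "eventually (\<lambda>y. norm (f y) \<ge> C x + 1) (at x)"
        by eventually_elim simp
      moreover have "isCont C x" using C W x by (simp add: continuous_on_eq_continuous_at)
      then have "eventually (\<lambda>y. C y < C x + 1) (at x)"
        unfolding isCont_def by (rule order_tendstoD) simp
      moreover have "eventually (\<lambda>y. y \<in> W) (at x)"
        using W x by (rule eventually_at_in_open')
      ultimately have "eventually (\<lambda>y. y \<in> W \<and> C y < norm (f y)) (at x)"
        by eventually_elim auto
      then obtain S where S: "open S" "x \<in> S" "\<And>y. y \<in> S \<Longrightarrow> y \<noteq> x \<Longrightarrow> y \<in> W \<and> C y < norm (f y)"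
        unfolding eventually_at_topological by blast
      obtain y where "y \<in> S" "y \<notin> insert x B"
        using open_minus_countable_nonempty[OF S(1,2), of "insert x B"] B by auto
      then show False using S(3)[of y] bd[of y] by auto
    qed
  qed
  then show "f analytic_on W" using analytic_on_analytic_at by blast
  show "norm (f x) \<le> C x" if x: "x \<in> W" for x
  proof (rule ccontr)
    assume *: "\<not> norm (f x) \<le> C x"
    have "isCont f x" using an[OF x] by (rule analytic_at_imp_isCont)
    moreover have "isCont C x" using C W x by (simp add: continuous_on_eq_continuous_at)
    ultimately have "isCont (\<lambda>y. norm (f y) - C y) x" by (intro continuous_intros)
    then have "((\<lambda>y. norm (f y) - C y) \<longlongrightarrow> norm (f x) - C x) (nhds x)"
      unfolding isCont_def by (rule tendsto_at_iff_tendsto_nhds[THEN iffD1])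
    then have "eventually (\<lambda>y. norm (f y) - C y > 0) (nhds x)"
      by (rule order_tendstoD) (use * in simp)
    moreover have "eventually (\<lambda>y. y \<in> W) (nhds x)"
      using W x by (rule eventually_nhds_in_open)
    ultimately have "eventually (\<lambda>y. norm (f y) - C y > 0 \<and> y \<in> W) (nhds x)"
      by (rule eventually_conj)
    then obtain S where S: "open S" "x \<in> S" "\<And>y. y \<in> S \<Longrightarrow> norm (f y) - C y > 0 \<and> y \<in> W"
      unfolding eventually_nhds by blast
    obtain y where "y \<in> S" "y \<notin> B" using open_minus_countable_nonempty[OF S(1,2) B] by blast
    then show False using S(3)[of y] bd[of y] by auto
  qed
qed

section \<open>Fixed q: equality of the exponents and decay of the quotients v_jk\<close>

text \<open>W is stable under division by q, so it contains the orbits x / q^n, but it need not be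
  star-shaped; M is the bound from (H5), to be chosen independently of q. An empty W is allowed and
  gives access to the facts about germs at 0, whereas results drawn from the growth along an orbit
  ask for a point of W.\<close>

locale fixed_q =
  fixes m :: nat and f :: "real \<Rightarrow> nat \<Rightarrow> complex fls" and q :: real and lam :: complex
    and L U :: "complex \<Rightarrow> complex mat" and W :: "complex set" and M :: real
  assumes q: "q > 1"
    and nonzero: "\<And>j. j < m \<Longrightarrow> 1 + fls_const (of_real (q - 1)) * f q j \<noteq> 0"
    and U: "is_U m f q lam L U" and L: "is_Lambda m f q L"
    and sorted: "\<And>j k. j < k \<Longrightarrow> k < m \<Longrightarrow> kappa f q j \<le> kappa f q k"
    and nonres: "\<And>j k (n::int). j < m \<Longrightarrow> k < m \<Longrightarrow> j \<noteq> k \<Longrightarrow> kappa f q j = kappa f q k \<Longrightarrow>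
      tau f q j \<noteq> of_real q powi n * tau f q k"
    and W: "open W" "0 \<notin> W" "\<And>x. x \<in> W \<Longrightarrow> x / of_real q \<in> W"
    and Wu: "\<And>j. j < m \<Longrightarrow> W \<subseteq> cont_dom (\<lambda>x. U x $$ (j,j))"
    and Wg: "\<And>j. Suc j < m \<Longrightarrow>
      W \<subseteq> cont_dom (\<lambda>x. U x $$ (Suc j, Suc j) / (x * U (of_real q * x) $$ (j,j)))"
    and bound: "\<And>j x. Suc j < m \<Longrightarrow> x \<in> W \<Longrightarrow>
      norm (cont_val (\<lambda>x. U x $$ (Suc j, Suc j) / (x * U (of_real q * x) $$ (j,j))) x) \<le> M"
begin

abbreviation u where "u j k \<equiv> (\<lambda>x. U x $$ (j,k))"
abbreviation g where "g j \<equiv> (\<lambda>x. U x $$ (Suc j, Suc j) / (x * U (of_real q * x) $$ (j,j)))"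
abbreviation v where "v j k \<equiv> (\<lambda>x. U x $$ (j,k) / U x $$ (j,j))"

lemma q0: "complex_of_real q \<noteq> 0" using q by simp

lemma tau0: "j < m \<Longrightarrow> tau f q j \<noteq> 0"
  using tau_nonzero nonzero by blast

lemma L_merom0: "j < m \<Longrightarrow> merom0 (\<lambda>x. L x $$ (j,j))"
  using Lambda_properties(1)[OF L] by (intro merom0_meromorphic_on)

lemma L_at:
  assumes "x \<noteq> 0"
  shows "eventually (\<lambda>x. \<forall>j<m. L x $$ (j,j) \<noteq> 0 \<and>
    L (of_real q * x) $$ (j,j) = tau f q j * x powi kappa f q j * L x $$ (j,j)) (at x)"
proof -
  have "\<forall>\<^sub>\<approx>x\<in>- {0}. \<forall>j<m. L x $$ (j,j) \<noteq> 0 \<and>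
    L (of_real q * x) $$ (j,j) = tau f q j * x powi kappa f q j * L x $$ (j,j)"
    by (rule eventually_mono[OF Lambda_properties(2)[OF L]]) auto
  then show ?thesis using assms by (subst (asm) eventually_cosparse_open_eq) auto
qed

lemma L_near0:
  "near0 (\<lambda>x. \<forall>j<m. L x $$ (j,j) \<noteq> 0 \<and>
    L (of_real q * x) $$ (j,j) = tau f q j * x powi kappa f q j * L x $$ (j,j))"
  unfolding near0_altdef using L_at by (intro exI[of _ 1]) auto

lemma L_generic:
  obtains B where "countable B" "\<And>z n i. z \<notin> B \<Longrightarrow> z \<noteq> 0 \<Longrightarrow> i < m \<Longrightarrow>
      L (z / of_real q ^ n) $$ (i,i) \<noteq> 0 \<and> L (z / of_real q ^ n) $$ (i,i) =
      tau f q i * (z / of_real q ^ Suc n) powi kappa f q i * L (z / of_real q ^ Suc n) $$ (i,i)"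
proof -
  have "\<exists>B. countable B \<and> (\<forall>x. x \<notin> B \<longrightarrow> (\<forall>n. x / of_real q ^ n \<in> - {0} \<longrightarrow>
      (\<forall>j<m. L (x / of_real q ^ n) $$ (j,j) \<noteq> 0 \<and>
      L (of_real q * (x / of_real q ^ n)) $$ (j,j) =
      tau f q j * (x / of_real q ^ n) powi kappa f q j * L (x / of_real q ^ n) $$ (j,j))))"
    by (rule generic_at[OF _ L_at q]) auto
  then obtain B where B: "countable B"
    "\<And>x n. x \<notin> B \<Longrightarrow> x / of_real q ^ n \<in> - {0} \<Longrightarrow> \<forall>j<m. L (x / of_real q ^ n) $$ (j,j) \<noteq> 0 \<and>
      L (of_real q * (x / of_real q ^ n)) $$ (j,j) =
      tau f q j * (x / of_real q ^ n) powi kappa f q j * L (x / of_real q ^ n) $$ (j,j)" by blast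
  show ?thesis
  proof (rule that[OF B(1)])
    fix z n i assume z: "z \<notin> B" "z \<noteq> 0" and i: "i < m"
    have nz: "z / of_real q ^ n \<in> - {0}" for n using z(2) q by simp
    have e: "of_real q * (z / of_real q ^ Suc n) = z / of_real q ^ n" using q by simp
    show "L (z / of_real q ^ n) $$ (i,i) \<noteq> 0 \<and> L (z / of_real q ^ n) $$ (i,i) =
      tau f q i * (z / of_real q ^ Suc n) powi kappa f q i * L (z / of_real q ^ Suc n) $$ (i,i)"
      using B(2)[OF z(1) nz, of n] B(2)[OF z(1) nz, of "Suc n"] i unfolding e by blast
  qed
qed

lemma diagonal:
  obtains F where "\<And>j. j < m \<Longrightarrow> fls_conv_radius (F j) > 0"
    "\<And>j. j < m \<Longrightarrow> eval_fls (F j) \<midarrow>0\<rightarrow> 1"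
    "near0 (\<lambda>x. \<forall>j<m. U x $$ (j,j) = eval_fls (F j) x * L x $$ (j,j))"
    "near0 (\<lambda>x. \<forall>j<m. eval_fls (F j) x \<noteq> 0)"
proof -
  obtain F where F: "\<And>i j. i < m \<Longrightarrow> j < m \<Longrightarrow> fls_conv_radius (F i j) > 0"
    "\<And>j. j < m \<Longrightarrow> F j j \<noteq> 0 \<and> fls_subdegree (F j j) = 0 \<and> fls_nth (F j j) 0 = 1"
    "near0 (\<lambda>x. (\<forall>j<m. U x $$ (j,j) = eval_fls (F j j) x * L x $$ (j,j)) \<and>
        (\<forall>i<m. \<forall>j<i. U x $$ (i,j) = 0))"
    by (rule U_structure[OF U L]) ((rule sorted; assumption), (rule that; assumption))
  have lim: "eval_fls (F j j) \<midarrow>0\<rightarrow> 1" if "j < m" for j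
    using has_laurent_expansion_imp_tendsto_0[OF eval_fls_has_laurent_expansion[OF F(1)[OF that that]]] F(2)[OF that]
    by simp
  show ?thesis
  proof (rule that[of "\<lambda>j. F j j"])
    show "near0 (\<lambda>x. \<forall>j<m. U x $$ (j,j) = eval_fls (F j j) x * L x $$ (j,j))"
      by (rule near0_mono[OF F(3)]) auto
    show "near0 (\<lambda>x. \<forall>j<m. eval_fls (F j j) x \<noteq> 0)"
      by (intro near0_all_less near0_eventually tendsto_imp_eventually_ne[OF lim]) auto
  qed (use F lim in auto)
qed

lemma u_merom0: "j < m \<Longrightarrow> merom0 (u j j)"
  and u_nonzero: "near0 (\<lambda>x. \<forall>j<m. U x $$ (j,j) \<noteq> 0)"
proof -
  obtain F where F: "\<And>j. j < m \<Longrightarrow> fls_conv_radius (F j) > 0"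
    "near0 (\<lambda>x. \<forall>j<m. U x $$ (j,j) = eval_fls (F j) x * L x $$ (j,j))"
    "near0 (\<lambda>x. \<forall>j<m. eval_fls (F j) x \<noteq> 0)" by (rule diagonal) (rule that; assumption)
  show "merom0 (u j j)" if "j < m"
  proof (rule merom0_near0_cong)
    show "near0 (\<lambda>x. U x $$ (j,j) = eval_fls (F j) x * L x $$ (j,j))"
      by (rule near0_mono[OF F(2)]) (use that in auto)
  qed (intro merom0_mult merom0_eval_fls F(1) L_merom0 that)+
  show "near0 (\<lambda>x. \<forall>j<m. U x $$ (j,j) \<noteq> 0)"
    by (rule near0_mono[OF near0_conj[OF near0_conj[OF F(2,3)] L_near0]]) auto
qed

lemma g_merom0:
  assumes "Suc j < m" shows "merom0 (g j)"
  by (intro merom0_divide merom0_mult merom0_id u_merom0 merom0_scale[where c = "of_real q"] q0)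
    (use assms in auto)

text \<open>Poles are excluded by the bound at the surrounding points of the open set W; at a pole
  itself \<open>cont_val\<close> is 0 and a bound would carry no information.\<close>

lemma g_analytic: "Suc j < m \<Longrightarrow> cont_val (g j) analytic_on W"
  by (rule nicely_meromorphic_bounded(1)[OF W(1), where B = "{}" and C = "\<lambda>_. M"])
    (auto intro!: bound continuous_intros nicely_meromorphic_on_subset[OF cont_val_nicely_meromorphic[OF g_merom0]]
      Wg[THEN subsetD])

lemma W_power: "x \<in> W \<Longrightarrow> x / of_real q ^ n \<in> W"
proof (induction n)
  case (Suc n)
  then have "x / of_real q ^ n / of_real q \<in> W" using W(3) by blast
  then show ?case by (simp add: mult.commute)
qed auto

text \<open>
  Ratio test: a bounded nonzero sequence cannot have ratios eventually above \<open>c > 1\<close>. The points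
  \<open>x / q\<^sup>n\<close> must avoid the zeros and poles of the solution, a countable set.
\<close>
lemma kappa_step:
  assumes j: "Suc j < m" and ne: "w \<in> W"
  shows "kappa f q (Suc j) = kappa f q j"
    and "norm (tau f q j) \<le> norm (tau f q (Suc j)) * q powi (- (1 + kappa f q j))"
proof -
  obtain F where F: "\<And>j. j < m \<Longrightarrow> eval_fls (F j) \<midarrow>0\<rightarrow> 1"
    "near0 (\<lambda>x. \<forall>j<m. U x $$ (j,j) = eval_fls (F j) x * L x $$ (j,j))" by (rule diagonal) (rule that; assumption)
  have j': "j < m" using j by simp
  have "near0 (\<lambda>x. (\<forall>j<m. U x $$ (j,j) = eval_fls (F j) x * L x $$ (j,j)) \<and> cont_val (g j) x = g j x)"
    by (rule near0_conj[OF F(2) near0_cont_val[OF g_merom0[OF j]]])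
  from generic_near0[OF this q] obtain B1 where B1: "countable B1"
    "\<And>x. x \<notin> B1 \<Longrightarrow> x \<noteq> 0 \<Longrightarrow> \<forall>\<^sub>F n in sequentially.
      (\<forall>j<m. U (x / of_real q ^ n) $$ (j,j) = eval_fls (F j) (x / of_real q ^ n) * L (x / of_real q ^ n) $$ (j,j))
      \<and> cont_val (g j) (x / of_real q ^ n) = g j (x / of_real q ^ n)" by blast
  obtain B2 where B2: "countable B2" "\<And>z n i. z \<notin> B2 \<Longrightarrow> z \<noteq> 0 \<Longrightarrow> i < m \<Longrightarrow>
      L (z / of_real q ^ n) $$ (i,i) \<noteq> 0 \<and> L (z / of_real q ^ n) $$ (i,i) =
      tau f q i * (z / of_real q ^ Suc n) powi kappa f q i * L (z / of_real q ^ Suc n) $$ (i,i)"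
    by (rule L_generic) (rule that; assumption)
  obtain z where z: "z \<in> W" "z \<notin> B1 \<union> B2"
    using open_minus_countable_nonempty[OF W(1) ne, of "B1 \<union> B2"] B1(1) B2(1) by auto
  have z0: "z \<noteq> 0" using z W(2) by auto
  define x where "x = (\<lambda>n. z / complex_of_real q ^ n)"
  have xq: "of_real q * x (Suc n) = x n" for n using q by (simp add: x_def)
  have Lx: "L (x n) $$ (i,i) \<noteq> 0"
    "L (x n) $$ (i,i) = tau f q i * x (Suc n) powi kappa f q i * L (x (Suc n)) $$ (i,i)" if "i < m" for n i
    unfolding x_def using B2(2)[OF _ z0 that] z(2) by blast+
  have bd: "eventually (\<lambda>n. norm (eval_fls (F (Suc j)) (x (Suc n)) * L (x (Suc n)) $$ (Suc j, Suc j) /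
     (x (Suc n) * (eval_fls (F j) (x n) * L (x n) $$ (j,j)))) \<le> M) sequentially"
  proof -
    have ev: "\<forall>\<^sub>F n in sequentially. (\<forall>j<m. U (x n) $$ (j,j) = eval_fls (F j) (x n) * L (x n) $$ (j,j))
      \<and> cont_val (g j) (x n) = g j (x n)"
      unfolding x_def by (rule B1(2)) (use z(2) z0 in auto)
    then have "\<forall>\<^sub>F n in sequentially. (\<forall>j<m. U (x (Suc n)) $$ (j,j) = eval_fls (F j) (x (Suc n)) * L (x (Suc n)) $$ (j,j))
      \<and> cont_val (g j) (x (Suc n)) = g j (x (Suc n))"
      by (rule eventually_sequentially_Suc[THEN iffD2])
    with ev show ?thesis
    proof eventually_elim
      case (elim n)
      have "norm (cont_val (g j) (x (Suc n))) \<le> M"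
        using bound[OF j W_power[OF z(1), of "Suc n"]] by (simp only: x_def)
      moreover have "cont_val (g j) (x (Suc n)) = g j (x (Suc n))" by (rule conjunct2[OF elim(2)])
      moreover have "U (x n) $$ (j,j) = eval_fls (F j) (x n) * L (x n) $$ (j,j)"
        by (rule conjunct1[OF elim(1), rule_format, OF j'])
      moreover have "U (x (Suc n)) $$ (Suc j, Suc j) = eval_fls (F (Suc j)) (x (Suc n)) * L (x (Suc n)) $$ (Suc j, Suc j)"
        by (rule conjunct1[OF elim(2), rule_format, OF j])
      ultimately show ?case by (simp only: xq)
    qed
  qed
  note kt = kappa_tau_bound[where A = "eval_fls (F j)" and B = "eval_fls (F (Suc j))" and x = x
      and L = "\<lambda>x. L x $$ (j,j)" and L' = "\<lambda>x. L x $$ (Suc j, Suc j)",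
      OF q z0 F(1)[OF j'] F(1)[OF j] tau0[OF j'] tau0[OF j] x_def Lx[OF j'] Lx[OF j] bd]
  have "kappa f q (Suc j) \<le> kappa f q j" by (rule kt(1))
  with sorted[of j "Suc j"] j show eq: "kappa f q (Suc j) = kappa f q j" by simp
  show "norm (tau f q j) \<le> norm (tau f q (Suc j)) * q powi (- (1 + kappa f q j))"
    by (rule kt(2)[OF eq])
qed

lemma kappa_const:
  assumes "w \<in> W" "j < m" "k < m" shows "kappa f q j = kappa f q k"
proof -
  have *: "kappa f q j = kappa f q 0" if "j < m" for j
    using that
  proof (induction j)
    case (Suc j)
    then show ?case using kappa_step(1)[OF Suc.prems assms(1)] by simp
  qed auto
  show ?thesis using *[OF assms(2)] *[OF assms(3)] by simp
qed

lemma tau_decay: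
  assumes w: "w \<in> W" and "j \<le> k" "k < m"
  shows "norm (tau f q j) \<le> norm (tau f q k) * (q powi (- (1 + kappa f q 0))) ^ (k - j)"
  using assms(2,3)
proof (induction "k - j" arbitrary: k)
  case 0
  then show ?case by simp
next
  case (Suc d)
  then obtain k' where k': "k = Suc k'" by (cases k) auto
  have *: "j \<le> k'" "k' < m" "d = k' - j" "Suc k' < m" "k - j = Suc (k' - j)" using Suc k' by auto
  define p where "p = q powi (- (1 + kappa f q 0))"
  have p: "p \<ge> 0" using q by (simp add: p_def)
  have "norm (tau f q j) \<le> norm (tau f q k') * p ^ (k' - j)"
    unfolding p_def using Suc.hyps(1)[OF *(3,1,2)] .
  also have "norm (tau f q k') \<le> norm (tau f q k) * p"
    using kappa_step(2)[OF *(4) w] kappa_const[OF w *(2), of 0] *(2)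
    unfolding k' p_def by (simp del: minus_add_distrib)
  then have "norm (tau f q k') * p ^ (k' - j) \<le> (norm (tau f q k) * p) * p ^ (k' - j)"
    using p by (intro mult_right_mono) auto
  also have "\<dots> = norm (tau f q k) * p ^ (k - j)"
    unfolding *(5) by simp
  finally show ?case unfolding p_def .
qed

end

context fixed_q begin

text \<open>A point of W makes all exponents equal, which releases the conditional parts of
  \<open>U_structure\<close>. The equation for F_jk is freed of f_j, so that it can be combined with
  U = F Lambda alone.\<close>

lemma full_structure:
  assumes w: "w \<in> W"
  obtains F where "\<And>i j. i < m \<Longrightarrow> j < m \<Longrightarrow> fls_conv_radius (F i j) > 0"
    "\<And>j. j < m \<Longrightarrow> eval_fls (F j j) \<midarrow>0\<rightarrow> 1"
    "near0 (\<lambda>x. \<forall>i<m. \<forall>j<m. U x $$ (i,j) = eval_fls (F i j) x * L x $$ (j,j))"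
    "\<And>j k. j < k \<Longrightarrow> k < m \<Longrightarrow> near0 (\<lambda>x.
      eval_fls (F j j) (of_real q * x) * (tau f q j * x powi kappa f q 0) * eval_fls (F j k) x +
      of_real (q - 1) * eval_fls (F (Suc j) k) x * eval_fls (F j j) x =
      eval_fls (F j k) (of_real q * x) * (tau f q k * x powi kappa f q 0) * eval_fls (F j j) x)"
    "\<And>j k n. j \<le> k \<Longrightarrow> k < m \<Longrightarrow> n < - int (k - j) * kappa f q 0 \<Longrightarrow> fls_nth (F j k) n = 0"
proof -
  obtain F where F: "\<And>i j. i < m \<Longrightarrow> j < m \<Longrightarrow> fls_conv_radius (F i j) > 0"
    "\<And>i j. i < m \<Longrightarrow> j < i \<Longrightarrow> F i j = 0"
    "\<And>j. j < m \<Longrightarrow> F j j \<noteq> 0 \<and> fls_subdegree (F j j) = 0 \<and> fls_nth (F j j) 0 = 1"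
    "near0 (\<lambda>x. \<forall>i<m. \<forall>j<m. U x $$ (i,j) = eval_fls (F i j) x * L x $$ (j,j))"
    and eq: "\<And>j k. j < m \<Longrightarrow> k < m \<Longrightarrow>
        (1 + fls_const (of_real (q - 1)) * f q j) * F j k +
          (if Suc j < m then fls_const (of_real (q - 1)) * F (Suc j) k else 0) =
        fls_sigma q (F j k) * (fls_const (tau f q k) * fls_X_intpow (kappa f q k))"
  proof (rule U_structure[OF U L])
    fix F assume F: "\<And>i j. i < m \<Longrightarrow> j < m \<Longrightarrow> fls_conv_radius (F i j) > 0"
    "\<And>i j. i < m \<Longrightarrow> j < i \<Longrightarrow> F i j = 0"
    "\<And>j. j < m \<Longrightarrow> F j j \<noteq> 0 \<and> fls_subdegree (F j j) = 0 \<and> fls_nth (F j j) 0 = 1"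
    "(\<And>j k. j < m \<Longrightarrow> k < m \<Longrightarrow> kappa f q j = kappa f q k) \<Longrightarrow>
      near0 (\<lambda>x. \<forall>i<m. \<forall>j<m. U x $$ (i,j) = eval_fls (F i j) x * L x $$ (j,j))"
    "(\<And>j k. j < m \<Longrightarrow> k < m \<Longrightarrow> kappa f q j = kappa f q k) \<Longrightarrow>
      (\<And>j k. j < m \<Longrightarrow> k < m \<Longrightarrow>
        (1 + fls_const (of_real (q - 1)) * f q j) * F j k +
          (if Suc j < m then fls_const (of_real (q - 1)) * F (Suc j) k else 0) =
        fls_sigma q (F j k) * (fls_const (tau f q k) * fls_X_intpow (kappa f q k)))"
    show thesis
      by (rule that[OF F(1) F(2) F(3) F(4) F(5)]) (assumption | rule kappa_const[OF w])+
  qed (rule sorted)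
  have k0: "kappa f q j = kappa f q 0" if "j < m" for j
    using kappa_const[OF w that, of 0] that by auto
  show ?thesis
  proof (rule that[OF F(1) _ F(4)])
    show "eval_fls (F j j) \<midarrow>0\<rightarrow> 1" if "j < m" for j
      using has_laurent_expansion_imp_tendsto_0[OF eval_fls_has_laurent_expansion[OF F(1)[OF that that]]] F(3)[OF that]
      by simp
    show "near0 (\<lambda>x.
      eval_fls (F j j) (of_real q * x) * (tau f q j * x powi kappa f q 0) * eval_fls (F j k) x +
      of_real (q - 1) * eval_fls (F (Suc j) k) x * eval_fls (F j j) x =
      eval_fls (F j k) (of_real q * x) * (tau f q k * x powi kappa f q 0) * eval_fls (F j j) x)"
      if jk: "j < k" "k < m" for j k
    proof -
      have lt: "j < m" "Suc j < m" using jk by auto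
      let ?X = "\<lambda>k. fls_const (tau f q k) * fls_X_intpow (kappa f q 0) :: complex fls"
      let ?s = "fls_const (of_real (q - 1)) :: complex fls"
      let ?c = "1 + ?s * f q j"
      have 1: "?c * F j j = fls_sigma q (F j j) * ?X j"
      proof -
        have "F (Suc j) j = 0" by (rule F(2)[OF lt(2)]) simp
        then show ?thesis using eq[OF lt(1) lt(1)] unfolding k0[OF lt(1)] by (simp only: lt(2) if_True mult_zero_right add_0_right)
      qed
      have 2: "?c * F j k + ?s * F (Suc j) k = fls_sigma q (F j k) * ?X k"
        using eq[OF lt(1) jk(2)] lt(2) unfolding k0[OF jk(2)] by simp
      \<comment> \<open>Entry (j,k) multiplied by F_jj, with the coefficient 1 + (q-1) f_j replaced
        by means of entry (j,j), where F_(j+1)j = 0.\<close>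
      have I: "fls_sigma q (F j j) * ?X j * F j k + ?s * F (Suc j) k * F j j =
        fls_sigma q (F j k) * ?X k * F j j"
        unfolding 1[symmetric] 2[symmetric] by (simp only: ring_distribs mult_ac)
      have E: "eval_fls (F j k) has_laurent_expansion F j k" if "j < m" "k < m" for j k
        using F(1)[OF that] by (rule eval_fls_has_laurent_expansion)
      have S: "(\<lambda>x. eval_fls (F j k) (of_real q * x)) has_laurent_expansion fls_sigma q (F j k)"
        if "j < m" "k < m" for j k
        using fls_sigma_has_laurent_expansion[OF E[OF that]] q by simp
      have l: "(\<lambda>x. eval_fls (F j j) (of_real q * x) * (tau f q j * x powi kappa f q 0) * eval_fls (F j k) x +
        of_real (q - 1) * eval_fls (F (Suc j) k) x * eval_fls (F j j) x) has_laurent_expansion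
        fls_sigma q (F j j) * ?X j * F j k + ?s * F (Suc j) k * F j j"
        by (intro has_laurent_expansion_add has_laurent_expansion_mult S E
          X_intpow_has_laurent_expansion has_laurent_expansion_const lt jk(2))
      have r: "(\<lambda>x. eval_fls (F j k) (of_real q * x) * (tau f q k * x powi kappa f q 0) * eval_fls (F j j) x)
        has_laurent_expansion fls_sigma q (F j k) * ?X k * F j j"
        by (intro has_laurent_expansion_mult S E X_intpow_has_laurent_expansion lt jk(2))
      show ?thesis
        by (rule near0_mono[OF near0_conj[OF eval_fls_eventually_eq[OF l] eval_fls_eventually_eq[OF r]]])
          (metis I)
    qed
    show "fls_nth (F j k) n = 0"
      if jk: "j \<le> k" "k < m" and n: "n < - int (k - j) * kappa f q 0" for j k n
    proof (rule coefficients_vanish[where q = q and c = "\<lambda>j. 1 + fls_const (of_real (q - 1)) * f q j"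
          and \<tau> = "tau f q" and \<kappa> = "kappa f q 0" and s = "of_real (q - 1)" and m = m])
      show "q > 0" using q by simp
      show "fls_subdegree (1 + fls_const (of_real (q - 1)) * f q j) = kappa f q 0 \<and>
        fls_nth (1 + fls_const (of_real (q - 1)) * f q j) (kappa f q 0) = tau f q j" if "j < m" for j
        using k0[OF that] unfolding kappa_def tau_def t0_def by metis
      show "fls_subdegree (F k k) = 0" if "k < m" for k using F(3) that by blast
      show "(1 + fls_const (of_real (q - 1)) * f q j) * F j k + fls_const (of_real (q - 1)) * F (Suc j) k =
        fls_sigma q (F j k) * (fls_const (tau f q k) * fls_X_intpow (kappa f q 0))" if "j < k" "k < m" for j k
        using eq[of j k] that unfolding k0[OF that(2)] by simp
      show "tau f q j \<noteq> of_real q powi n * tau f q k" if "j < m" "k < m" "j \<noteq> k" for j k n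
        using nonres[OF that kappa_const[OF w that(1,2)]] .
    qed (use jk n in auto)
  qed
qed

text \<open>Row j of the system gives u_jk(qx) = c u_jk(x) + (q-1) u_(j+1)k(x) and u_jj(qx) = c
  u_jj(x) with the same c. Dividing by u_jj(qx) leaves the increment (q-1) u_(j+1)k(x) / u_jj(qx),
  which is (q-1) x g_j(x) v_(j+1)k(x). The limit along x / q^n is claimed off a countable set, where
  U = F Lambda holds at the far points of the orbit.\<close>

lemma offdiagonal:
  assumes w: "w \<in> W" and jk: "j < k" "k < m"
  shows "merom0 (u j k)"
    and "near0 (\<lambda>x. v j k (of_real q * x) - v j k x = of_real (q - 1) * x * g j x * v (Suc j) k x)"
    and "\<exists>B. countable B \<and> (\<forall>x. x \<notin> B \<longrightarrow> x \<noteq> 0 \<longrightarrow> (\<lambda>n. v j k (x / of_real q ^ n)) \<longlonglongrightarrow> 0)"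
proof -
  obtain F where F: "\<And>i j. i < m \<Longrightarrow> j < m \<Longrightarrow> fls_conv_radius (F i j) > 0"
    "\<And>j. j < m \<Longrightarrow> eval_fls (F j j) \<midarrow>0\<rightarrow> 1"
    "near0 (\<lambda>x. \<forall>i<m. \<forall>j<m. U x $$ (i,j) = eval_fls (F i j) x * L x $$ (j,j))"
    "\<And>j k. j < k \<Longrightarrow> k < m \<Longrightarrow> near0 (\<lambda>x.
      eval_fls (F j j) (of_real q * x) * (tau f q j * x powi kappa f q 0) * eval_fls (F j k) x +
      of_real (q - 1) * eval_fls (F (Suc j) k) x * eval_fls (F j j) x =
      eval_fls (F j k) (of_real q * x) * (tau f q k * x powi kappa f q 0) * eval_fls (F j j) x)"
    "\<And>j k n. j \<le> k \<Longrightarrow> k < m \<Longrightarrow> n < - int (k - j) * kappa f q 0 \<Longrightarrow> fls_nth (F j k) n = 0"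
    by (rule full_structure[OF w]) (rule that; assumption)
  have lt: "j < m" "Suc j < m" using jk by auto
  have k0: "kappa f q j = kappa f q 0" if "j < m" for j
    using kappa_const[OF w that, of 0] that by auto
  show "merom0 (u j k)"
  proof (rule merom0_near0_cong)
    show "near0 (\<lambda>x. U x $$ (j,k) = eval_fls (F j k) x * L x $$ (k,k))"
      by (rule near0_mono[OF F(3)]) (use lt jk in auto)
    show "merom0 (\<lambda>x. eval_fls (F j k) x * L x $$ (k,k))"
      by (intro merom0_mult merom0_eval_fls F(1) L_merom0 lt jk)
  qed
  have Fnz: "near0 (\<lambda>x. \<forall>j<m. eval_fls (F j j) x \<noteq> 0)"
    by (intro near0_all_less near0_eventually tendsto_imp_eventually_ne[OF F(2)]) auto
  note all = near0_conj[OF near0_conj[OF near0_conj[OF F(3) near0_scale[OF q0 F(3)]]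
    near0_conj[OF Fnz near0_scale[OF q0 Fnz]]] near0_conj[OF L_near0 F(4)[OF jk]]]
  show "near0 (\<lambda>x. v j k (of_real q * x) - v j k x = of_real (q - 1) * x * g j x * v (Suc j) k x)"
  proof (rule near0_mono[OF all])
    fix x :: complex assume x0: "x \<noteq> 0"
    let ?qx = "of_real q * x" and ?s = "complex_of_real (q - 1)"
    define X where "X = x powi kappa f q 0"
    have X: "X \<noteq> 0" using x0 by (simp add: X_def)
    assume A: "((((\<forall>i<m. \<forall>j<m. U x $$ (i,j) = eval_fls (F i j) x * L x $$ (j,j)) \<and>
      (\<forall>i<m. \<forall>j<m. U ?qx $$ (i,j) = eval_fls (F i j) ?qx * L ?qx $$ (j,j))) \<and>
      (\<forall>j<m. eval_fls (F j j) x \<noteq> 0) \<and> (\<forall>j<m. eval_fls (F j j) ?qx \<noteq> 0)) \<and>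
      (\<forall>j<m. L x $$ (j,j) \<noteq> 0 \<and> L ?qx $$ (j,j) = tau f q j * x powi kappa f q j * L x $$ (j,j)) \<and>
      eval_fls (F j j) ?qx * (tau f q j * x powi kappa f q 0) * eval_fls (F j k) x +
      ?s * eval_fls (F (Suc j) k) x * eval_fls (F j j) x =
      eval_fls (F j k) ?qx * (tau f q k * x powi kappa f q 0) * eval_fls (F j j) x)"
    have Ux: "U x $$ (i,l) = eval_fls (F i l) x * L x $$ (l,l)"
      "U ?qx $$ (i,l) = eval_fls (F i l) ?qx * (tau f q l * X * L x $$ (l,l))" if "i < m" "l < m" for i l
      using A that k0[OF that(2)] unfolding X_def by auto
    have nz: "eval_fls (F i i) x \<noteq> 0" "eval_fls (F i i) ?qx \<noteq> 0" "L x $$ (i,i) \<noteq> 0" if "i < m" for i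
      using A that by auto
    have I: "eval_fls (F j j) ?qx * (tau f q j * X) * eval_fls (F j k) x +
      ?s * eval_fls (F (Suc j) k) x * eval_fls (F j j) x =
      eval_fls (F j k) ?qx * (tau f q k * X) * eval_fls (F j j) x"
      using A unfolding X_def by blast
    have alg: "a' * (t' * X' * l') / (b' * (t * X' * l)) - a * l' / (b * l) =
      s * x * (e * n / (x * (b' * (t * X' * l)))) * (c * l' / (e * n))"
      if "b' * (t * X') * a + s * c * b = a' * (t' * X') * b" "b \<noteq> 0" "b' \<noteq> 0" "t \<noteq> 0" "X' \<noteq> 0"
        "l \<noteq> 0" "e \<noteq> 0" "n \<noteq> 0" "x \<noteq> 0"
      for a' t' X' l' b' t l a b s e n c :: complex
    proof -
      have "a' * (t' * X' * l') / (b' * (t * X' * l)) - a * l' / (b * l) =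
        (a' * (t' * X') * b - b' * (t * X') * a) * l' / (b' * (t * X' * l) * b)"
        using that(2-) by (simp add: divide_simps) (simp add: algebra_simps)
      also have "a' * (t' * X') * b - b' * (t * X') * a = s * c * b"
        using that(1) by (simp add: algebra_simps)
      also have "s * c * b * l' / (b' * (t * X' * l) * b) =
        s * x * (e * n / (x * (b' * (t * X' * l)))) * (c * l' / (e * n))"
        using that(2-) by (simp add: divide_simps)
      finally show ?thesis .
    qed
    show "v j k ?qx - v j k x = ?s * x * g j x * v (Suc j) k x"
      unfolding Ux[OF lt(1) jk(2)] Ux[OF lt(1) lt(1)] Ux[OF lt(2) lt(2)] Ux[OF lt(2) jk(2)]
      by (rule alg[OF I]) (use nz lt X x0 tau0 in auto)
  qed
  from generic_near0[OF F(3) q] obtain B1 where B1: "countable B1"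
    "\<And>x. x \<notin> B1 \<Longrightarrow> x \<noteq> 0 \<Longrightarrow> \<forall>\<^sub>F n in sequentially.
      (\<forall>i<m. \<forall>j<m. U (x / of_real q ^ n) $$ (i,j) = eval_fls (F i j) (x / of_real q ^ n) * L (x / of_real q ^ n) $$ (j,j))"
    by blast
  obtain B2 where B2: "countable B2" "\<And>z n i. z \<notin> B2 \<Longrightarrow> z \<noteq> 0 \<Longrightarrow> i < m \<Longrightarrow>
      L (z / of_real q ^ n) $$ (i,i) \<noteq> 0 \<and> L (z / of_real q ^ n) $$ (i,i) =
      tau f q i * (z / of_real q ^ Suc n) powi kappa f q i * L (z / of_real q ^ Suc n) $$ (i,i)"
    by (rule L_generic) (rule that; assumption)
  show "\<exists>B. countable B \<and> (\<forall>x. x \<notin> B \<longrightarrow> x \<noteq> 0 \<longrightarrow> (\<lambda>n. v j k (x / of_real q ^ n)) \<longlonglongrightarrow> 0)"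
  proof (rule exI[of _ "B1 \<union> B2"], intro conjI allI impI)
    show "countable (B1 \<union> B2)" using B1(1) B2(1) by simp
    fix z :: complex assume zB: "z \<notin> B1 \<union> B2" and z0: "z \<noteq> 0"
    define x where "x = (\<lambda>n. z / complex_of_real q ^ n)"
    have Lx: "L (x n) $$ (i,i) \<noteq> 0"
      "L (x n) $$ (i,i) = tau f q i * x (Suc n) powi kappa f q 0 * L (x (Suc n)) $$ (i,i)" if "i < m" for n i
      unfolding x_def k0[OF that, symmetric] using B2(2)[OF _ z0 that] zB by blast+
    have d: "k - j \<ge> 1" using jk by simp
    note lim = quotient_tendsto_0[where A = "eval_fls (F j j)" and F = "F j k" and x = x
      and L = "\<lambda>x. L x $$ (j,j)" and L' = "\<lambda>x. L x $$ (k,k)" and d = "k - j" and \<kappa> = "kappa f q 0",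
      OF q z0 x_def F(2)[OF lt(1)] F(1)[OF lt(1) jk(2)] F(5)[OF less_imp_le[OF jk(1)] jk(2)]
      d tau0[OF lt(1)] tau0[OF jk(2)] tau_decay[OF w less_imp_le[OF jk(1)] jk(2)]
      Lx[OF lt(1)] Lx[OF jk(2)]]
    have "\<forall>\<^sub>F n in sequentially. eval_fls (F j k) (x n) * L (x n) $$ (k,k) / (eval_fls (F j j) (x n) * L (x n) $$ (j,j)) =
      v j k (x n)"
    proof -
      have "z \<notin> B1" using zB by simp
      from B1(2)[OF this z0] show ?thesis
        unfolding x_def by (rule eventually_mono) (use lt jk in auto)
    qed
    from Lim_transform_eventually[OF lim this]
    show "(\<lambda>n. v j k (z / of_real q ^ n)) \<longlonglongrightarrow> 0" unfolding x_def .
  qed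
qed

end

section \<open>Fixed q: continuation, bounds and series for the quotients v_jk\<close>

lemma ray_star_INT:
  assumes "finite I" "I \<noteq> {}" "\<And>i. i \<in> I \<Longrightarrow> ray_star (A i)"
  shows "ray_star (\<Inter>i\<in>I. A i)"
  using assms unfolding ray_star_def by (auto intro!: open_INT)

lemma ray_star_divide:
  assumes "ray_star X" "x \<in> X" "q \<ge> (1::real)"
  shows "x / of_real q ^ n \<in> X"
proof -
  have "inverse (q ^ n) \<in> {0<..1}" using assms(3) by (auto simp: inverse_le_1_iff)
  then have "of_real (inverse (q ^ n)) * x \<in> X"
    using assms(1,2) unfolding ray_star_def by blast
  then show ?thesis by (simp add: divide_inverse mult.commute)
qed

lemma meromorphic_on_scaled:
  assumes "f meromorphic_on X" "ray_star X" "q \<ge> (1::real)"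
  shows "(\<lambda>y. f (y / of_real q ^ n)) meromorphic_on X"
  by (rule meromorphic_on_compose[OF assms(1)])
    (use ray_star_divide[OF assms(2) _ assms(3)] assms(3) in \<open>auto intro!: analytic_intros\<close>)

text \<open>The total mass of the weights in the series for v_jk. That it is 1 for every q makes the
  bounds below independent of q.\<close>

lemma sums_geometric_inverse:
  assumes "q > (1::real)"
  shows "(\<lambda>n. (q - 1) * inverse q ^ Suc n) sums 1"
proof -
  have "(\<lambda>n. (q - 1) * inverse q * inverse q ^ n) sums ((q - 1) * inverse q * (1 / (1 - inverse q)))"
    by (intro sums_mult geometric_sums) (use assms in \<open>simp add: inverse_less_1_iff\<close>)
  moreover have "(q - 1) * inverse q * (1 / (1 - inverse q)) = 1"
    using assms by (simp add: field_simps)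
  ultimately show ?thesis by (simp only: mult.assoc power_Suc)
qed

text \<open>Telescoping; the sum starts at x / c because each increment is evaluated at the inner
  point.\<close>

lemma sums_of_recursion:
  fixes V T :: "complex \<Rightarrow> complex"
  assumes "\<And>n. V (x / c ^ n) = V (x / c ^ Suc n) + T (x / c ^ Suc n)"
    and "(\<lambda>n. V (x / c ^ n)) \<longlonglongrightarrow> 0"
  shows "(\<lambda>n. T (x / c ^ Suc n)) sums V x"
proof -
  have "(\<Sum>n<N. T (x / c ^ Suc n)) = V x - V (x / c ^ N)" for N
  proof (induction N)
    case (Suc N)
    then show ?case using assms(1)[of N] by simp
  qed simp
  moreover have "(\<lambda>N. V x - V (x / c ^ N)) \<longlonglongrightarrow> V x - 0"
    by (intro tendsto_intros assms(2))
  ultimately show ?thesis unfolding sums_def by simp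
qed

context fixed_q begin

text \<open>The set on which the v_jk are continued. For m > 0 it is star-shaped, as the identity
  theorem requires, while the bounds are available on W. The case distinction is there because
  \<open>g j\<close> makes sense for Suc j < m only.\<close>

definition X0 where
  "X0 = (\<Inter>j\<in>{..<m}. if Suc j < m then cont_dom (u j j) \<inter> cont_dom (g j) else cont_dom (u j j))"

lemma X0_ray_star: "m > 0 \<Longrightarrow> ray_star X0"
  unfolding X0_def
  by (intro ray_star_INT) (auto intro!: ray_star_Int ray_star_cont_dom u_merom0 g_merom0)

lemma X0_subset:
  shows "j < m \<Longrightarrow> X0 \<subseteq> cont_dom (u j j)" and "Suc j < m \<Longrightarrow> X0 \<subseteq> cont_dom (g j)"
proof -
  have *: "X0 \<subseteq> (if Suc j < m then cont_dom (u j j) \<inter> cont_dom (g j) else cont_dom (u j j))" if "j < m"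
    unfolding X0_def by (rule INT_lower) (use that in simp)
  show "X0 \<subseteq> cont_dom (u j j)" if "j < m"
    using *[OF that] by (simp split: if_splits)
  show "X0 \<subseteq> cont_dom (g j)" if "Suc j < m"
    using *[OF Suc_lessD[OF that]] that by simp
qed

lemma W_subset_X0: "W \<subseteq> X0"
  unfolding X0_def using Wu Wg by auto

lemma u_merom0': "w \<in> W \<Longrightarrow> j \<le> k \<Longrightarrow> k < m \<Longrightarrow> merom0 (u j k)"
  using u_merom0 offdiagonal(1) by (cases "j = k") auto

lemma v_merom0: "w \<in> W \<Longrightarrow> j \<le> k \<Longrightarrow> k < m \<Longrightarrow> merom0 (v j k)"
  by (intro merom0_divide u_merom0' u_merom0) auto

text \<open>The increment \<open>v j k (q x) - v j k x\<close> near 0, written with continued values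
  so that it makes sense on all of \<open>X0\<close>.\<close>

definition T where "T j k x = of_real (q - 1) * x * cont_val (g j) x * cont_val (v (Suc j) k) x"

text \<open>Iterating the recursion N times expresses v_jk(y) through v_jk(y / q^N), where y / q^N
  lies in the disc on which v_jk is given, and through values of T, known on \<open>X0\<close>; this
  continues v_jk. At generic points of W the decay along the orbit yields the series, which the
  geometric weights bound by (M |x|)^(e+1). The bound excludes poles on W and itself implies decay
  at every point, so the series holds on the whole of W.\<close>

lemma quotient_step:
  assumes w: "w \<in> W" and jk: "j < k" "k < m"
    and IH: "X0 \<subseteq> cont_dom (v (Suc j) k)" "cont_val (v (Suc j) k) analytic_on W"
      "\<And>x. x \<in> W \<Longrightarrow> norm (cont_val (v (Suc j) k) x) \<le> (M * norm x) ^ e"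
  shows "X0 \<subseteq> cont_dom (v j k)" "cont_val (v j k) analytic_on W"
    "\<And>x. x \<in> W \<Longrightarrow> norm (cont_val (v j k) x) \<le> (M * norm x) ^ Suc e"
    "\<And>x. x \<in> W \<Longrightarrow> (\<lambda>n. T j k (x / of_real q ^ Suc n)) sums cont_val (v j k) x"
proof -
  have lt: "j < m" "Suc j < m" "Suc j \<le> k" using jk by auto
  have X0: "ray_star X0" using X0_ray_star lt by simp
  have q1: "q \<ge> 1" using q by simp
  have M: "M \<ge> 0" using bound[OF lt(2) w] norm_ge_zero order_trans by blast
  let ?V = "cont_val (v j k)"
  have vm: "merom0 (v j k)" "merom0 (v (Suc j) k)" by (auto intro!: v_merom0[OF w] lt jk less_imp_le)
  have Gm: "cont_val (g j) meromorphic_on X0"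
    using cont_val_nicely_meromorphic[OF g_merom0[OF lt(2)]] X0_subset(2)[OF lt(2)]
    by (meson meromorphic_on_subset nicely_meromorphic_on_def)
  have Vm': "cont_val (v (Suc j) k) meromorphic_on X0"
    using cont_val_nicely_meromorphic[OF vm(2)] IH(1)
    by (meson meromorphic_on_subset nicely_meromorphic_on_def)
  have Tm: "T j k meromorphic_on X0"
    unfolding T_def by (intro meromorphic_on_mult meromorphic_on_const meromorphic_on_id Gm Vm')
  have "near0 (\<lambda>x. v j k (of_real q * x) - v j k x = T j k x)"
    by (rule near0_mono[OF near0_conj[OF offdiagonal(2)[OF w jk]
          near0_conj[OF near0_cont_val[OF g_merom0[OF lt(2)]] near0_cont_val[OF vm(2)]]]])
      (simp only: T_def)
  from near0_scale[OF _ this, of "inverse (of_real q)"]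
  have step: "near0 (\<lambda>x. v j k x = v j k (x / of_real q) + T j k (x / of_real q))"
  proof (rule near0_mono)
    fix x :: complex
    assume *: "v j k (of_real q * (inverse (of_real q) * x)) - v j k (inverse (of_real q) * x) =
      T j k (inverse (of_real q) * x)"
    have e: "inverse (of_real q) * x = x / of_real q" "of_real q * (x / of_real q) = x"
      using q by (simp_all add: divide_inverse mult.commute)
    show "v j k x = v j k (x / of_real q) + T j k (x / of_real q)"
      using * unfolding e by (simp only: diff_eq_eq add.commute)
  qed (use q in simp)
  have expand: "near0 (\<lambda>y. v j k (y / of_real q ^ N) + (\<Sum>n<N. T j k (y / of_real q ^ Suc n)) = v j k y)" for N
  proof (induction N)
    case 0
    show ?case by (rule near0_eventually) simp
  next
    case (Suc N)
    have alg: "a = b + t \<and> a + S = c \<Longrightarrow> b + (S + t) = c" for a b c t S :: complex by auto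
    have "near0 (\<lambda>x. v j k (inverse (of_real q ^ N) * x) = v j k (inverse (of_real q ^ N) * x / of_real q) +
        T j k (inverse (of_real q ^ N) * x / of_real q))"
      by (rule near0_scale[OF _ step]) (use q in simp)
    then have "near0 (\<lambda>x. v j k (x / of_real q ^ N) = v j k (x / of_real q ^ Suc N) + T j k (x / of_real q ^ Suc N))"
    proof (rule near0_mono)
      fix x :: complex
      have e: "inverse (of_real q ^ N) * x = x / of_real q ^ N"
        "x / of_real q ^ N / of_real q = x / of_real q ^ Suc N"
        by (simp_all add: divide_inverse mult.commute)
      assume "v j k (inverse (of_real q ^ N) * x) = v j k (inverse (of_real q ^ N) * x / of_real q) +
        T j k (inverse (of_real q ^ N) * x / of_real q)"
      then show "v j k (x / of_real q ^ N) = v j k (x / of_real q ^ Suc N) + T j k (x / of_real q ^ Suc N)"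
        unfolding e .
    qed
    from near0_conj[OF this Suc] show ?case
    proof (rule near0_mono)
      fix x :: complex
      assume "v j k (x / of_real q ^ N) = v j k (x / of_real q ^ Suc N) + T j k (x / of_real q ^ Suc N) \<and>
        v j k (x / of_real q ^ N) + (\<Sum>n<N. T j k (x / of_real q ^ Suc n)) = v j k x"
      then show "v j k (x / of_real q ^ Suc N) + (\<Sum>n<Suc N. T j k (x / of_real q ^ Suc n)) = v j k x"
        unfolding sum.lessThan_Suc using alg by blast
    qed
  qed
  show sub: "X0 \<subseteq> cont_dom (v j k)"
  proof
    fix x assume x: "x \<in> X0"
    obtain r where r: "r > 0" "v j k meromorphic_on ball 0 r - {0}"
      using vm(1) unfolding merom0_def by blast
    \<comment> \<open>So large that x / q^N lies in the disc of radius r where v_jk is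
      meromorphic.\<close>
    obtain N where N: "norm x / r < q ^ N" using real_arch_pow[OF q] by blast
    define X1 where "X1 = X0 \<inter> (ball 0 (r * q ^ N) - {0})"
    have X1: "ray_star X1" unfolding X1_def by (intro ray_star_Int X0 ray_star_ball)
    have "(\<lambda>y. v j k (y / of_real q ^ N)) meromorphic_on X1"
      by (rule meromorphic_on_compose[OF r(2)])
        (use q in \<open>auto intro!: analytic_intros simp: X1_def norm_divide norm_power pos_divide_less_eq\<close>)
    moreover have "(\<lambda>y. T j k (y / of_real q ^ Suc n)) meromorphic_on X1" for n
      by (rule meromorphic_on_subset[OF meromorphic_on_scaled[OF Tm X0 q1]]) (auto simp: X1_def)
    ultimately have "(\<lambda>y. v j k (y / of_real q ^ N) + (\<Sum>n<N. T j k (y / of_real q ^ Suc n))) meromorphic_on X1"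
      by (intro meromorphic_on_add meromorphic_on_sum)
    from ray_star_subset_cont_dom[OF X1 this expand vm(1)]
    show "x \<in> cont_dom (v j k)"
      using x N r(1) X0 unfolding X1_def ray_star_def by (auto simp: pos_divide_less_eq mult.commute)
  qed
  have Vn: "?V nicely_meromorphic_on X0"
    using cont_val_nicely_meromorphic[OF vm(1)] sub by (rule nicely_meromorphic_on_subset)
  then have Vm: "?V meromorphic_on X0" unfolding nicely_meromorphic_on_def by blast
  \<comment> \<open>An identity of meromorphic functions, hence valid in punctured neighbourhoods;
    it becomes exact first at generic points and, once analyticity is known, everywhere on
    W.\<close>
  have rec: "eventually (\<lambda>y. ?V y = ?V (y / of_real q) + T j k (y / of_real q)) (at x)" if "x \<in> X0" for x
  proof (rule meromorphic_identity[OF X0 Vm _ _ that])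
    show "(\<lambda>y. ?V (y / of_real q) + T j k (y / of_real q)) meromorphic_on X0"
      using meromorphic_on_scaled[OF Vm X0 q1, of 1] meromorphic_on_scaled[OF Tm X0 q1, of 1]
      by (simp add: meromorphic_on_add)
    have "near0 (\<lambda>y. ?V (inverse (of_real q) * y) = v j k (inverse (of_real q) * y))"
      by (rule near0_scale[OF _ near0_cont_val[OF vm(1)]]) (use q in simp)
    from near0_conj[OF this near0_conj[OF step near0_cont_val[OF vm(1)]]]
    show "near0 (\<lambda>y. ?V y = ?V (y / of_real q) + T j k (y / of_real q))"
      by (rule near0_mono) (simp add: divide_inverse mult.commute)
  qed
  have Tbound: "norm (T j k (x / of_real q ^ Suc n)) \<le> ((q - 1) * inverse q ^ Suc n) * (M * norm x) ^ Suc e"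
    if x: "x \<in> W" for x n
  proof -
    let ?y = "x / of_real q ^ Suc n"
    have y: "?y \<in> W" using W_power[OF x] .
    have ny: "norm ?y = norm x * inverse q ^ Suc n"
      using q by (simp add: norm_divide norm_mult norm_power norm_inverse norm_mult divide_inverse power_inverse)
    have "inverse q ^ Suc n \<le> 1" using q by (intro power_le_one) (auto simp: inverse_le_1_iff)
    then have "norm ?y \<le> norm x" unfolding ny by (intro mult_left_le) auto
    then have "(M * norm ?y) ^ e \<le> (M * norm x) ^ e" using M by (intro power_mono mult_left_mono) auto
    then have 1: "norm (cont_val (v (Suc j) k) ?y) \<le> (M * norm x) ^ e" using IH(3)[OF y] by linarith
    have "norm (T j k ?y) = ((q - 1) * norm ?y) * norm (cont_val (g j) ?y) * norm (cont_val (v (Suc j) k) ?y)"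
      unfolding T_def norm_mult norm_of_real using q by simp
    also have "\<dots> \<le> ((q - 1) * norm ?y) * M * (M * norm x) ^ e"
      using q M by (intro mult_mono bound[OF lt(2) y] 1 order_refl) auto
    also have "\<dots> = ((q - 1) * inverse q ^ Suc n) * (M * norm x) ^ Suc e"
      unfolding ny power_Suc[of "M * norm x"] by (simp only: mult_ac)
    finally show ?thesis .
  qed
  have "\<exists>B. countable B \<and> (\<forall>x. x \<notin> B \<longrightarrow> (\<forall>n. x / of_real q ^ n \<in> X0 \<longrightarrow>
    ?V (x / of_real q ^ n) = ?V (x / of_real q ^ n / of_real q) + T j k (x / of_real q ^ n / of_real q)))"
    by (rule generic_at[OF _ rec q]) (use X0 in \<open>auto simp: ray_star_def\<close>)
  then obtain B1 where B1: "countable B1" "\<And>x n. x \<notin> B1 \<Longrightarrow> x / of_real q ^ n \<in> X0 \<Longrightarrow>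
    ?V (x / of_real q ^ n) = ?V (x / of_real q ^ n / of_real q) + T j k (x / of_real q ^ n / of_real q)"
    by blast
  obtain B2 where B2: "countable B2" "\<And>x. x \<notin> B2 \<Longrightarrow> x \<noteq> 0 \<Longrightarrow> (\<lambda>n. v j k (x / of_real q ^ n)) \<longlonglongrightarrow> 0"
    using offdiagonal(3)[OF w jk] by blast
  obtain B3 where B3: "countable B3" "\<And>x. x \<notin> B3 \<Longrightarrow> x \<noteq> 0 \<Longrightarrow>
    \<forall>\<^sub>F n in sequentially. ?V (x / of_real q ^ n) = v j k (x / of_real q ^ n)"
    using generic_near0[OF near0_cont_val[OF vm(1)] q] by blast
  \<comment> \<open>Decay is so far known for the original v_jk off B2; B3 transfers it to the
    continued values, and B1 makes the recursion exact along the orbit.\<close>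
  have generic: "norm (?V x) \<le> (M * norm x) ^ Suc e" if x: "x \<in> W" "x \<notin> B1 \<union> B2 \<union> B3" for x
  proof -
    have x0: "x \<noteq> 0" using x(1) W(2) by auto
    have "(\<lambda>n. ?V (x / of_real q ^ n)) \<longlonglongrightarrow> 0"
    proof (rule Lim_transform_eventually)
      show "(\<lambda>n. v j k (x / of_real q ^ n)) \<longlonglongrightarrow> 0" using B2(2) x x0 by auto
      show "\<forall>\<^sub>F n in sequentially. v j k (x / of_real q ^ n) = ?V (x / of_real q ^ n)"
        by (rule eventually_mono[OF B3(2)]) (use x x0 in auto)
    qed
    moreover have "?V (x / of_real q ^ n) = ?V (x / of_real q ^ Suc n) + T j k (x / of_real q ^ Suc n)" for n
    proof -
      have "x / of_real q ^ n \<in> X0" "x \<notin> B1" using W_power[OF x(1)] W_subset_X0 x(2) by auto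
      moreover have e: "x / of_real q ^ n / of_real q = x / of_real q ^ Suc n" by (simp add: mult.commute)
      ultimately show ?thesis using B1(2)[of x n] unfolding e by blast
    qed
    ultimately have s: "(\<lambda>n. T j k (x / of_real q ^ Suc n)) sums ?V x"
      by (intro sums_of_recursion)
    have s2: "(\<lambda>n. ((q - 1) * inverse q ^ Suc n) * (M * norm x) ^ Suc e) sums (1 * (M * norm x) ^ Suc e)"
      by (intro sums_mult2 sums_geometric_inverse q)
    have "norm (?V x) \<le> (\<Sum>n. ((q - 1) * inverse q ^ Suc n) * (M * norm x) ^ Suc e)"
      unfolding sums_unique[OF s]
      by (rule norm_suminf_le[OF Tbound[OF x(1)] sums_summable[OF s2]])
    then show ?thesis using sums_unique[OF s2] by simp
  qed
  have "continuous_on W (\<lambda>x. (M * norm x) ^ Suc e)" by (intro continuous_intros)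
  note bounded = nicely_meromorphic_bounded[where B = "B1 \<union> B2 \<union> B3", OF W(1) nicely_meromorphic_on_subset[OF Vn W_subset_X0] _ this generic]
  show an: "?V analytic_on W" by (rule bounded) (use B1(1) B2(1) B3(1) in auto)
  show bd: "norm (?V x) \<le> (M * norm x) ^ Suc e" if "x \<in> W" for x
    by (rule bounded(2)) (use B1(1) B2(1) B3(1) that in auto)
  show "(\<lambda>n. T j k (x / of_real q ^ Suc n)) sums ?V x" if x: "x \<in> W" for x
  proof (rule sums_of_recursion)
    have anT: "T j k analytic_on W"
      unfolding T_def by (intro analytic_intros IH(2) g_analytic lt)
    fix n
    let ?y = "x / of_real q ^ n"
    have y: "?y \<in> W" using W_power[OF x] .
    have img: "(\<lambda>y. y / of_real q) ` W \<subseteq> W" using W(3) by auto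
    have sc: "(\<lambda>y. y / complex_of_real q) analytic_on W" using q by (intro analytic_intros) auto
    have "(\<lambda>y. ?V (y / of_real q) + T j k (y / of_real q)) analytic_on W"
      using analytic_on_compose_gen[OF sc an] analytic_on_compose_gen[OF sc anT] W(3)
      unfolding o_def by (intro analytic_on_add) auto
    note nm = analytic_on_imp_nicely_meromorphic_on[OF this] analytic_on_imp_nicely_meromorphic_on[OF an]
    have "?V ?y = ?V (?y / of_real q) + T j k (?y / of_real q)"
    proof (rule nicely_meromorphic_eqI[where f = ?V and g = "\<lambda>y. ?V (y / of_real q) + T j k (y / of_real q)"])
      show "eventually (\<lambda>y. ?V y = ?V (y / of_real q) + T j k (y / of_real q)) (at ?y)"
        by (rule rec) (use y W_subset_X0 in blast)
    qed (rule nicely_meromorphic_on_subset[OF nm(2)] nicely_meromorphic_on_subset[OF nm(1)]; use y in simp)+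
    then show "?V (x / of_real q ^ n) = ?V (x / of_real q ^ Suc n) + T j k (x / of_real q ^ Suc n)"
      by (simp add: mult.commute)
  next
    \<comment> \<open>The bound (M |x| / q^n)^(e+1), with positive exponent, now gives decay at
      every x of W and not only at generic ones.\<close>
    have "(\<lambda>n. (M * norm x) ^ Suc e * (inverse q ^ Suc e) ^ n) \<longlonglongrightarrow> (M * norm x) ^ Suc e * 0"
    proof (rule tendsto_mult[OF tendsto_const], rule LIMSEQ_power_zero)
      have "inverse q ^ Suc e < 1"
        by (rule power_Suc_less_one) (use q in \<open>auto simp: inverse_less_1_iff\<close>)
      then show "norm (inverse q ^ Suc e) < 1" using q by (simp only: norm_power norm_inverse real_norm_def) simp
    qed
    moreover have "norm (?V (x / of_real q ^ n)) \<le> (M * norm x) ^ Suc e * (inverse q ^ Suc e) ^ n" for n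
    proof -
      have "norm (?V (x / of_real q ^ n)) \<le> (M * norm (x / of_real q ^ n)) ^ Suc e"
        by (rule bd[OF W_power[OF x]])
      also have "norm (x / of_real q ^ n) = norm x * inverse q ^ n"
        using q by (simp add: norm_divide norm_power norm_inverse norm_mult divide_inverse power_inverse)
      also have "(M * (norm x * inverse q ^ n)) ^ Suc e = (M * norm x) ^ Suc e * (inverse q ^ Suc e) ^ n"
      proof -
        have "(inverse q ^ n) ^ Suc e = (inverse q ^ Suc e) ^ n"
          unfolding power_mult[symmetric] mult.commute[of n "Suc e"] by (rule refl)
        moreover have "M * (norm x * inverse q ^ n) = (M * norm x) * inverse q ^ n" by (rule mult.assoc[symmetric])
        ultimately show ?thesis by (simp only: power_mult_distrib)
      qed
      finally show ?thesis .
    qed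
    ultimately show "(\<lambda>n. ?V (x / of_real q ^ n)) \<longlonglongrightarrow> 0"
      unfolding mult_zero_right by (rule Lim_null_comparison[OF always_eventually[OF allI], rotated])
  qed
qed

lemma quotients:
  assumes w: "w \<in> W" and jk: "j \<le> k" "k < m"
  shows "X0 \<subseteq> cont_dom (v j k) \<and> cont_val (v j k) analytic_on W \<and>
    (\<forall>x\<in>W. norm (cont_val (v j k) x) \<le> (M * norm x) ^ (k - j))"
  using jk(1)
proof (induction "k - j" arbitrary: j)
  case 0
  then have jk': "j = k" by simp
  have one: "near0 (\<lambda>x. 1 = v j j x)"
    by (rule near0_mono[OF u_nonzero]) (use jk jk' in auto)
  have vm: "merom0 (v j j)" using v_merom0[OF w, of j j] jk jk' by simp
  have X: "ray_star X0" using X0_ray_star jk by simp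
  have an: "(\<lambda>_. 1) analytic_on {x}" for x :: complex by simp
  have val: "cont_val (v j j) x = 1" "cont_val (v j j) analytic_on {x}" if "x \<in> X0" for x
    using cont_val_eq_analytic[OF X meromorphic_on_const one vm that an] by auto
  have "X0 \<subseteq> cont_dom (v j j)"
    by (rule ray_star_subset_cont_dom[OF X meromorphic_on_const one vm])
  moreover have "cont_val (v j j) analytic_on W"
    using val(2) W_subset_X0 analytic_on_analytic_at by blast
  moreover have "\<forall>x\<in>W. norm (cont_val (v j j) x) \<le> (M * norm x) ^ (k - j)"
    using val(1) W_subset_X0 jk' by auto
  ultimately show ?case using jk' by simp
next
  case (Suc d)
  then have *: "d = k - Suc j" "Suc j \<le> k" "j < k" "k - j = Suc (k - Suc j)" by auto
  note IH = Suc.hyps(1)[OF *(1,2)]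
  show ?case
    using quotient_step[OF w *(3) jk(2), of "k - Suc j"] IH unfolding *(4) by blast
qed

lemma v_analytic: "j \<le> k \<Longrightarrow> k < m \<Longrightarrow> cont_val (v j k) analytic_on W"
  using quotients[of _ j k] by (cases "W = {}") (auto simp: analytic_on_def)

lemma v_bound: "j \<le> k \<Longrightarrow> k < m \<Longrightarrow> x \<in> W \<Longrightarrow> norm (cont_val (v j k) x) \<le> (M * norm x) ^ (k - j)"
  using quotients by blast

lemma v_sums:
  assumes "j < k" "k < m" "x \<in> W"
  shows "(\<lambda>n. T j k (x / of_real q ^ Suc n)) sums cont_val (v j k) x"
  by (rule quotient_step(4)[OF assms(3,1,2), where e = "k - Suc j"])
    (use quotients[OF assms(3), of "Suc j" k] assms in auto)

lemma v_diag:
  assumes "k < m" "x \<in> W"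
  shows "cont_val (v k k) x = 1"
proof -
  have "near0 (\<lambda>x. 1 = v k k x)"
    by (rule near0_mono[OF u_nonzero]) (use assms in auto)
  then show ?thesis
    using cont_val_eq_analytic(1)[OF X0_ray_star meromorphic_on_const _ v_merom0[OF assms(2), of k k], of 1 x]
      assms W_subset_X0 by auto
qed

text \<open>u_jk is recovered as u_jj v_jk. Analyticity of u_jj is asked at x alone, because the
  bounds concern quotients and do not control u_jj along the orbit.\<close>

lemma u_continues:
  assumes jk: "j \<le> k" "k < m" and x: "x \<in> W" and an: "cont_val (u j j) analytic_on {x}"
  shows "continues_to (u j k) x" "cont_val (u j k) x = cont_val (u j j) x * cont_val (v j k) x"
    "cont_val (u j k) analytic_on {x}"
proof -
  have lt: "j < m" using jk by simp
  have X: "ray_star X0" using X0_ray_star lt by simp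
  let ?h = "\<lambda>x. cont_val (u j j) x * cont_val (v j k) x"
  have um: "merom0 (u j k)" using u_merom0'[OF x jk] .
  have h1: "?h meromorphic_on X0"
  proof (rule meromorphic_on_mult)
    show "cont_val (u j j) meromorphic_on X0"
      using nicely_meromorphic_on_subset[OF cont_val_nicely_meromorphic[OF u_merom0[OF lt]] X0_subset(1)[OF lt]]
      by (simp add: nicely_meromorphic_on_def)
    show "cont_val (v j k) meromorphic_on X0"
      using nicely_meromorphic_on_subset[OF cont_val_nicely_meromorphic[OF v_merom0[OF x jk]]
        conjunct1[OF quotients[OF x jk]]]
      by (simp add: nicely_meromorphic_on_def)
  qed
  have h2: "near0 (\<lambda>x. ?h x = u j k x)"
    by (rule near0_mono[OF near0_conj[OF u_nonzero near0_conj[OF near0_cont_val[OF u_merom0[OF lt]]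
          near0_cont_val[OF v_merom0[OF x jk]]]]]) (use lt in auto)
  have xX: "x \<in> X0" using x W_subset_X0 by blast
  show "continues_to (u j k) x" by (rule cont_val_remove_sings(1)[OF X h1 h2 um xX])
  have "?h analytic_on {x}"
    using an v_analytic[OF jk] x by (intro analytic_on_mult) (auto intro: analytic_on_subset)
  from cont_val_eq_analytic[OF X h1 h2 um xX this]
  show "cont_val (u j k) x = ?h x" "cont_val (u j k) analytic_on {x}" by auto
qed

end

section \<open>Continuous convergence\<close>

text \<open>Continuous convergence: the parameter and the argument move together. On an open set
  with continuous limit it amounts to uniform convergence on compact subsets, but it passes directly
  through products, through the shift from z to q z and through Riemann sums with a moving base
  point.\<close>

definition cconv :: "complex set \<Rightarrow> (real \<Rightarrow> complex \<Rightarrow> complex) \<Rightarrow> (complex \<Rightarrow> complex) \<Rightarrow> bool" where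
  "cconv D \<phi> l \<longleftrightarrow> (\<forall>Q W w. (\<forall>i::nat. Q i > 1) \<longrightarrow> Q \<longlonglongrightarrow> 1 \<longrightarrow> W \<longlonglongrightarrow> w \<longrightarrow> w \<in> D \<longrightarrow>
     (\<lambda>i. \<phi> (Q i) (W i)) \<longlonglongrightarrow> l w)"

lemma cconvD:
  assumes "cconv D \<phi> l" "\<And>i. Q i > 1" "Q \<longlonglongrightarrow> 1" "W \<longlonglongrightarrow> w" "w \<in> D"
  shows "(\<lambda>i. \<phi> (Q i) (W i)) \<longlonglongrightarrow> l w"
  using assms(1)[unfolded cconv_def, rule_format, OF assms(2-5)] .

lemma sequence_at_right:
  assumes "\<And>i. Q i > (1::real)" "Q \<longlonglongrightarrow> 1"
  shows "filterlim Q (at_right 1) sequentially"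
  using assms by (intro tendsto_imp_filterlim_at_right) auto

text \<open>A failure of uniformity yields q_i < 1 + 1/(i+1) and points w_i of K where the distance
  is at least e; a convergent subsequence of the w_i contradicts continuous convergence.\<close>

lemma cconv_imp_uniform_limit:
  assumes c: "cconv D \<phi> l" and l: "continuous_on D l" and K: "compact K" "K \<subseteq> D"
  shows "uniform_limit K \<phi> l (at_right 1)"
proof (rule ccontr)
  assume "\<not> uniform_limit K \<phi> l (at_right 1)"
  then obtain e where e: "e > 0" "\<not> eventually (\<lambda>q. \<forall>w\<in>K. dist (\<phi> q w) (l w) < e) (at_right 1)"
    unfolding uniform_limit_iff by blast
  have ex: "\<exists>q w. 1 < q \<and> q < 1 + 1 / real (Suc i) \<and> w \<in> K \<and> dist (\<phi> q w) (l w) \<ge> e" for i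
  proof (rule ccontr)
    assume *: "\<not> (\<exists>q w. 1 < q \<and> q < 1 + 1 / real (Suc i) \<and> w \<in> K \<and> dist (\<phi> q w) (l w) \<ge> e)"
    have "eventually (\<lambda>q. q \<in> {1<..<1 + 1 / real (Suc i)}) (at_right 1)"
      by (rule eventually_at_right_real) simp
    then have "eventually (\<lambda>q. \<forall>w\<in>K. dist (\<phi> q w) (l w) < e) (at_right 1)"
    proof eventually_elim
      case (elim q)
      show ?case
      proof
        fix w assume "w \<in> K"
        then show "dist (\<phi> q w) (l w) < e" using * elim by (auto simp: not_le)
      qed
    qed
    then show False using e(2) by blast
  qed
  have "\<forall>i. \<exists>p. 1 < fst p \<and> fst p < 1 + 1 / real (Suc i) \<and> snd p \<in> K \<and> dist (\<phi> (fst p) (snd p)) (l (snd p)) \<ge> e"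
    using ex by auto
  from choice[OF this] obtain p where p: "\<And>i. 1 < fst (p i) \<and> fst (p i) < 1 + 1 / real (Suc i) \<and> snd (p i) \<in> K \<and>
    dist (\<phi> (fst (p i)) (snd (p i))) (l (snd (p i))) \<ge> e" by blast
  define Q where "Q = (\<lambda>i. fst (p i))"
  define W where "W = (\<lambda>i. snd (p i))"
  have QW: "\<And>i. 1 < Q i" "\<And>i. Q i < 1 + 1 / real (Suc i)" "\<And>i. W i \<in> K"
    "\<And>i. dist (\<phi> (Q i) (W i)) (l (W i)) \<ge> e" using p by (simp_all add: Q_def W_def)
  obtain w r where r: "w \<in> K" "strict_mono r" "(W \<circ> r) \<longlonglongrightarrow> w"
    using K(1) QW(3) unfolding compact_def by blast
  have "Q \<longlonglongrightarrow> 1"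
  proof (rule tendsto_sandwich[of "\<lambda>_. 1" _ _ "\<lambda>i. 1 + 1 / real (Suc i)"])
    show "(\<lambda>i. 1 + 1 / real (Suc i)) \<longlonglongrightarrow> 1"
      using tendsto_add[OF tendsto_const[of 1] LIMSEQ_inverse_real_of_nat] by (simp add: inverse_eq_divide)
  qed (use QW in \<open>auto intro!: always_eventually less_imp_le\<close>)
  then have Qr: "(\<lambda>i. Q (r i)) \<longlonglongrightarrow> 1" using LIMSEQ_subseq_LIMSEQ[OF _ r(2)] by (simp add: o_def)
  have Wr: "(\<lambda>i. W (r i)) \<longlonglongrightarrow> w" using r(3) by (simp add: o_def)
  have wD: "w \<in> D" using r(1) K(2) by blast
  have 1: "(\<lambda>i. \<phi> (Q (r i)) (W (r i))) \<longlonglongrightarrow> l w"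
    by (rule cconvD[OF c QW(1) Qr Wr wD])
  have "\<forall>i. W (r i) \<in> D" using QW(3) K(2) by blast
  then have 2: "(\<lambda>i. l (W (r i))) \<longlonglongrightarrow> l w"
    by (intro continuous_on_tendsto_compose[OF l Wr wD]) simp
  have "eventually (\<lambda>i. dist (\<phi> (Q (r i)) (W (r i))) (l (W (r i))) < e) sequentially"
    by (rule order_tendstoD(2)[OF tendsto_dist[OF 1 2]]) (use e(1) in simp)
  then obtain i where "dist (\<phi> (Q (r i)) (W (r i))) (l (W (r i))) < e"
    unfolding eventually_sequentially by blast
  then show False using QW(4)[of "r i"] by simp
qed

lemma uniform_limit_imp_cconv:
  assumes D: "open D" and l: "continuous_on D l"
    and u: "\<And>K. compact K \<Longrightarrow> K \<subseteq> D \<Longrightarrow> uniform_limit K \<phi> l (at_right 1)"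
  shows "cconv D \<phi> l"
  unfolding cconv_def
proof (intro allI impI)
  fix Q :: "nat \<Rightarrow> real" and W w
  assume Q: "\<forall>i. Q i > 1" "Q \<longlonglongrightarrow> 1" and W: "W \<longlonglongrightarrow> w" and w: "w \<in> D"
  obtain d where d: "d > 0" "cball w d \<subseteq> D" using D w open_contains_cball by blast
  have WK: "eventually (\<lambda>i. W i \<in> cball w d) sequentially"
    by (rule eventually_mono[OF tendstoD[OF W d(1)]]) (simp add: dist_commute)
  have lW: "(\<lambda>i. l (W i)) \<longlonglongrightarrow> l w"
    by (rule continuous_on_tendsto_compose[OF l W w]) (rule eventually_mono[OF WK], use d(2) in blast)
  have "(\<lambda>i. dist (\<phi> (Q i) (W i)) (l (W i))) \<longlonglongrightarrow> 0"
  proof (rule tendstoI)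
    fix e :: real assume e: "e > 0"
    have "eventually (\<lambda>q. \<forall>w\<in>cball w d. dist (\<phi> q w) (l w) < e) (at_right 1)"
      using uniform_limitD[OF u[OF compact_cball d(2)] e] .
    then have "eventually (\<lambda>i. \<forall>w\<in>cball w d. dist (\<phi> (Q i) w) (l w) < e) sequentially"
      using sequence_at_right[of Q] Q unfolding filterlim_iff by blast
    with WK show "eventually (\<lambda>i. dist (dist (\<phi> (Q i) (W i)) (l (W i))) 0 < e) sequentially"
      by eventually_elim simp
  qed
  from Lim_transform[OF lW] this show "(\<lambda>i. \<phi> (Q i) (W i)) \<longlonglongrightarrow> l w"
    by (simp add: dist_norm tendsto_norm_zero_iff)
qed

lemma compact_enlarge:
  fixes D :: "complex set"
  assumes "compact K" "open D" "K \<subseteq> D"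
  obtains \<delta> where "\<delta> > 0" "compact (\<Union>x\<in>K. cball x \<delta>)" "(\<Union>x\<in>K. cball x \<delta>) \<subseteq> D"
  by (rule compact_subset_open_imp_cball_epsilon_subset[OF assms]) (rule that; simp add: compact_minkowski_sum_cball assms(1))

section \<open>Riemann sums along a ray\<close>

lemma set_integrable_exp_minus: "set_integrable lborel {0..} (\<lambda>s::real. exp (- s))"
proof -
  have "(\<integral>\<^sup>+s. ennreal (exp (- s)) * indicator {0..} s \<partial>lborel) = ennreal (0 - (- exp (- 0)))"
  proof (rule nn_integral_FTC_atLeast)
    show "((\<lambda>s::real. - exp (- s)) \<longlongrightarrow> 0) at_top" by real_asymp
  qed (auto intro!: derivative_eq_intros)
  then have "(\<integral>\<^sup>+s. ennreal (indicator {0..} s * exp (- s)) \<partial>lborel) < \<infinity>"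
    by (simp add: ennreal_mult' ennreal_indicator mult.commute)
  then show ?thesis
    unfolding set_integrable_def by (intro integrableI_nonneg) (auto simp: mult.commute)
qed

lemma floor_divide_bounds:
  fixes s h :: real
  assumes "h > 0"
  shows "of_int \<lfloor>s / h\<rfloor> * h \<le> s" "s < (of_int \<lfloor>s / h\<rfloor> + 1) * h"
proof -
  have "of_int \<lfloor>s / h\<rfloor> * h \<le> s / h * h" "s / h * h < (of_int \<lfloor>s / h\<rfloor> + 1) * h"
    using assms by (intro mult_right_mono mult_strict_right_mono; linarith)+
  then show "of_int \<lfloor>s / h\<rfloor> * h \<le> s" "s < (of_int \<lfloor>s / h\<rfloor> + 1) * h" using assms by simp_all
qed

text \<open>The series is the integral of the step function equal to G n on [n h, (n+1) h[; the
  exponential bound makes it integrable, so that countable additivity applies.\<close>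

lemma step_integral:
  fixes G :: "int \<Rightarrow> complex"
  assumes h: "h > 0" and bd: "\<And>s. s \<ge> 0 \<Longrightarrow> norm (G \<lfloor>s / h\<rfloor>) \<le> C * exp (- s)"
  shows "(\<lambda>s. G \<lfloor>s / h\<rfloor>) \<in> borel_measurable borel"
    and "(LINT s:{0..}|lborel. G \<lfloor>s / h\<rfloor>) = (\<Sum>n. of_real h * G (int n))"
proof -
  show meas: "(\<lambda>s. G \<lfloor>s / h\<rfloor>) \<in> borel_measurable borel"
    by (rule measurable_compose[where g = G and N = "count_space UNIV"]) auto
  let ?A = "\<lambda>n::nat. {real n * h..<real (Suc n) * h}"
  have fl: "\<lfloor>s / h\<rfloor> = int n" if "s \<in> ?A n" for s n
    using that h by (intro floor_unique) (auto simp: field_simps)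
  have un: "(\<Union>n. ?A n) = {0..}"
  proof (intro equalityI subsetI)
    fix s :: real assume "s \<in> {0..}"
    then have s: "s \<ge> 0" by simp
    have f0: "\<lfloor>s / h\<rfloor> \<ge> 0" using s h by simp
    have "real (nat \<lfloor>s / h\<rfloor>) = of_int \<lfloor>s / h\<rfloor>" using f0 by simp
    then have "s \<in> ?A (nat \<lfloor>s / h\<rfloor>)" using floor_divide_bounds[OF h, of s] by (simp add: add.commute)
    then show "s \<in> (\<Union>n. ?A n)" by blast
  next
    fix s assume "s \<in> (\<Union>n. ?A n)"
    then obtain n where "real n * h \<le> s" by auto
    moreover have "0 \<le> real n * h" using h by simp
    ultimately show "s \<in> {0..}" by simp
  qed
  have disj: "?A i \<inter> ?A j = {}" if "i \<noteq> j" for i j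
  proof (rule ccontr)
    assume "?A i \<inter> ?A j \<noteq> {}"
    then obtain s where "s \<in> ?A i" "s \<in> ?A j" by blast
    then show False using fl[of s i] fl[of s j] that by simp
  qed
  have int: "set_integrable lborel (\<Union>n. ?A n) (\<lambda>s. G \<lfloor>s / h\<rfloor>)"
    unfolding un
  proof (rule set_integrable_bound[where f = "\<lambda>s. C * exp (- s)"])
    show "set_integrable lborel {0..} (\<lambda>s::real. C * exp (- s))"
      by (intro set_integrable_mult_right set_integrable_exp_minus)
    show "set_borel_measurable lborel {0..} (\<lambda>s. G \<lfloor>s / h\<rfloor>)"
      unfolding set_borel_measurable_def using meas by (intro borel_measurable_scaleR) auto
    show "AE s in lborel. s \<in> {0..} \<longrightarrow> norm (G \<lfloor>s / h\<rfloor>) \<le> norm (C * exp (- s))"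
    proof (intro AE_I2 impI)
      fix s :: real assume "s \<in> {0..}"
      then have "norm (G \<lfloor>s / h\<rfloor>) \<le> C * exp (- s)" using bd by simp
      also have "\<dots> \<le> norm (C * exp (- s))" by simp
      finally show "norm (G \<lfloor>s / h\<rfloor>) \<le> norm (C * exp (- s))" .
    qed
  qed
  have piece: "(LINT s:?A n|lborel. G \<lfloor>s / h\<rfloor>) = of_real h * G (int n)" for n
  proof -
    have "(LINT s:?A n|lborel. G \<lfloor>s / h\<rfloor>) = (LINT s:?A n|lborel. G (int n))"
      by (rule set_lebesgue_integral_cong) (use fl in auto)
    also have "\<dots> = (LINT s|lborel. indicator (?A n) s) *\<^sub>R G (int n)"
    proof -
      have "real n * h \<le> real (Suc n) * h" using h by (intro mult_right_mono) auto
      then have "emeasure lborel (?A n) < \<infinity>" by (simp only: emeasure_lborel_Ico) simp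
      then show ?thesis
        unfolding set_lebesgue_integral_def
        by (intro integral_scaleR_left integrable_real_indicator) auto
    qed
    also have "(LINT s|lborel. indicator (?A n) s) = (h::real)" using h by (simp add: algebra_simps)
    finally show ?thesis by (simp add: scaleR_conv_of_real)
  qed
  have "(LINT s:(\<Union>n. ?A n)|lborel. G \<lfloor>s / h\<rfloor>) = (\<Sum>n. LINT s:?A n|lborel. G \<lfloor>s / h\<rfloor>)"
    by (rule lebesgue_integral_countable_add[OF _ _ int]) (use disj in auto)
  then show "(LINT s:{0..}|lborel. G \<lfloor>s / h\<rfloor>) = (\<Sum>n. of_real h * G (int n))"
    unfolding un piece .
qed

text \<open>With h = ln q, the n-th term samples the integrand at the right end s = (n+1) h of a
  step of length h, with weight q - 1 in place of h; the ratio of the two tends to 1. The step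
  functions are dominated by a multiple of exp (-s), and dominated convergence yields integrability
  of the limit together with the value.\<close>

lemma riemann_sum_limit:
  fixes \<psi> :: "real \<Rightarrow> complex \<Rightarrow> complex" and \<psi>0 :: "complex \<Rightarrow> complex"
  assumes D: "\<And>w s. w \<in> D \<Longrightarrow> s \<ge> 0 \<Longrightarrow> w - of_real s \<in> D"
    and c: "cconv D \<psi> \<psi>0"
    and Q: "\<And>i::nat. Q i > 1" "Q \<longlonglongrightarrow> 1" and W: "W \<longlonglongrightarrow> w" and w: "w \<in> D"
    and bd: "\<And>i n. norm (\<psi> (Q i) (W i - of_real (real (Suc n) * ln (Q i)))) \<le> M"
    and S: "\<And>i. (\<lambda>n. of_real (Q i - 1) * exp (W i - of_real (real (Suc n) * ln (Q i))) *
      \<psi> (Q i) (W i - of_real (real (Suc n) * ln (Q i)))) sums S i"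
  shows "set_integrable lborel {0..} (\<lambda>s. exp (w - of_real s) * \<psi>0 (w - of_real s))"
    and "S \<longlonglongrightarrow> (LINT s:{0..}|lborel. exp (w - of_real s) * \<psi>0 (w - of_real s))"
proof -
  define h where "h = (\<lambda>i. ln (Q i))"
  have h: "h i > 0" for i using Q(1)[of i] by (simp add: h_def)
  have h0: "h \<longlonglongrightarrow> 0" unfolding h_def using tendsto_ln[OF Q(2)] by simp
  \<comment> \<open>The shift k + 1 selects the right end of the step, where exp (W - s) has its
    smallest modulus; hence the domination by exp (-s).\<close>
  define G where "G = (\<lambda>i (k::int). exp (W i - of_real (of_int (k + 1) * h i)) * \<psi> (Q i) (W i - of_real (of_int (k + 1) * h i)))"
  have "Bseq W" using W by (intro convergent_imp_Bseq convergentI)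
  then obtain R where R: "\<And>i. norm (W i) \<le> R" unfolding Bseq_def by blast
  have M0: "M \<ge> 0" using bd[of 0 0] norm_ge_zero order_trans by blast
  define C where "C = exp R * M"
  have Gbd: "norm (G i \<lfloor>s / h i\<rfloor>) \<le> C * exp (- s)" if s: "s \<ge> 0" for i s
  proof -
    define n where "n = nat \<lfloor>s / h i\<rfloor>"
    have n: "\<lfloor>s / h i\<rfloor> = int n" using s h[of i] by (simp add: n_def)
    let ?y = "W i - of_real (real (Suc n) * ln (Q i))"
    have "G i (int n) = exp ?y * \<psi> (Q i) ?y"
      unfolding G_def h_def by (simp add: add.commute)
    then have G: "G i \<lfloor>s / h i\<rfloor> = exp ?y * \<psi> (Q i) ?y" unfolding n .
    have "s \<le> real (Suc n) * h i" using floor_divide_bounds(2)[OF h, of s i] unfolding n by (simp add: add.commute)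
    moreover have "Re (W i) \<le> R" using R[of i] complex_Re_le_cmod order_trans by blast
    ultimately have "Re ?y \<le> R + - s" unfolding h_def by simp
    then have "norm (exp ?y) \<le> exp R * exp (- s)" unfolding norm_exp_eq_Re exp_add[symmetric] by simp
    then have "norm (exp ?y) * norm (\<psi> (Q i) ?y) \<le> (exp R * exp (- s)) * M"
      by (intro mult_mono bd) auto
    then show ?thesis unfolding G norm_mult C_def by (simp only: mult_ac)
  qed
  note step = step_integral[OF h Gbd]
  have suminf: "(LINT s:{0..}|lborel. G i \<lfloor>s / h i\<rfloor>) = of_real (h i / (Q i - 1)) * S i" for i
  proof -
    have q: "Q i - 1 \<noteq> 0" using Q(1)[of i] by simp
    have "(\<lambda>n. of_real (h i / (Q i - 1)) * (of_real (Q i - 1) * exp (W i - of_real (real (Suc n) * ln (Q i))) *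
      \<psi> (Q i) (W i - of_real (real (Suc n) * ln (Q i))))) sums (of_real (h i / (Q i - 1)) * S i)"
      by (rule sums_mult[OF S])
    moreover have "of_real (h i / (Q i - 1)) * (of_real (Q i - 1) * exp (W i - of_real (real (Suc n) * ln (Q i))) *
      \<psi> (Q i) (W i - of_real (real (Suc n) * ln (Q i)))) = of_real (h i) * G i (int n)" for n
    proof -
      have "complex_of_real (h i / (Q i - 1)) * of_real (Q i - 1) = of_real (h i)"
        using q by (simp only: of_real_mult[symmetric]) simp
      moreover have "G i (int n) = exp (W i - of_real (real (Suc n) * ln (Q i))) * \<psi> (Q i) (W i - of_real (real (Suc n) * ln (Q i)))"
        unfolding G_def h_def by (simp add: add.commute)
      ultimately show ?thesis by (simp only: mult.assoc[symmetric])
    qed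
    ultimately have "(\<lambda>n. of_real (h i) * G i (int n)) sums (of_real (h i / (Q i - 1)) * S i)" by (simp only:)
    then show ?thesis using step(2)[of i] sums_unique by metis
  qed
  let ?f = "\<lambda>s::real. indicator {0..} s *\<^sub>R (exp (w - of_real s) * \<psi>0 (w - of_real s))"
  let ?F = "\<lambda>i s. indicator {0..} s *\<^sub>R G i \<lfloor>s / h i\<rfloor>"
  have pw: "(\<lambda>i. ?F i s) \<longlonglongrightarrow> ?f s" for s
  proof (cases "s \<ge> 0")
    case True
    have "(\<lambda>i. of_int (\<lfloor>s / h i\<rfloor> + 1) * h i) \<longlonglongrightarrow> s"
    proof (rule tendsto_sandwich[of "\<lambda>_. s" _ _ "\<lambda>i. s + h i"])
      have "s \<le> of_int (\<lfloor>s / h i\<rfloor> + 1) * h i \<and> of_int (\<lfloor>s / h i\<rfloor> + 1) * h i \<le> s + h i" for i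
      proof -
        have "of_int (\<lfloor>s / h i\<rfloor> + 1) * h i = of_int \<lfloor>s / h i\<rfloor> * h i + h i" by (simp add: algebra_simps)
        then show ?thesis using floor_divide_bounds[OF h, of s i] by (simp add: algebra_simps)
      qed
      then show "\<forall>\<^sub>F i in sequentially. s \<le> of_int (\<lfloor>s / h i\<rfloor> + 1) * h i"
        "\<forall>\<^sub>F i in sequentially. of_int (\<lfloor>s / h i\<rfloor> + 1) * h i \<le> s + h i" by auto
      show "(\<lambda>i. s + h i) \<longlonglongrightarrow> s" using tendsto_add[OF tendsto_const[of s] h0] by simp
    qed simp
    then have lim: "(\<lambda>i. W i - of_real (of_int (\<lfloor>s / h i\<rfloor> + 1) * h i)) \<longlonglongrightarrow> w - of_real s"
      by (intro tendsto_diff W tendsto_of_real)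
    have "(\<lambda>i. G i \<lfloor>s / h i\<rfloor>) \<longlonglongrightarrow> exp (w - of_real s) * \<psi>0 (w - of_real s)"
      unfolding G_def by (intro tendsto_mult tendsto_exp lim cconvD[OF c Q lim D[OF w True]])
    then show ?thesis using True by simp
  qed simp
  have dom: "integrable lborel (\<lambda>s. indicator {0..} s *\<^sub>R (C * exp (- s)))"
    using set_integrable_mult_right[OF set_integrable_exp_minus, of C] unfolding set_integrable_def by simp
  have Fm: "?F i \<in> borel_measurable lborel" for i
    using step(1)[of i] by (intro borel_measurable_scaleR) auto
  have fm: "?f \<in> borel_measurable lborel"
    by (rule borel_measurable_LIMSEQ_metric[OF Fm pw])
  have le: "norm (?F i s) \<le> indicator {0..} s *\<^sub>R (C * exp (- s))" for i s
    using Gbd[of s i] by (simp add: indicator_def)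
  show "set_integrable lborel {0..} (\<lambda>s. exp (w - of_real s) * \<psi>0 (w - of_real s))"
    unfolding set_integrable_def
    by (rule integrable_dominated_convergence[OF fm Fm dom AE_I2[OF pw] AE_I2[OF le]])
  have lim: "(\<lambda>i. integral\<^sup>L lborel (?F i)) \<longlonglongrightarrow> integral\<^sup>L lborel ?f"
    by (rule integral_dominated_convergence[OF fm Fm dom AE_I2[OF pw] AE_I2[OF le]])
  have ratio: "(\<lambda>i. (Q i - 1) / h i) \<longlonglongrightarrow> 1"
  proof -
    have "((\<lambda>q::real. (q - 1) / ln q) \<longlongrightarrow> 1) (at_right 1)" by real_asymp
    from filterlim_compose[OF this sequence_at_right[OF Q]] show ?thesis by (simp add: h_def)
  qed
  have "(\<lambda>i. of_real ((Q i - 1) / h i) * integral\<^sup>L lborel (?F i)) \<longlonglongrightarrow> of_real 1 * integral\<^sup>L lborel ?f"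
    by (intro tendsto_mult tendsto_of_real ratio lim)
  moreover have "of_real ((Q i - 1) / h i) * integral\<^sup>L lborel (?F i) = S i" for i
  proof -
    have "complex_of_real ((Q i - 1) / h i) * of_real (h i / (Q i - 1)) = 1"
      using Q(1)[of i] h[of i] by (simp only: of_real_mult[symmetric]) simp
    then show ?thesis
      using suminf[of i] unfolding set_lebesgue_integral_def by (simp only: mult.assoc[symmetric] mult_1_left)
  qed
  ultimately show "S \<longlonglongrightarrow> (LINT s:{0..}|lborel. exp (w - of_real s) * \<psi>0 (w - of_real s))"
    unfolding set_lebesgue_integral_def by simp
qed

text \<open>A diagonal choice: for each n an index N n >= n is taken at which \<phi> at W n is
  within 1/(n+1) of l (W n). The parameters Q0 (N n) still tend to 1, so convergence along these
  pairs forces l (W n) to tend to l w.\<close>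

lemma cconv_continuous:
  assumes c: "cconv D \<phi> l"
  shows "continuous_on D l"
  unfolding continuous_on_sequentially
proof (intro allI ballI impI)
  fix W :: "nat \<Rightarrow> complex" and w assume w: "w \<in> D" and W: "(\<forall>n. W n \<in> D) \<and> W \<longlonglongrightarrow> w"
  define Q0 where "Q0 = (\<lambda>n::nat. 1 + inverse (real (Suc n)))"
  have Q0: "Q0 n > 1" for n by (simp add: Q0_def)
  have Q0lim: "Q0 \<longlonglongrightarrow> 1"
    using tendsto_add[OF tendsto_const[of 1] LIMSEQ_inverse_real_of_nat] by (simp add: Q0_def)
  have ex: "\<exists>N\<ge>n. dist (\<phi> (Q0 N) (W n)) (l (W n)) < inverse (real (Suc n))" for n
  proof -
    have "(\<lambda>i. \<phi> (Q0 i) (W n)) \<longlonglongrightarrow> l (W n)"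
      by (rule cconvD[OF c Q0 Q0lim tendsto_const]) (use W in blast)
    then have "eventually (\<lambda>i. dist (\<phi> (Q0 i) (W n)) (l (W n)) < inverse (real (Suc n))) sequentially"
      by (rule tendstoD) simp
    then have "eventually (\<lambda>i. i \<ge> n \<and> dist (\<phi> (Q0 i) (W n)) (l (W n)) < inverse (real (Suc n))) sequentially"
      using eventually_ge_at_top[of n] by eventually_elim simp
    then show ?thesis unfolding eventually_sequentially by blast
  qed
  have "\<exists>N. \<forall>n. n \<le> N n \<and> dist (\<phi> (Q0 (N n)) (W n)) (l (W n)) < inverse (real (Suc n))"
    by (rule choice) (use ex in blast)
  then obtain N where N: "\<And>n. N n \<ge> n" "\<And>n. dist (\<phi> (Q0 (N n)) (W n)) (l (W n)) < inverse (real (Suc n))"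
    by blast
  have "filterlim N at_top sequentially"
    by (rule filterlim_at_top_mono[OF filterlim_ident]) (use N(1) in auto)
  then have "(\<lambda>n. Q0 (N n)) \<longlonglongrightarrow> 1" by (rule filterlim_compose[OF Q0lim])
  then have 1: "(\<lambda>n. \<phi> (Q0 (N n)) (W n)) \<longlonglongrightarrow> l w"
    by (intro cconvD[OF c Q0]) (use W w in auto)
  have "(\<lambda>n. \<phi> (Q0 (N n)) (W n) - l (W n)) \<longlonglongrightarrow> 0"
    by (rule Lim_null_comparison[OF _ LIMSEQ_inverse_real_of_nat])
      (use N(2) in \<open>auto simp: dist_norm intro!: always_eventually less_imp_le\<close>)
  from tendsto_diff[OF 1 this] show "(l \<circ> W) \<longlonglongrightarrow> l w" by (simp add: o_def)
qed

section \<open>Limits of continued families in the logarithmic coordinate\<close>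

lemma analytic_uniform_limit:
  assumes D: "open D"
    and an: "\<And>K. compact K \<Longrightarrow> K \<subseteq> D \<Longrightarrow> \<forall>\<^sub>F q in at_right (1::real). \<forall>w\<in>K. \<phi> q analytic_on {w}"
    and lim: "\<And>K. compact K \<Longrightarrow> K \<subseteq> D \<Longrightarrow> uniform_limit K \<phi> l (at_right 1)"
  shows "l analytic_on D"
  unfolding analytic_on_def
proof
  fix w assume "w \<in> D"
  then obtain r where r: "r > 0" "cball w r \<subseteq> D" using D open_contains_cball by blast
  have "\<forall>\<^sub>F q in at_right 1. continuous_on (cball w r) (\<phi> q) \<and> \<phi> q holomorphic_on ball w r"
    using an[OF compact_cball r(2)]
  proof eventually_elim
    case (elim q)
    then have "\<phi> q analytic_on cball w r" using analytic_on_analytic_at by blast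
    then have "\<phi> q holomorphic_on cball w r" by (rule analytic_imp_holomorphic)
    then show ?case using holomorphic_on_imp_continuous_on holomorphic_on_subset ball_subset_cball by blast
  qed
  from holomorphic_uniform_limit[OF this lim[OF compact_cball r(2)]]
  have "l holomorphic_on ball w r" by simp
  then show "\<exists>\<epsilon>>0. l holomorphic_on ball w \<epsilon>" using r(1) by blast
qed

text \<open>exp is injective on balls of radius pi, so it maps punctured neighbourhoods of w into
  punctured neighbourhoods of exp w; limits and poles at exp w can then be read at w.\<close>

lemma filterlim_exp_at: "filterlim exp (at (exp w)) (at (w::complex))"
  unfolding filterlim_at
proof
  have "eventually (\<lambda>y. y \<in> ball w pi - {w}) (at w)" by (intro eventually_at_in_open) auto
  then show "eventually (\<lambda>y. exp y \<in> UNIV \<and> exp y \<noteq> exp w) (at w)"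
  proof eventually_elim
    case (elim y)
    then show ?case using inj_onD[OF inj_on_exp_pi[of w], of y w] by auto
  qed
  show "exp \<midarrow>w\<rightarrow> exp w" by (intro tendsto_intros)
qed

lemma exp_minus_mult_ln:
  fixes w :: complex
  assumes "q > 0"
  shows "exp (w - of_real (real n * ln q)) = exp w / of_real q ^ n"
proof -
  have "exp (complex_of_real (real n * ln q)) = of_real (exp (real n * ln q))" by (simp only: exp_of_real)
  also have "exp (real n * ln q) = q ^ n" using assms by (simp add: exp_of_nat_mult)
  finally show ?thesis unfolding exp_diff by simp
qed

lemma open_Dom: "open (Dom d a \<epsilon>)"
proof -
  have "Dom d a \<epsilon> = {w. Re w < ln a} \<inter> {w. d - \<epsilon> < Im w} \<inter> {w. Im w < d + \<epsilon>}"
    unfolding Dom_def by auto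
  then show ?thesis
    by (auto intro!: open_Int open_halfspace_Re_lt open_halfspace_Im_lt open_halfspace_Im_gt)
qed

lemma Dom_minus: "w \<in> Dom d a \<epsilon> \<Longrightarrow> s \<ge> 0 \<Longrightarrow> w - of_real s \<in> Dom d a \<epsilon>"
  unfolding Dom_def by auto

text \<open>
  A pole of one member of the family is a pole of all the others, which are uniformly close to it.
  Since \<^const>\<open>cont_val\<close> is \<open>0\<close> at poles, the limit would vanish there.
\<close>
lemma nonvanishing_limit_no_poles:
  assumes lim: "lim_on_compacts d a \<epsilon> G l" and mer: "\<forall>\<^sub>F q in at_right 1. merom0 (G q)"
    and nz: "\<And>w. w \<in> Dom d a \<epsilon> \<Longrightarrow> l w \<noteq> 0"
    and K: "compact K" "K \<subseteq> Dom d a \<epsilon>"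
  shows "\<forall>\<^sub>F q in at_right 1. \<forall>w\<in>K. exp w \<in> cont_dom (G q) \<and> cont_val (G q) analytic_on {exp w}"
proof -
  obtain \<delta> where \<delta>: "\<delta> > 0" "compact (\<Union>x\<in>K. cball x \<delta>)" "(\<Union>x\<in>K. cball x \<delta>) \<subseteq> Dom d a \<epsilon>"
    by (rule compact_enlarge[OF K(1) open_Dom K(2)])
  let ?K = "\<Union>x\<in>K. cball x \<delta>"
  have ev1: "\<forall>\<^sub>F q in at_right 1. \<forall>w\<in>?K. continues_to (G q) (exp w)"
    using lim \<delta>(2,3) unfolding lim_on_compacts_def merom_family_def by blast
  have ul: "uniform_limit ?K (\<lambda>q w. cont_val (G q) (exp w)) l (at_right 1)"
    using lim \<delta>(2,3) unfolding lim_on_compacts_def by blast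
  have ev2: "\<forall>\<^sub>F q in at_right 1. \<forall>w\<in>?K. dist (cont_val (G q) (exp w)) (l w) < 1"
    using uniform_limitD[OF ul, of 1] by simp
  obtain b where b: "b > 1" "\<And>q. 1 < q \<Longrightarrow> q < b \<Longrightarrow> merom0 (G q) \<and>
      (\<forall>w\<in>?K. continues_to (G q) (exp w)) \<and> (\<forall>w\<in>?K. dist (cont_val (G q) (exp w)) (l w) < 1)"
    using eventually_conj[OF mer eventually_conj[OF ev1 ev2]]
    unfolding eventually_at_right_field by blast
  have dom: "exp w \<in> cont_dom (G q)" if "1 < q" "q < b" "w \<in> ?K" for q w
  proof -
    have "continues_to (G q) (exp w)" using b(2)[OF that(1,2)] that(3) by blast
    then show ?thesis unfolding cont_dom_def by simp
  qed
  have nm: "cont_val (G q) nicely_meromorphic_on {exp w}" if "1 < q" "q < b" "w \<in> ?K" for q w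
    by (rule nicely_meromorphic_on_subset[OF cont_val_nicely_meromorphic])
      (use b(2)[OF that(1,2)] dom[OF that] in auto)
  have KK: "K \<subseteq> ?K" using \<delta>(1) by auto
  have nopole: "\<not> is_pole (cont_val (G q)) (exp w)" if q: "1 < q" "q < b" and w: "w \<in> K" for q w
  proof
    assume pole: "is_pole (cont_val (G q)) (exp w)"
    have wK: "w \<in> ?K" using w KK by blast
    have zero: "cont_val (G p) (exp w) = 0" if p: "1 < p" "p < b" for p
    proof (rule ccontr)
      assume ne: "cont_val (G p) (exp w) \<noteq> 0"
      then have "cont_val (G p) \<midarrow>exp w\<rightarrow> cont_val (G p) (exp w)"
        using nm[OF p wK] unfolding nicely_meromorphic_on_def by blast
      from tendsto_norm[OF filterlim_compose[OF this filterlim_exp_at]]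
      have 1: "\<forall>\<^sub>F y in at w. norm (cont_val (G p) (exp y)) < norm (cont_val (G p) (exp w)) + 1"
        by (rule order_tendstoD(2)) simp
      have "filterlim (\<lambda>y. cont_val (G q) (exp y)) at_infinity (at w)"
        using filterlim_compose[OF pole[unfolded is_pole_def] filterlim_exp_at] .
      then have inf: "\<forall>r>0. \<forall>\<^sub>F y in at w. r \<le> norm (cont_val (G q) (exp y))"
        unfolding filterlim_at_infinity[OF order_refl] .
      have "norm (cont_val (G p) (exp w)) + 3 > 0" by (simp add: add_nonneg_pos)
      with inf have 2: "\<forall>\<^sub>F y in at w. norm (cont_val (G p) (exp w)) + 3 \<le> norm (cont_val (G q) (exp y))"
        by blast
      have 3: "\<forall>\<^sub>F y in at w. y \<in> ball w \<delta>" using \<delta>(1) by (intro eventually_at_in_open') auto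
      have "\<forall>\<^sub>F y in at w. False"
        using 1 2 3
      proof eventually_elim
        case (elim y)
        have y: "y \<in> ?K" using elim(3) w by (intro UN_I[of w]) auto
        have "dist (cont_val (G p) (exp y)) (l y) < 1" "dist (cont_val (G q) (exp y)) (l y) < 1"
          using b(2)[OF p] b(2)[OF q] y by blast+
        then have "dist (cont_val (G q) (exp y)) (cont_val (G p) (exp y)) < 2"
          using dist_triangle2[of "cont_val (G q) (exp y)" "cont_val (G p) (exp y)" "l y"] by linarith
        moreover have "norm (cont_val (G q) (exp y)) \<le> norm (cont_val (G p) (exp y)) +
            dist (cont_val (G q) (exp y)) (cont_val (G p) (exp y))"
          unfolding dist_norm by (rule norm_triangle_sub)
        ultimately show False using elim(1,2) by linarith
      qed
      then show False by simp
    qed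
    have "((\<lambda>p. cont_val (G p) (exp w)) \<longlongrightarrow> l w) (at_right 1)"
      by (rule tendsto_uniform_limitI[OF ul wK])
    moreover have "\<forall>\<^sub>F p in at_right 1. cont_val (G p) (exp w) = 0"
      unfolding eventually_at_right_field using b(1) zero by blast
    ultimately have "((\<lambda>p. 0) \<longlongrightarrow> l w) (at_right (1::real))"
      by (rule Lim_transform_eventually)
    then have "l w = 0"
      using tendsto_unique[OF trivial_limit_at_right_real _ tendsto_const] by blast
    then show False using nz w K(2) by blast
  qed
  show ?thesis
    unfolding eventually_at_right_field
  proof (intro exI[of _ b] conjI allI impI ballI b(1))
    fix q w assume q: "1 < q" "q < b" and w: "w \<in> K"
    have wK: "w \<in> ?K" using w KK by blast
    show "exp w \<in> cont_dom (G q)" by (rule dom[OF q wK])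
    show "cont_val (G q) analytic_on {exp w}"
      by (rule nicely_meromorphic_on_imp_analytic_at[OF nm[OF q wK] _ nopole[OF q w]]) simp
  qed
qed

lemma nonvanishing_limit:
  assumes lim: "lim_on_compacts d a \<epsilon> G l" and mer: "\<forall>\<^sub>F q in at_right 1. merom0 (G q)"
    and nz: "\<And>w. w \<in> Dom d a \<epsilon> \<Longrightarrow> l w \<noteq> 0"
  shows "l analytic_on Dom d a \<epsilon>"
    and "cconv (Dom d a \<epsilon>) (\<lambda>q w. cont_val (G q) (exp w)) l"
    and "\<And>K. compact K \<Longrightarrow> K \<subseteq> Dom d a \<epsilon> \<Longrightarrow> \<forall>\<^sub>F q in at_right 1. \<forall>w\<in>K. exp w \<in> cont_dom (G q) \<and>
      cont_val (G q) analytic_on {exp w} \<and> cont_val (G q) (exp w) \<noteq> 0"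
proof -
  have np: "\<forall>\<^sub>F q in at_right 1. \<forall>w\<in>K. exp w \<in> cont_dom (G q) \<and> cont_val (G q) analytic_on {exp w}"
    if "compact K" "K \<subseteq> Dom d a \<epsilon>" for K
    by (rule nonvanishing_limit_no_poles[OF lim mer _ that]) (rule nz)
  have ul: "uniform_limit K (\<lambda>q w. cont_val (G q) (exp w)) l (at_right 1)"
    if "compact K" "K \<subseteq> Dom d a \<epsilon>" for K
    using lim that unfolding lim_on_compacts_def by blast
  show an: "l analytic_on Dom d a \<epsilon>"
  proof (rule analytic_uniform_limit[OF open_Dom _ ul])
    fix K assume K: "compact K" "K \<subseteq> Dom d a \<epsilon>"
    show "\<forall>\<^sub>F q in at_right 1. \<forall>w\<in>K. (\<lambda>w. cont_val (G q) (exp w)) analytic_on {w}"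
      using np[OF K]
    proof eventually_elim
      case (elim q)
      show ?case
      proof
        fix w assume "w \<in> K"
        then have "cont_val (G q) analytic_on exp ` {w}" using elim by simp
        have "(\<lambda>w::complex. exp w) analytic_on {w}" by (intro analytic_intros)
        from analytic_on_compose[OF this] \<open>cont_val (G q) analytic_on exp ` {w}\<close>
        show "(\<lambda>w. cont_val (G q) (exp w)) analytic_on {w}" by (simp add: o_def)
      qed
    qed
  qed
  have cont: "continuous_on (Dom d a \<epsilon>) l"
    by (rule holomorphic_on_imp_continuous_on[OF analytic_imp_holomorphic[OF an]])
  show "cconv (Dom d a \<epsilon>) (\<lambda>q w. cont_val (G q) (exp w)) l"
    by (rule uniform_limit_imp_cconv[OF open_Dom cont ul])
  fix K assume K: "compact K" "K \<subseteq> Dom d a \<epsilon>"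
  \<comment> \<open>A nowhere vanishing continuous limit is bounded below on the compact K, so
    functions closer to it than c have no zeros there.\<close>
  have "\<exists>c>0. \<forall>w\<in>K. c \<le> norm (l w)"
  proof (cases "K = {}")
    case False
    have "continuous_on K (\<lambda>w. norm (l w))"
      by (intro continuous_on_norm continuous_on_subset[OF cont K(2)])
    from continuous_attains_inf[OF K(1) False this] obtain w where
      "w \<in> K" "\<forall>y\<in>K. norm (l w) \<le> norm (l y)" by blast
    then show ?thesis using nz K(2) by (intro exI[of _ "norm (l w)"]) auto
  qed (auto intro: exI[of _ 1])
  then obtain c where c: "c > 0" "\<And>w. w \<in> K \<Longrightarrow> c \<le> norm (l w)" by blast
  show "\<forall>\<^sub>F q in at_right 1. \<forall>w\<in>K. exp w \<in> cont_dom (G q) \<and>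
      cont_val (G q) analytic_on {exp w} \<and> cont_val (G q) (exp w) \<noteq> 0"
    using np[OF K] uniform_limitD[OF ul[OF K] c(1)]
  proof eventually_elim
    case (elim q)
    show ?case
    proof (intro ballI conjI)
      fix w assume w: "w \<in> K"
      show "exp w \<in> cont_dom (G q)" "cont_val (G q) analytic_on {exp w}" using elim(1) w by auto
      have "dist (cont_val (G q) (exp w)) (l w) < c" using elim(2) w by blast
      then show "cont_val (G q) (exp w) \<noteq> 0" using c(2)[OF w] by (auto simp: dist_norm)
    qed
  qed
qed

lemma ray_star_scale:
  assumes "ray_star X" "c \<noteq> 0"
  shows "ray_star {x. c * x \<in> X}"
proof -
  have "open ((\<lambda>x. c * x) -` X)"
    using assms(1) unfolding ray_star_def by (intro open_vimage continuous_intros) auto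
  moreover have "c * (of_real t * x) \<in> X" if "c * x \<in> X" "t \<in> {0<..1}" for x t
  proof -
    have "of_real t * (c * x) \<in> X" using assms(1) that unfolding ray_star_def by blast
    then show ?thesis by (simp only: mult.left_commute)
  qed
  ultimately show ?thesis using assms(1) unfolding ray_star_def vimage_def by auto
qed

text \<open>In the logarithmic coordinate the point q z is w + ln q, so the shift disappears in the
  limit under continuous convergence. Near q = 1 both functions are analytic and G does not vanish
  at the points concerned, hence \<open>cont_val\<close> of the quotient is the quotient of the
  values.\<close>

lemma quotient_limit:
  fixes G H :: "real \<Rightarrow> complex \<Rightarrow> complex"
  assumes G: "lim_on_compacts d a \<epsilon> G l" "\<forall>\<^sub>F q in at_right 1. merom0 (G q)" "\<And>w. w \<in> Dom d a \<epsilon> \<Longrightarrow> l w \<noteq> 0"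
    and H: "lim_on_compacts d a \<epsilon> H k" "\<forall>\<^sub>F q in at_right 1. merom0 (H q)" "\<And>w. w \<in> Dom d a \<epsilon> \<Longrightarrow> k w \<noteq> 0"
  shows "cconv (Dom d a \<epsilon>) (\<lambda>q w. cont_val (\<lambda>x. H q x / (x * G q (of_real q * x))) (exp w))
    (\<lambda>w. k w / (exp w * l w))"
  unfolding cconv_def
proof (intro allI impI)
  fix Q :: "nat \<Rightarrow> real" and W w
  assume Q: "\<forall>i. Q i > 1" "Q \<longlonglongrightarrow> 1" and W: "W \<longlonglongrightarrow> w" and w: "w \<in> Dom d a \<epsilon>"
  obtain r where r: "r > 0" "cball w r \<subseteq> Dom d a \<epsilon>" using open_Dom w open_contains_cball by blast
  let ?R = "\<lambda>q x. H q x / (x * G q (of_real q * x))"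
  have Qr: "filterlim Q (at_right 1) sequentially" by (rule sequence_at_right) (use Q in auto)
  have W2: "(\<lambda>i. W i + of_real (ln (Q i))) \<longlonglongrightarrow> w"
  proof -
    have "(\<lambda>i. W i + of_real (ln (Q i))) \<longlonglongrightarrow> w + of_real (ln 1)"
      by (intro tendsto_add W tendsto_of_real tendsto_ln Q(2)) simp
    then show ?thesis by simp
  qed
  have evW: "\<forall>\<^sub>F i in sequentially. W i \<in> cball w r"
    by (rule eventually_mono[OF tendstoD[OF W r(1)]]) (simp add: dist_commute)
  have evW2: "\<forall>\<^sub>F i in sequentially. W i + of_real (ln (Q i)) \<in> cball w r"
    by (rule eventually_mono[OF tendstoD[OF W2 r(1)]]) (simp add: dist_commute)
  have seq: "\<forall>\<^sub>F i in sequentially. P (Q i)" if "\<forall>\<^sub>F q in at_right 1. P q" for P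
    using Qr that unfolding filterlim_iff by blast
  note K = compact_cball r(2)
  have GK: "\<forall>\<^sub>F q in at_right 1. \<forall>w\<in>cball w r. exp w \<in> cont_dom (G q) \<and>
      cont_val (G q) analytic_on {exp w} \<and> cont_val (G q) (exp w) \<noteq> 0"
    by (rule nonvanishing_limit(3)[OF G(1,2) _ K]) (rule G(3))
  have HK: "\<forall>\<^sub>F q in at_right 1. \<forall>w\<in>cball w r. exp w \<in> cont_dom (H q) \<and>
      cont_val (H q) analytic_on {exp w} \<and> cont_val (H q) (exp w) \<noteq> 0"
    by (rule nonvanishing_limit(3)[OF H(1,2) _ K]) (rule H(3))
  have Gc: "cconv (Dom d a \<epsilon>) (\<lambda>q w. cont_val (G q) (exp w)) l"
    by (rule nonvanishing_limit(2)[OF G(1,2)]) (rule G(3))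
  have Hc: "cconv (Dom d a \<epsilon>) (\<lambda>q w. cont_val (H q) (exp w)) k"
    by (rule nonvanishing_limit(2)[OF H(1,2)]) (rule H(3))
  have "\<forall>\<^sub>F i in sequentially. cont_val (H (Q i)) (exp (W i)) /
     (exp (W i) * cont_val (G (Q i)) (exp (W i + of_real (ln (Q i))))) = cont_val (?R (Q i)) (exp (W i))"
    using evW evW2 seq[OF G(2)] seq[OF H(2)] seq[OF GK] seq[OF HK]
  proof eventually_elim
    case (elim i)
    define q where "q = Q i"
    define z where "z = exp (W i)"
    have q: "q > 1" "complex_of_real q \<noteq> 0" using Q(1)[rule_format, of i] unfolding q_def by simp_all
    have qz: "of_real q * z = exp (W i + of_real (ln q))"
      using q unfolding z_def by (simp add: exp_add exp_of_real)
    have g: "of_real q * z \<in> cont_dom (G q)" "cont_val (G q) analytic_on {of_real q * z}"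
      "cont_val (G q) (of_real q * z) \<noteq> 0" and h: "z \<in> cont_dom (H q)" "cont_val (H q) analytic_on {z}"
    proof -
      show "of_real q * z \<in> cont_dom (G q)" unfolding qz unfolding q_def using elim(2,5) by blast
      show "cont_val (G q) analytic_on {of_real q * z}" unfolding qz unfolding q_def using elim(2,5) by blast
      show "cont_val (G q) (of_real q * z) \<noteq> 0" unfolding qz unfolding q_def using elim(2,5) by blast
      show "z \<in> cont_dom (H q)" unfolding z_def q_def using elim(1,6) by blast
      show "cont_val (H q) analytic_on {z}" unfolding z_def q_def using elim(1,6) by blast
    qed
    have mG: "merom0 (G q)" using elim(3) unfolding q_def .
    have mH: "merom0 (H q)" using elim(4) unfolding q_def .
    have z0: "z \<noteq> 0" by (simp add: z_def)
    let ?h = "\<lambda>x. cont_val (H q) x / (x * cont_val (G q) (of_real q * x))"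
    define X where "X = cont_dom (H q) \<inter> {x. of_real q * x \<in> cont_dom (G q)}"
    have X: "ray_star X" unfolding X_def
      by (intro ray_star_Int ray_star_scale ray_star_cont_dom mG mH q(2))
    have sc: "(\<lambda>x. of_real q * x) analytic_on X" by (intro analytic_intros)
    have Hm: "cont_val (H q) meromorphic_on X"
      using nicely_meromorphic_on_subset[OF cont_val_nicely_meromorphic[OF mH], of X]
      unfolding X_def nicely_meromorphic_on_def by blast
    have Gm: "cont_val (G q) meromorphic_on cont_dom (G q)"
      using cont_val_nicely_meromorphic[OF mG] unfolding nicely_meromorphic_on_def by blast
    have Gm': "(\<lambda>x. cont_val (G q) (of_real q * x)) meromorphic_on X"
      by (rule meromorphic_on_compose[OF Gm sc]) (auto simp: X_def)
    have hm: "?h meromorphic_on X"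
      by (intro meromorphic_on_divide meromorphic_on_mult meromorphic_on_id Hm Gm')
    have hn: "near0 (\<lambda>x. ?h x = ?R q x)"
      by (rule near0_mono[OF near0_conj[OF near0_cont_val[OF mH] near0_scale[OF q(2) near0_cont_val[OF mG]]]]) simp
    have Rm: "merom0 (?R q)"
      by (intro merom0_divide merom0_mult merom0_id mH merom0_scale[OF mG q(2)])
    have zX: "z \<in> X" unfolding X_def using g h by simp
    have "(cont_val (G q) \<circ> (\<lambda>x. of_real q * x)) analytic_on {z}"
      by (rule analytic_on_compose) (use g in \<open>auto intro!: analytic_intros\<close>)
    then have "?h analytic_on {z}"
      unfolding o_def by (intro analytic_on_divide analytic_on_mult analytic_on_ident h) (use z0 g in auto)
    from cont_val_eq_analytic(1)[OF X hm hn Rm zX this]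
    show ?case unfolding q_def[symmetric] z_def[symmetric] qz[symmetric] by simp
  qed
  moreover have "(\<lambda>i. cont_val (H (Q i)) (exp (W i)) /
     (exp (W i) * cont_val (G (Q i)) (exp (W i + of_real (ln (Q i)))))) \<longlonglongrightarrow> k w / (exp w * l w)"
    using Q(1) by (intro tendsto_divide tendsto_mult tendsto_exp W
        cconvD[OF Hc _ Q(2) W w] cconvD[OF Gc _ Q(2) W2 w])
      (use G(3)[OF w] in auto)
  ultimately show "(\<lambda>i. cont_val (?R (Q i)) (exp (W i))) \<longlonglongrightarrow> k w / (exp w * l w)"
    by (rule Lim_transform_eventually[rotated])
qed

text \<open>\<open>classB\<close> bounds the values at z / q^n for n > N0 only. For n <= N0 the
  points w - n ln q stay within \<delta> of K once N0 ln q < \<delta>, and there uniform convergence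
  to l gives the bound R + 1.\<close>

lemma classB_bound:
  assumes B: "classB d a \<epsilon> G" and c: "cconv (Dom d a \<epsilon>) (\<lambda>q w. cont_val (G q) (exp w)) l"
    and K: "compact K" "K \<subseteq> Dom d a \<epsilon>"
  shows "\<exists>M. \<forall>\<^sub>F q in at_right 1. \<forall>w\<in>K. \<forall>n. norm (cont_val (G q) (exp w / of_real q ^ n)) \<le> M"
proof -
  obtain \<delta> where \<delta>: "\<delta> > 0" "compact (\<Union>x\<in>K. cball x \<delta>)" "(\<Union>x\<in>K. cball x \<delta>) \<subseteq> Dom d a \<epsilon>"
    by (rule compact_enlarge[OF K(1) open_Dom K(2)])
  let ?K = "\<Union>x\<in>K. cball x \<delta>"
  have cont: "continuous_on (Dom d a \<epsilon>) l" by (rule cconv_continuous[OF c])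
  have ul: "uniform_limit ?K (\<lambda>q w. cont_val (G q) (exp w)) l (at_right 1)"
    by (rule cconv_imp_uniform_limit[OF c cont \<delta>(2,3)])
  have "bounded (l ` ?K)"
    by (intro compact_imp_bounded compact_continuous_image continuous_on_subset[OF cont] \<delta>)
  then obtain R where R: "\<And>w. w \<in> ?K \<Longrightarrow> norm (l w) \<le> R" unfolding bounded_iff by blast
  obtain q0 N0 M0 where M0: "q0 > (1::real)"
    "\<And>q N w. q \<in> {1<..<q0} \<Longrightarrow> N > N0 \<Longrightarrow> w \<in> K \<Longrightarrow>
      norm (cont_val (G q) (of_real (q powi (- int N)) * exp w)) < M0"
  proof -
    have "\<exists>q0>1. \<exists>N0\<ge>1. \<exists>M0>0. \<forall>q\<in>{1<..<q0}. \<forall>N>N0. \<forall>w\<in>K.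
        norm (cont_val (G q) (of_real (q powi (- int N)) * exp w)) < M0"
      using B[unfolded classB_def, THEN conjunct2, rule_format, OF conjI[OF K]] .
    then show thesis using that by (elim exE conjE) blast
  qed
  have ev1: "\<forall>\<^sub>F q in at_right 1. q \<in> {1<..<q0}" using M0(1) by (rule eventually_at_right_real)
  have ev2: "\<forall>\<^sub>F q in at_right 1. \<forall>w\<in>?K. dist (cont_val (G q) (exp w)) (l w) < 1"
    using uniform_limitD[OF ul, of 1] by simp
  have ev3: "\<forall>\<^sub>F q in at_right 1. real N0 * ln q < \<delta>"
  proof -
    have "((\<lambda>q. real N0 * ln q) \<longlongrightarrow> real N0 * ln 1) (at_right (1::real))"
      by (intro tendsto_intros) auto
    then show ?thesis by (rule order_tendstoD(2)) (use \<delta>(1) in simp)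
  qed
  have "\<forall>\<^sub>F q in at_right 1. \<forall>w\<in>K. \<forall>n. norm (cont_val (G q) (exp w / of_real q ^ n)) \<le> max M0 (R + 1)"
    using ev1 ev2 ev3
  proof eventually_elim
    case (elim q)
    have q: "q > 1" using elim(1) by simp
    show ?case
    proof (intro ballI allI)
      fix w n assume w: "w \<in> K"
      show "norm (cont_val (G q) (exp w / of_real q ^ n)) \<le> max M0 (R + 1)"
      proof (cases "n > N0")
        case True
        have "of_real (q powi (- int n)) * exp w = exp w / of_real q ^ n"
          unfolding power_int_minus power_int_of_nat by (simp add: divide_inverse)
        then show ?thesis using M0(2)[OF elim(1) True w] by simp
      next
        case False
        let ?y = "w - of_real (real n * ln q)"
        have "real n * ln q \<le> real N0 * ln q" using False q by (intro mult_right_mono) auto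
        moreover have "0 \<le> real n * ln q" using q by simp
        ultimately have "\<bar>real n * ln q\<bar> \<le> \<delta>" using elim(3) by linarith
        then have "dist w ?y \<le> \<delta>" unfolding dist_norm by (simp only: diff_diff_eq2 add_diff_cancel_left' norm_of_real)
        then have y: "?y \<in> ?K" using w by (intro UN_I[of w]) auto
        have "dist (cont_val (G q) (exp ?y)) (l ?y) < 1" using elim(2) y by blast
        moreover have "norm (cont_val (G q) (exp ?y)) \<le> norm (l ?y) + dist (cont_val (G q) (exp ?y)) (l ?y)"
          unfolding dist_norm by (rule norm_triangle_sub)
        ultimately have "norm (cont_val (G q) (exp ?y)) \<le> R + 1" using R[OF y] by linarith
        moreover have "q > 0" using q by simp
        ultimately show ?thesis by (simp only: exp_minus_mult_ln le_max_iff_disj simp_thms)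
      qed
    qed
  qed
  then show ?thesis by blast
qed

section \<open>The limit \<open>q \<rightarrow> 1\<close>\<close>

lemma cconv_mult:
  assumes "cconv D \<phi> l" "cconv D \<psi> k"
  shows "cconv D (\<lambda>q w. \<phi> q w * \<psi> q w) (\<lambda>w. l w * k w)"
  unfolding cconv_def
proof (intro allI impI)
  fix Q :: "nat \<Rightarrow> real" and W w
  assume *: "\<forall>i. 1 < Q i" "Q \<longlonglongrightarrow> 1" "W \<longlonglongrightarrow> w" "w \<in> D"
  show "(\<lambda>i. \<phi> (Q i) (W i) * \<psi> (Q i) (W i)) \<longlonglongrightarrow> l w * k w"
    by (intro tendsto_mult cconvD[OF assms(1) _ *(2-4)] cconvD[OF assms(2) _ *(2-4)] *(1)[rule_format])
qed

lemma eventually_all_less: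
  assumes "\<And>j. j < m \<Longrightarrow> eventually (P j) F"
  shows "eventually (\<lambda>q. \<forall>j<(m::nat). P j q) F"
proof -
  have "eventually (\<lambda>q. \<forall>j\<in>{..<m}. P j q) F"
    by (rule eventually_ball_finite) (use assms in auto)
  then show ?thesis by (rule eventually_mono) simp
qed

lemma open_exp_image:
  fixes S :: "complex set"
  assumes "open S" shows "open (exp ` S)"
proof (rule open_mapping_thm[of exp UNIV])
  show "\<not> (exp :: complex \<Rightarrow> complex) constant_on UNIV"
  proof
    assume "(exp :: complex \<Rightarrow> complex) constant_on UNIV"
    then obtain c where "\<And>x::complex. exp x = c" unfolding constant_on_def by blast
    then have "exp (0::complex) = exp (of_real (ln 2))" by metis
    then show False unfolding exp_of_real by simp
  qed
  show "(exp :: complex \<Rightarrow> complex) holomorphic_on UNIV" by (rule holomorphic_on_exp)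
qed (use assms in auto)

lemma Utilde_less:
  "j < k \<Longrightarrow> Utilde ut j k w = ut j w * (LINT s:{0..}|lborel. Utilde ut (Suc j) k (w - of_real s) / ut j (w - of_real s))"
  by (subst Utilde.simps) simp

lemma Utilde_eq: "Utilde ut k k = ut k"
  by (subst Utilde.simps) simp

lemma Utilde_greater: "k < j \<Longrightarrow> Utilde ut j k w = 0"
  by (subst Utilde.simps) simp

lemma (in fixed_q) lower_zero: "near0 (\<lambda>x. \<forall>i<m. \<forall>j<i. U x $$ (i,j) = 0)"
proof (rule U_structure[OF U L])
  fix F :: "nat \<Rightarrow> nat \<Rightarrow> complex fls"
  assume "near0 (\<lambda>x. (\<forall>j<m. U x $$ (j,j) = eval_fls (F j j) x * L x $$ (j,j)) \<and> (\<forall>i<m. \<forall>j<i. U x $$ (i,j) = 0))"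
  then show ?thesis by (rule near0_mono) blast
qed (rule sorted)

locale q_family =
  fixes m :: nat and f :: "real \<Rightarrow> nat \<Rightarrow> complex fls" and lam :: complex and d a \<epsilon> :: real
    and Lam U :: "real \<Rightarrow> complex \<Rightarrow> complex mat" and ut :: "nat \<Rightarrow> complex \<Rightarrow> complex"
  assumes nonzero: "\<forall>q>1. \<forall>j<m. 1 + fls_const (of_real (q - 1)) * f q j \<noteq> 0"
    and H2: "hyp_H2 m f"
    and a: "a > 0"
    and Lam: "\<forall>q>1. is_Lambda m f q (Lam q)"
    and U: "\<forall>\<^sub>F q in at_right 1. is_U m f q lam (Lam q) (U q)"
    and H4: "\<forall>j<m. lim_on_compacts d a \<epsilon> (\<lambda>q z. U q z $$ (j,j)) (ut j) \<and>
                    Aring (d - \<epsilon>) (d + \<epsilon>) (ut j) \<and> (\<forall>w\<in>Dom d a \<epsilon>. ut j w \<noteq> 0)"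
    and H5: "\<forall>j. Suc j < m \<longrightarrow>
               classB d a \<epsilon> (\<lambda>q z. U q z $$ (Suc j, Suc j) / (z * U q (of_real q * z) $$ (j,j)))"
begin

abbreviation "D \<equiv> Dom d a \<epsilon>"
abbreviation "uh q j k w \<equiv> cont_val (\<lambda>x. U q x $$ (j,k)) (exp w)"
abbreviation "om q j w \<equiv> cont_val (\<lambda>x. U q x $$ (Suc j, Suc j) / (x * U q (of_real q * x) $$ (j,j))) (exp w)"
abbreviation "vh q j k w \<equiv> cont_val (\<lambda>x. U q x $$ (j,k) / U q x $$ (j,j)) (exp w)"

abbreviation "admissible q \<equiv> q > 1 \<and> is_U m f q lam (Lam q) (U q) \<and>
    (\<forall>j<m. \<forall>k<m. j < k \<longrightarrow> kappa f q j \<le> kappa f q k) \<and>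
    (\<forall>j<m. \<forall>k<m. j \<noteq> k \<longrightarrow> kappa f q j = kappa f q k \<longrightarrow> (\<forall>n::int. tau f q j \<noteq> of_real q powi n * tau f q k))"

text \<open>What is needed above a compact set K: a domain for the results at fixed q that contains
  exp K, and regular diagonal entries on exp K. M is a parameter so that one value can serve all q
  near 1.\<close>

abbreviation "regular q K M \<equiv> \<exists>W. fixed_q m f q lam (Lam q) (U q) W M \<and>
  (\<forall>w\<in>K. exp w \<in> W) \<and> (\<forall>j<m. \<forall>w\<in>K. cont_val (\<lambda>x. U q x $$ (j,j)) analytic_on {exp w})"

lemma eventually_fixed:
  "\<forall>\<^sub>F q in at_right 1. admissible q"
  by (intro eventually_conj U eventually_at_right_less)
    (use H2 in \<open>simp_all add: hyp_H2_def\<close>)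

lemma fixed_qI:
  assumes "admissible q"
    and "open W" "0 \<notin> W" "\<And>x. x \<in> W \<Longrightarrow> x / of_real q \<in> W"
    and "\<And>j. j < m \<Longrightarrow> W \<subseteq> cont_dom (\<lambda>x. U q x $$ (j,j))"
    and "\<And>j. Suc j < m \<Longrightarrow> W \<subseteq> cont_dom (\<lambda>x. U q x $$ (Suc j, Suc j) / (x * U q (of_real q * x) $$ (j,j)))"
    and "\<And>j x. Suc j < m \<Longrightarrow> x \<in> W \<Longrightarrow>
      norm (cont_val (\<lambda>x. U q x $$ (Suc j, Suc j) / (x * U q (of_real q * x) $$ (j,j))) x) \<le> M"
  shows "fixed_q m f q lam (Lam q) (U q) W M"
proof
  show "q > 1" using assms(1) by blast
  then show "is_Lambda m f q (Lam q)" "\<And>j. j < m \<Longrightarrow> 1 + fls_const (of_real (q - 1)) * f q j \<noteq> 0"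
    using Lam nonzero by blast+
  show "is_U m f q lam (Lam q) (U q)" using assms(1) by blast
  show "kappa f q j \<le> kappa f q k" if "j < k" "k < m" for j k
    using assms(1) that less_trans by blast
  show "tau f q j \<noteq> of_real q powi n * tau f q k"
    if "j < m" "k < m" "j \<noteq> k" "kappa f q j = kappa f q k" for j k and n :: int
    using assms(1) that by blast
qed (fact assms)+

lemma eventually_merom0:
  "j < m \<Longrightarrow> \<forall>\<^sub>F q in at_right 1. merom0 (\<lambda>x. U q x $$ (j,j))"
  using eventually_fixed
proof eventually_elim
  case (elim q)
  \<comment> \<open>Only the germ at 0 matters here, so the empty W with bound 0 will do.\<close>
  have "fixed_q m f q lam (Lam q) (U q) {} 0" by (rule fixed_qI[OF elim(2)]) auto
  then show ?case using fixed_q.u_merom0 elim(1) by blast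
qed

lemma diagonal_limit:
  assumes "j < m"
  shows "ut j analytic_on D" "cconv D (\<lambda>q w. uh q j j w) (ut j)"
    "\<And>K. compact K \<Longrightarrow> K \<subseteq> D \<Longrightarrow> \<forall>\<^sub>F q in at_right 1. \<forall>w\<in>K. exp w \<in> cont_dom (\<lambda>x. U q x $$ (j,j)) \<and>
      cont_val (\<lambda>x. U q x $$ (j,j)) analytic_on {exp w} \<and> uh q j j w \<noteq> 0"
proof -
  have l: "lim_on_compacts d a \<epsilon> (\<lambda>q z. U q z $$ (j,j)) (ut j)" and nz: "\<And>w. w \<in> D \<Longrightarrow> ut j w \<noteq> 0"
    using H4 assms by blast+
  note nl = nonvanishing_limit[OF l eventually_merom0[OF assms]]
  show "ut j analytic_on D" by (rule nl(1)) (rule nz)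
  show "cconv D (\<lambda>q w. uh q j j w) (ut j)" by (rule nl(2)) (rule nz)
  show "\<forall>\<^sub>F q in at_right 1. \<forall>w\<in>K. exp w \<in> cont_dom (\<lambda>x. U q x $$ (j,j)) \<and>
      cont_val (\<lambda>x. U q x $$ (j,j)) analytic_on {exp w} \<and> uh q j j w \<noteq> 0" if "compact K" "K \<subseteq> D" for K
    by (rule nl(3)[OF _ that]) (rule nz)
qed

lemma om_limit:
  assumes "Suc j < m"
  shows "cconv D (\<lambda>q w. om q j w) (\<lambda>w. ut (Suc j) w / (exp w * ut j w))"
  by (rule quotient_limit) (use H4 eventually_merom0 assms Suc_lessD in blast)+

text \<open>For an open neighbourhood S of K inside D, W consists of all exp w / q^n with w in S. It
  is open because exp is an open map, it is stable under division by q, and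
  \<open>classB_bound\<close> on the closed neighbourhood gives the bound on all of W at
  once.\<close>

lemma fixed_q_eventually:
  assumes K: "compact K" "K \<subseteq> D"
  shows "\<exists>M\<ge>0. \<forall>\<^sub>F q in at_right 1. regular q K M"
proof -
  obtain \<delta> where \<delta>: "\<delta> > 0" "compact (\<Union>x\<in>K. cball x \<delta>)" "(\<Union>x\<in>K. cball x \<delta>) \<subseteq> D"
    by (rule compact_enlarge[OF K(1) open_Dom K(2)])
  let ?K = "\<Union>x\<in>K. cball x \<delta>"
  let ?g = "\<lambda>q j x. U q x $$ (Suc j, Suc j) / (x * U q (of_real q * x) $$ (j,j))"
  have "\<forall>j. \<exists>M. Suc j < m \<longrightarrow> (\<forall>\<^sub>F q in at_right 1. \<forall>w\<in>?K. \<forall>n.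
      norm (cont_val (?g q j) (exp w / of_real q ^ n)) \<le> M)"
  proof
    fix j
    show "\<exists>M. Suc j < m \<longrightarrow> (\<forall>\<^sub>F q in at_right 1. \<forall>w\<in>?K. \<forall>n. norm (cont_val (?g q j) (exp w / of_real q ^ n)) \<le> M)"
    proof (cases "Suc j < m")
      case True
      have "classB d a \<epsilon> (\<lambda>q. ?g q j)" using H5 True by blast
      from classB_bound[OF this om_limit[OF True] \<delta>(2,3)] show ?thesis by blast
    qed simp
  qed
  from choice[OF this] obtain Mj where Mj: "\<And>j. Suc j < m \<Longrightarrow>
    \<forall>\<^sub>F q in at_right 1. \<forall>w\<in>?K. \<forall>n. norm (cont_val (?g q j) (exp w / of_real q ^ n)) \<le> Mj j" by blast
  \<comment> \<open>One constant for all j; the absolute values make the sum dominate each of its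
    terms.\<close>
  define M where "M = (\<Sum>j<m. \<bar>Mj j\<bar>)"
  have MM: "Mj j \<le> M" if "j < m" for j
  proof -
    have "\<bar>Mj j\<bar> \<le> M" unfolding M_def by (rule member_le_sum) (use that in auto)
    then show ?thesis by linarith
  qed
  have ev1: "\<forall>\<^sub>F q in at_right 1. \<forall>j<m - 1. \<forall>w\<in>?K. \<forall>n. norm (cont_val (?g q j) (exp w / of_real q ^ n)) \<le> Mj j"
    by (rule eventually_all_less) (rule Mj, simp)
  have ev2: "\<forall>\<^sub>F q in at_right 1. \<forall>j<m. \<forall>w\<in>?K. exp w \<in> cont_dom (\<lambda>x. U q x $$ (j,j)) \<and>
      cont_val (\<lambda>x. U q x $$ (j,j)) analytic_on {exp w} \<and> uh q j j w \<noteq> 0"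
    by (rule eventually_all_less) (rule diagonal_limit(3)[OF _ \<delta>(2,3)])
  have ev3: "\<forall>\<^sub>F q in at_right 1. \<forall>j<m - 1. \<forall>w\<in>?K. continues_to (?g q j) (exp w)"
  proof (rule eventually_all_less)
    fix j assume "j < m - 1"
    then have "classB d a \<epsilon> (\<lambda>q. ?g q j)" using H5 by simp
    then show "\<forall>\<^sub>F q in at_right 1. \<forall>w\<in>?K. continues_to (?g q j) (exp w)"
      using \<delta>(2,3) unfolding classB_def merom_family_def by blast
  qed
  have "\<forall>\<^sub>F q in at_right 1. regular q K M"
    using eventually_fixed ev1 ev2 ev3
  proof eventually_elim
    case (elim q)
    have q: "q > 1" using elim(1) by blast
    define S where "S = (\<Union>x\<in>K. ball x \<delta>)"
    have SK: "S \<subseteq> ?K" unfolding S_def using ball_subset_cball by blast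
    \<comment> \<open>Written with preimages under multiplication by q^n, so that openness is
      immediate.\<close>
    define W where "W = (\<Union>n. (\<lambda>x. x * of_real q ^ n) -` (exp ` S))"
    have S: "open S" unfolding S_def by (intro open_UN ballI open_ball)
    have Wrep: "\<exists>w\<in>?K. \<exists>n. x = exp w / of_real q ^ n" if "x \<in> W" for x
    proof -
      from that obtain n w where w: "w \<in> S" "x * of_real q ^ n = exp w" unfolding W_def by blast
      have "x = exp w / of_real q ^ n" unfolding w(2)[symmetric] using q by simp
      then show ?thesis using SK w(1) by blast
    qed
    have empty: "fixed_q m f q lam (Lam q) (U q) {} 0" by (rule fixed_qI[OF elim(1)]) auto
    note mg = fixed_q.g_merom0[OF empty] and mu = fixed_q.u_merom0[OF empty]
    have q1: "q \<ge> 1" using q by simp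
    have "fixed_q m f q lam (Lam q) (U q) W M"
    proof (rule fixed_qI[OF elim(1)])
      show "open W" unfolding W_def
        by (intro open_UN ballI open_vimage open_exp_image S continuous_intros)
      show "0 \<notin> W" unfolding W_def by auto
      show "x / of_real q \<in> W" if "x \<in> W" for x
      proof -
        from that obtain n where "x * of_real q ^ n \<in> exp ` S" unfolding W_def by blast
        moreover have "x / of_real q * of_real q ^ Suc n = x * of_real q ^ n" using q by simp
        ultimately show ?thesis unfolding W_def by (intro UN_I[of "Suc n"]) auto
      qed
      show "W \<subseteq> cont_dom (\<lambda>x. U q x $$ (j,j))" if j: "j < m" for j
      proof
        fix x assume "x \<in> W"
        from Wrep[OF this] obtain w n where w: "w \<in> ?K" "x = exp w / of_real q ^ n" by blast
        have "exp w \<in> cont_dom (\<lambda>x. U q x $$ (j,j))" using elim(3) j w(1) by blast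
        then show "x \<in> cont_dom (\<lambda>x. U q x $$ (j,j))"
          unfolding w(2) by (rule ray_star_divide[OF ray_star_cont_dom[OF mu[OF j]] _ q1])
      qed
      show "W \<subseteq> cont_dom (?g q j)" if j: "Suc j < m" for j
      proof
        fix x assume "x \<in> W"
        from Wrep[OF this] obtain w n where w: "w \<in> ?K" "x = exp w / of_real q ^ n" by blast
        have "j < m - 1" using j by simp
        then have "continues_to (?g q j) (exp w)" using elim(4) w(1) by blast
        then have "exp w \<in> cont_dom (?g q j)" unfolding cont_dom_def by simp
        then show "x \<in> cont_dom (?g q j)"
          unfolding w(2) by (rule ray_star_divide[OF ray_star_cont_dom[OF mg[OF j]] _ q1])
      qed
      show "norm (cont_val (?g q j) x) \<le> M" if j: "Suc j < m" and x: "x \<in> W" for j x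
      proof -
        from Wrep[OF x] obtain w n where w: "w \<in> ?K" "x = exp w / of_real q ^ n" by blast
        have "j < m - 1" using j by simp
        then have "norm (cont_val (?g q j) (exp w / of_real q ^ n)) \<le> Mj j" using elim(2) w(1) by blast
        also have "\<dots> \<le> M" using MM j by simp
        finally show ?thesis unfolding w(2) .
      qed
    qed
    moreover have "exp w \<in> W" if "w \<in> K" for w
    proof -
      have "w \<in> S" unfolding S_def by (rule UN_I[OF that]) (use \<delta>(1) in simp)
      then show ?thesis unfolding W_def by (intro UN_I[of 0]) auto
    qed
    moreover have "cont_val (\<lambda>x. U q x $$ (j,j)) analytic_on {exp w}" if "j < m" "w \<in> K" for j w
    proof -
      have "w \<in> ?K" by (rule UN_I[OF that(2)]) (use \<delta>(1) in simp)
      then show ?thesis using elim(3) that(1) by blast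
    qed
    ultimately show ?case by blast
  qed
  moreover have "M \<ge> 0" unfolding M_def by (intro sum_nonneg) simp
  ultimately show ?thesis by blast
qed

lemma ut_nonzero: "j < m \<Longrightarrow> w \<in> D \<Longrightarrow> ut j w \<noteq> 0"
  using H4 by blast

text \<open>The series for v_jk is the Riemann sum of \<open>riemann_sum_limit\<close> with \<psi>
  the product of the quotient of (H5) and v_(j+1)k. It is bounded by M (M a)^(k-j-1) uniformly in q,
  because |x| < a above D.\<close>

lemma quotient_limit_step:
  assumes jk: "j < k" "k < m"
    and IH: "cconv D (\<lambda>q w. vh q (Suc j) k w) (\<lambda>w. Utilde ut (Suc j) k w / ut (Suc j) w)"
    and Q: "\<And>i::nat. Q i > 1" "Q \<longlonglongrightarrow> 1" and W: "W \<longlonglongrightarrow> w" and w: "w \<in> D"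
  shows "set_integrable lborel {0..} (\<lambda>s. Utilde ut (Suc j) k (w - of_real s) / ut j (w - of_real s))"
    and "(\<lambda>i. vh (Q i) j k (W i)) \<longlonglongrightarrow> Utilde ut j k w / ut j w"
proof -
  have lt: "j < m" "Suc j < m" "Suc j \<le> k" using jk by auto
  obtain r where r: "r > 0" "cball w r \<subseteq> D" using open_Dom w open_contains_cball by blast
  obtain M where M: "M \<ge> 0" "\<forall>\<^sub>F q in at_right 1. regular q (cball w r) M"
    using fixed_q_eventually[OF compact_cball r(2)] by blast
  have "\<forall>\<^sub>F i in sequentially. \<exists>X. fixed_q m f (Q i) lam (Lam (Q i)) (U (Q i)) X M \<and> (\<forall>w\<in>cball w r. exp w \<in> X)"
    using M(2) sequence_at_right[OF Q] unfolding filterlim_iff by (auto elim!: eventually_mono allE)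
  moreover have "\<forall>\<^sub>F i in sequentially. W i \<in> cball w r"
    by (rule eventually_mono[OF tendstoD[OF W r(1)]]) (simp add: dist_commute)
  ultimately have "\<forall>\<^sub>F i in sequentially. W i \<in> cball w r \<and>
    (\<exists>X. fixed_q m f (Q i) lam (Lam (Q i)) (U (Q i)) X M \<and> exp (W i) \<in> X)"
    by eventually_elim blast
  then obtain N where N: "\<And>i. i \<ge> N \<Longrightarrow> W i \<in> cball w r \<and>
    (\<exists>X. fixed_q m f (Q i) lam (Lam (Q i)) (U (Q i)) X M \<and> exp (W i) \<in> X)"
    unfolding eventually_sequentially by blast
  \<comment> \<open>The first N indices are dropped, because \<open>riemann_sum_limit\<close> asks
    for its bounds at every index.\<close>
  define Q' where "Q' = (\<lambda>i. Q (i + N))"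
  define W' where "W' = (\<lambda>i. W (i + N))"
  have Q': "\<And>i. Q' i > 1" "Q' \<longlonglongrightarrow> 1" and W': "W' \<longlonglongrightarrow> w"
    unfolding Q'_def W'_def using Q(1) LIMSEQ_ignore_initial_segment[OF Q(2)] LIMSEQ_ignore_initial_segment[OF W] by auto
  define \<psi> where "\<psi> = (\<lambda>q w. om q j w * vh q (Suc j) k w)"
  \<comment> \<open>The denominator exp w comes from the factor z in the quotient of (H5); it
    cancels the factor exp (w - s) of the integrand.\<close>
  define \<psi>0 where "\<psi>0 = (\<lambda>w. ut (Suc j) w / (exp w * ut j w) * (Utilde ut (Suc j) k w / ut (Suc j) w))"
  have c: "cconv D \<psi> \<psi>0" unfolding \<psi>_def \<psi>0_def by (rule cconv_mult[OF om_limit[OF lt(2)] IH])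
  have fq: "norm (\<psi> (Q' i) (W' i - of_real (real (Suc n) * ln (Q' i)))) \<le> M * (M * a) ^ (k - Suc j)"
    "(\<lambda>n. of_real (Q' i - 1) * exp (W' i - of_real (real (Suc n) * ln (Q' i))) *
      \<psi> (Q' i) (W' i - of_real (real (Suc n) * ln (Q' i)))) sums vh (Q' i) j k (W' i)" for i n
  proof -
    have Wi: "W' i \<in> cball w r" and "\<exists>X. fixed_q m f (Q' i) lam (Lam (Q' i)) (U (Q' i)) X M \<and> exp (W' i) \<in> X"
      using N[of "i + N"] unfolding Q'_def W'_def by auto
    then obtain X where X: "fixed_q m f (Q' i) lam (Lam (Q' i)) (U (Q' i)) X M" "exp (W' i) \<in> X" by blast
    interpret fixed_q m f "Q' i" lam "Lam (Q' i)" "U (Q' i)" X M by (rule X(1))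
    have q0: "Q' i > 0" using Q'(1)[of i] by simp
    have e: "exp (W' i - of_real (real (Suc n) * ln (Q' i))) = exp (W' i) / of_real (Q' i) ^ Suc n" for n
      by (rule exp_minus_mult_ln[OF q0])
    let ?x = "exp (W' i) / of_real (Q' i) ^ Suc n"
    have x: "?x \<in> X" by (rule W_power[OF X(2)])
    have "norm ?x \<le> a"
    proof -
      have "Re (W' i) < ln a" using Wi r(2) unfolding Dom_def by blast
      then have "exp (Re (W' i)) \<le> a" using a by (metis exp_le_cancel_iff exp_ln less_imp_le)
      moreover have "norm ?x \<le> norm (exp (W' i))"
      proof -
        have "1 \<le> Q' i ^ Suc n" by (rule one_le_power) (use Q'(1)[of i] in simp)
        then have "norm (exp (W' i)) / Q' i ^ Suc n \<le> norm (exp (W' i)) / 1"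
          by (intro divide_left_mono) auto
        moreover have "norm ?x = norm (exp (W' i)) / Q' i ^ Suc n"
          unfolding norm_divide norm_power norm_of_real using q0 by simp
        ultimately show ?thesis by simp
      qed
      ultimately show ?thesis by (simp only: norm_exp_eq_Re)
    qed
    then have "(M * norm ?x) ^ (k - Suc j) \<le> (M * a) ^ (k - Suc j)"
      using M(1) by (intro power_mono mult_left_mono mult_nonneg_nonneg) auto
    with v_bound[OF lt(3) jk(2) x]
    have "norm (cont_val (\<lambda>x. U (Q' i) x $$ (Suc j,k) / U (Q' i) x $$ (Suc j, Suc j)) ?x) \<le> (M * a) ^ (k - Suc j)"
      by linarith
    then show "norm (\<psi> (Q' i) (W' i - of_real (real (Suc n) * ln (Q' i)))) \<le> M * (M * a) ^ (k - Suc j)"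
      unfolding \<psi>_def e norm_mult using bound[OF lt(2) x] M(1) by (intro mult_mono) auto
    show "(\<lambda>n. of_real (Q' i - 1) * exp (W' i - of_real (real (Suc n) * ln (Q' i))) *
      \<psi> (Q' i) (W' i - of_real (real (Suc n) * ln (Q' i)))) sums vh (Q' i) j k (W' i)"
      using v_sums[OF jk X(2)] unfolding T_def \<psi>_def e by (simp only: mult.assoc)
  qed
  note rs = riemann_sum_limit[OF Dom_minus c Q' W' w fq]
  have eq: "exp (w - of_real s) * \<psi>0 (w - of_real s) = Utilde ut (Suc j) k (w - of_real s) / ut j (w - of_real s)"
    if "s \<in> {0..}" for s
  proof -
    have "w - of_real s \<in> D" using Dom_minus[OF w] that by simp
    then have "ut j (w - of_real s) \<noteq> 0" "ut (Suc j) (w - of_real s) \<noteq> 0" using ut_nonzero lt by auto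
    then show ?thesis unfolding \<psi>0_def by simp
  qed
  show "set_integrable lborel {0..} (\<lambda>s. Utilde ut (Suc j) k (w - of_real s) / ut j (w - of_real s))"
    by (rule set_integrable_cong[THEN iffD1, OF refl refl eq rs(1)])
  have "(LINT s:{0..}|lborel. exp (w - of_real s) * \<psi>0 (w - of_real s)) =
    (LINT s:{0..}|lborel. Utilde ut (Suc j) k (w - of_real s) / ut j (w - of_real s))"
    by (rule set_lebesgue_integral_cong) (use eq in auto)
  also have "\<dots> = Utilde ut j k w / ut j w"
    unfolding Utilde_less[OF jk(1)] using ut_nonzero[OF lt(1) w] by simp
  finally have "(\<lambda>i. vh (Q' i) j k (W' i)) \<longlonglongrightarrow> Utilde ut j k w / ut j w" using rs(2) by simp
  then show "(\<lambda>i. vh (Q i) j k (W i)) \<longlonglongrightarrow> Utilde ut j k w / ut j w"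
    unfolding Q'_def W'_def by (rule LIMSEQ_offset)
qed

lemma vh_limit:
  assumes "j \<le> k" "k < m"
  shows "cconv D (\<lambda>q w. vh q j k w) (\<lambda>w. Utilde ut j k w / ut j w)"
  using assms(1)
proof (induction "k - j" arbitrary: j)
  case 0
  then have jk: "j = k" by simp
  show ?case
    unfolding cconv_def jk
  proof (intro allI impI)
    fix Q :: "nat \<Rightarrow> real" and W w
    assume Q: "\<forall>i. 1 < Q i" "Q \<longlonglongrightarrow> 1" and W: "W \<longlonglongrightarrow> w" and w: "w \<in> D"
    obtain r where r: "r > 0" "cball w r \<subseteq> D" using open_Dom w open_contains_cball by blast
    obtain M where M: "\<forall>\<^sub>F q in at_right 1. regular q (cball w r) M"
      using fixed_q_eventually[OF compact_cball r(2)] by blast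
    then have "\<forall>\<^sub>F q in at_right 1. \<forall>w\<in>cball w r. vh q k k w = 1"
      by (rule eventually_mono) (use fixed_q.v_diag assms(2) in blast)
    then have "\<forall>\<^sub>F i in sequentially. \<forall>w\<in>cball w r. vh (Q i) k k w = 1"
      using sequence_at_right[of Q] Q unfolding filterlim_iff by blast
    moreover have "\<forall>\<^sub>F i in sequentially. W i \<in> cball w r"
      by (rule eventually_mono[OF tendstoD[OF W r(1)]]) (simp add: dist_commute)
    ultimately have "\<forall>\<^sub>F i in sequentially. 1 = vh (Q i) k k (W i)"
      by eventually_elim simp
    from Lim_transform_eventually[OF tendsto_const this]
    have lim: "(\<lambda>i. vh (Q i) k k (W i)) \<longlonglongrightarrow> 1" .
    have one: "Utilde ut k k w / ut k w = 1" unfolding Utilde_eq using ut_nonzero[OF assms(2) w] by simp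
    show "(\<lambda>i. vh (Q i) k k (W i)) \<longlonglongrightarrow> Utilde ut k k w / ut k w"
      unfolding one by (rule lim)
  qed
next
  case (Suc n)
  then have *: "n = k - Suc j" "Suc j \<le> k" "j < k" by auto
  note IH = Suc.hyps(1)[OF *(1,2)]
  show ?case
    unfolding cconv_def
  proof (intro allI impI)
    fix Q :: "nat \<Rightarrow> real" and W w
    assume Q: "\<forall>i. 1 < Q i" "Q \<longlonglongrightarrow> 1" and W: "W \<longlonglongrightarrow> w" and w: "w \<in> D"
    show "(\<lambda>i. vh (Q i) j k (W i)) \<longlonglongrightarrow> Utilde ut j k w / ut j w"
      by (rule quotient_limit_step(2)[OF *(3) assms(2) IH _ Q(2) W w]) (use Q(1) in blast)
  qed
qed

text \<open>Integrability is a by-product of dominated convergence, so a constant base point and one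
  sequence of parameters tending to 1 suffice.\<close>

lemma quotient_integrable:
  assumes "j < k" "k < m" "w \<in> D"
  shows "set_integrable lborel {0..} (\<lambda>s. Utilde ut (Suc j) k (w - of_real s) / ut j (w - of_real s))"
proof (rule quotient_limit_step(1)[OF assms(1,2) _ _ _ tendsto_const assms(3)])
  show "cconv D (\<lambda>q w. vh q (Suc j) k w) (\<lambda>w. Utilde ut (Suc j) k w / ut (Suc j) w)"
    using assms by (intro vh_limit) auto
  show "(\<lambda>n::nat. 1 + inverse (real (Suc n))) \<longlonglongrightarrow> 1"
    using tendsto_add[OF tendsto_const[of 1] LIMSEQ_inverse_real_of_nat] by simp
qed simp

lemma entry_eventually:
  assumes jk: "j \<le> k" "k < m" and K: "compact K" "K \<subseteq> D"
  shows "\<forall>\<^sub>F q in at_right 1. \<forall>w\<in>K. continues_to (\<lambda>x. U q x $$ (j,k)) (exp w) \<and>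
    uh q j k w = uh q j j w * vh q j k w \<and> cont_val (\<lambda>x. U q x $$ (j,k)) analytic_on {exp w}"
proof -
  obtain M where "\<forall>\<^sub>F q in at_right 1. regular q K M"
    using fixed_q_eventually[OF K] by blast
  then show ?thesis
  proof eventually_elim
    case (elim q)
    then obtain X where X: "fixed_q m f q lam (Lam q) (U q) X M" "\<And>w. w \<in> K \<Longrightarrow> exp w \<in> X"
      "\<And>j w. j < m \<Longrightarrow> w \<in> K \<Longrightarrow> cont_val (\<lambda>x. U q x $$ (j,j)) analytic_on {exp w}" by blast
    show ?case
    proof
      fix w assume w: "w \<in> K"
      have "j < m" using jk by simp
      from fixed_q.u_continues[OF X(1) jk X(2)[OF w] X(3)[OF this w]]
      show "continues_to (\<lambda>x. U q x $$ (j,k)) (exp w) \<and>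
        uh q j k w = uh q j j w * vh q j k w \<and> cont_val (\<lambda>x. U q x $$ (j,k)) analytic_on {exp w}" by blast
    qed
  qed
qed

text \<open>The limit of u_jk is that of the product u_jj v_jk; its analyticity follows from local
  uniform convergence, as the u_jk are analytic above any given compact set for q near 1.\<close>

lemma entry_limit:
  assumes jk: "j \<le> k" "k < m"
  shows "Utilde ut j k analytic_on D" "lim_on_compacts d a \<epsilon> (\<lambda>q z. U q z $$ (j,k)) (Utilde ut j k)"
proof -
  have lt: "j < m" using jk by simp
  have c: "cconv D (\<lambda>q w. uh q j j w * vh q j k w) (\<lambda>w. ut j w * (Utilde ut j k w / ut j w))"
    by (rule cconv_mult[OF diagonal_limit(2)[OF lt] vh_limit[OF jk]])
  have ul: "uniform_limit K (\<lambda>q w. uh q j k w) (Utilde ut j k) (at_right 1)" if K: "compact K" "K \<subseteq> D" for K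
  proof (rule uniform_limit_cong[THEN iffD1, OF _ _ cconv_imp_uniform_limit[OF c cconv_continuous[OF c] K]])
    show "\<forall>\<^sub>F q in at_right 1. \<forall>w\<in>K. uh q j j w * vh q j k w = uh q j k w"
      by (rule eventually_mono[OF entry_eventually[OF jk K]]) simp
    show "ut j w * (Utilde ut j k w / ut j w) = Utilde ut j k w" if "w \<in> K" for w
      using ut_nonzero[OF lt, of w] that K by auto
  qed
  show "Utilde ut j k analytic_on D"
  proof (rule analytic_uniform_limit[OF open_Dom _ ul])
    fix K assume K: "compact K" "K \<subseteq> D"
    show "\<forall>\<^sub>F q in at_right 1. \<forall>w\<in>K. (\<lambda>w. uh q j k w) analytic_on {w}"
      using entry_eventually[OF jk K]
    proof eventually_elim
      case (elim q)
      show ?case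
      proof
        fix w assume "w \<in> K"
        then have "cont_val (\<lambda>x. U q x $$ (j,k)) analytic_on exp ` {w}" using elim by simp
        moreover have "(\<lambda>w::complex. exp w) analytic_on {w}" by (intro analytic_intros)
        ultimately show "(\<lambda>w. uh q j k w) analytic_on {w}"
          using analytic_on_compose[of "\<lambda>w. exp w" "{w}"] by (simp add: o_def)
      qed
    qed
  qed
  have "\<forall>\<^sub>F q in at_right 1. \<forall>w\<in>K. continues_to (\<lambda>x. U q x $$ (j,k)) (exp w)"
    if K: "compact K" "K \<subseteq> D" for K
    by (rule eventually_mono[OF entry_eventually[OF jk K]]) simp
  then show "lim_on_compacts d a \<epsilon> (\<lambda>q z. U q z $$ (j,k)) (Utilde ut j k)"
    unfolding lim_on_compacts_def merom_family_def using ul by blast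
qed

text \<open>An entry that vanishes near 0 has the zero function as its continuation along every
  ray.\<close>

lemma lower_entry_limit:
  assumes jk: "k < j" "j < m"
  shows "lim_on_compacts d a \<epsilon> (\<lambda>q z. U q z $$ (j,k)) (\<lambda>w. 0)"
proof -
  have ev: "\<forall>\<^sub>F q in at_right 1. \<forall>w. continuation (\<lambda>x. U q x $$ (j,k)) (exp w) (\<lambda>x. 0)"
    using eventually_fixed
  proof eventually_elim
    case (elim q)
    have "fixed_q m f q lam (Lam q) (U q) {} 0" by (rule fixed_qI[OF elim]) auto
    then have "near0 (\<lambda>x. (\<forall>i<m. \<forall>j<i. U q x $$ (i,j) = 0))" by (rule fixed_q.lower_zero)
    then have "near0 (\<lambda>x. 0 = U q x $$ (j,k))" by (rule near0_mono) (use jk in simp)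
    then show ?case unfolding continuation_def using nicely_meromorphic_on_const by blast
  qed
  have 1: "\<forall>\<^sub>F q in at_right 1. \<forall>w\<in>K. continues_to (\<lambda>x. U q x $$ (j,k)) (exp w)" for K
    by (rule eventually_mono[OF ev]) (auto simp: continues_to_def)
  have 2: "uniform_limit K (\<lambda>q w. uh q j k w) (\<lambda>w. 0) (at_right 1)" for K
  proof (rule uniform_limitI)
    fix e :: real assume e: "e > 0"
    show "\<forall>\<^sub>F q in at_right 1. \<forall>w\<in>K. dist (uh q j k w) 0 < e"
      using ev
    proof eventually_elim
      case (elim q)
      have "uh q j k w = 0" for w by (rule cont_val_eq[OF elim[rule_format]]) (rule exp_not_eq_zero)
      then show ?case using e by (simp only: dist_self ball_triv simp_thms)
    qed
  qed
  show ?thesis unfolding lim_on_compacts_def merom_family_def using 1 2 by blast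
qed

end

section \<open>Invertibility of the limit matrix and conclusion\<close>

lemma det_analytic:
  assumes "\<And>w. A w \<in> carrier_mat n n"
    and "\<And>i j. i < n \<Longrightarrow> j < n \<Longrightarrow> (\<lambda>w. A w $$ (i,j)) analytic_on S"
  shows "(\<lambda>w. Determinant.det (A w)) analytic_on S"
proof -
  have "(\<lambda>w. (\<Sum>p | p permutes {0..<n}. of_int (sign p) * (\<Prod>i = 0..<n. A w $$ (i, p i)))) analytic_on S"
  proof (intro analytic_on_sum analytic_on_mult analytic_on_const analytic_on_prod)
    fix p i assume p: "p \<in> {p. p permutes {0..<n}}" and i: "i \<in> {0..<n}"
    have "p i \<in> {0..<n}" using permutes_in_image[of p "{0..<n}" i] p i by simp
    then show "(\<lambda>w. A w $$ (i, p i)) analytic_on S" using i by (intro assms(2)) auto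
  qed
  then show ?thesis by (simp only: det_def'[OF assms(1)])
qed

text \<open>The inverse is the adjugate over the determinant. The determinant is the product of the
  diagonal entries, nonzero on the domain, and the adjugate is polynomial in the entries, so the
  inverse is analytic on the same domain.\<close>

lemma GL_Aring_upper_triangular:
  assumes c: "\<And>w. A w \<in> carrier_mat n n" and ut: "\<And>w. upper_triangular (A w)"
    and an: "\<And>i j. i < n \<Longrightarrow> j < n \<Longrightarrow> (\<lambda>w. A w $$ (i,j)) analytic_on Dom d a \<epsilon>"
    and nz: "\<And>i w. i < n \<Longrightarrow> w \<in> Dom d a \<epsilon> \<Longrightarrow> A w $$ (i,i) \<noteq> 0" and a: "a > 0"
  shows "GL_Aring n (d - \<epsilon>) (d + \<epsilon>) A"
proof -
  have Dom: "Dom d a \<epsilon> = {w. Re w < ln a \<and> d - \<epsilon> < Im w \<and> Im w < d + \<epsilon>}" by (simp add: Dom_def)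
  have ring: "Aring (d - \<epsilon>) (d + \<epsilon>) \<phi>" if "\<phi> analytic_on Dom d a \<epsilon>" for \<phi>
    unfolding Aring_def using that a Dom by auto
  define R where "R = (\<lambda>w. inverse (Determinant.det (A w)) \<cdot>\<^sub>m adj_mat (A w))"
  have adj: "adj_mat (A w) \<in> carrier_mat n n" for w using adj_mat(1)[OF c] .
  have Rc: "R w \<in> carrier_mat n n" for w unfolding R_def using adj by simp
  have det0: "Determinant.det (A w) \<noteq> 0" if "w \<in> Dom d a \<epsilon>" for w
    unfolding det_upper_triangular[OF ut c] diag_mat_def
    using nz that c[of w] by (auto simp: prod_list_zero_iff)
  have Ran: "(\<lambda>w. R w $$ (i,j)) analytic_on Dom d a \<epsilon>" if ij: "i < n" "j < n" for i j
  proof -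
    have "(\<lambda>w. Determinant.det (mat_delete (A w) j i)) analytic_on Dom d a \<epsilon>"
    proof (rule det_analytic)
      show "mat_delete (A w) j i \<in> carrier_mat (n - 1) (n - 1)" for w
        using mat_delete_carrier[OF c] .
      fix k l assume kl: "k < n - 1" "l < n - 1"
      have "(\<lambda>w. A w $$ (insert_index j k, insert_index i l)) analytic_on Dom d a \<epsilon>"
        by (rule an) (use kl in \<open>auto simp: insert_index_def\<close>)
      moreover have "mat_delete (A w) j i $$ (k,l) = A w $$ (insert_index j k, insert_index i l)" for w
        using mat_delete_index[of "A w" "n - 1" j i k l] c[of w] kl ij by simp
      ultimately show "(\<lambda>w. mat_delete (A w) j i $$ (k,l)) analytic_on Dom d a \<epsilon>" by simp
    qed
    then have "(\<lambda>w. inverse (Determinant.det (A w)) * ((- 1) ^ (j + i) * Determinant.det (mat_delete (A w) j i)))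
      analytic_on Dom d a \<epsilon>"
      using det0 by (intro analytic_on_mult analytic_on_const analytic_on_inverse det_analytic[OF c an]) auto
    moreover have "R w $$ (i,j) = inverse (Determinant.det (A w)) * ((- 1) ^ (j + i) * Determinant.det (mat_delete (A w) j i))" for w
      unfolding R_def adj_mat_def cofactor_def using ij c[of w] by simp
    ultimately show ?thesis by simp
  qed
  have inv: "inverts_mat (A w) (R w)" "inverts_mat (R w) (A w)" if w: "w \<in> Dom d a \<epsilon>" for w
  proof -
    have "A w * R w = inverse (Determinant.det (A w)) \<cdot>\<^sub>m (A w * adj_mat (A w))"
      unfolding R_def by (rule mult_smult_distrib[OF c adj])
    also have "\<dots> = 1\<^sub>m n"
      unfolding adj_mat(2)[OF c] by (rule eq_matI) (use det0[OF w] in auto)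
    finally show "inverts_mat (A w) (R w)" unfolding inverts_mat_def using c[of w] by simp
    have "R w * A w = inverse (Determinant.det (A w)) \<cdot>\<^sub>m (adj_mat (A w) * A w)"
      unfolding R_def by (rule mult_smult_assoc_mat[OF adj c])
    also have "\<dots> = 1\<^sub>m n"
      unfolding adj_mat(3)[OF c] by (rule eq_matI) (use det0[OF w] in auto)
    finally show "inverts_mat (R w) (A w)" unfolding inverts_mat_def using Rc[of w] by simp
  qed
  show ?thesis
    unfolding GL_Aring_def
  proof (intro conjI allI impI exI[of _ R] exI[of _ a] c Rc ring an Ran a)
    fix w assume "Re w < ln a \<and> d - \<epsilon> < Im w \<and> Im w < d + \<epsilon>"
    then have "w \<in> Dom d a \<epsilon>" unfolding Dom_def by simp
    from inv[OF this] show "inverts_mat (A w) (R w)" "inverts_mat (R w) (A w)" .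
  qed
qed

theorem theorem4p5:
  fixes m :: nat
    and f :: "real \<Rightarrow> nat \<Rightarrow> complex fls" and ft :: "nat \<Rightarrow> complex fls"
    and lam :: complex and d a \<epsilon> :: real and Sig :: "real set"
    and Lam U :: "real \<Rightarrow> complex \<Rightarrow> complex mat"
    and ut :: "nat \<Rightarrow> complex \<Rightarrow> complex"
  assumes m: "m \<ge> 1"
    and nonzero: "\<forall>q>1. \<forall>j<m. 1 + fls_const (of_real (q - 1)) * f q j \<noteq> 0"
    and H1: "hyp_H1 m f ft"
    and H2: "hyp_H2 m f"
    and H3: "hyp_H3 m ft"
    and Sig: "sing_dir_set m f ft Sig"
    and lam: "lam \<noteq> 0" "lam = of_real (cmod lam) * cis d" "d \<notin> Sig"
    and pos: "a > 0" "\<epsilon> > 0"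
    and Lam: "\<forall>q>1. is_Lambda m f q (Lam q)"
    and U: "\<forall>\<^sub>F q in at_right 1. is_U m f q lam (Lam q) (U q)"
    and H4: "\<forall>j<m. lim_on_compacts d a \<epsilon> (\<lambda>q z. U q z $$ (j,j)) (ut j) \<and>
                    Aring (d - \<epsilon>) (d + \<epsilon>) (ut j) \<and> (\<forall>w\<in>Dom d a \<epsilon>. ut j w \<noteq> 0)"
    and H5: "\<forall>j. Suc j < m \<longrightarrow>
               classB d a \<epsilon> (\<lambda>q z. U q z $$ (Suc j, Suc j) / (z * U q (of_real q * z) $$ (j,j)))"
  shows "(\<forall>j k. j < k \<and> k < m \<longrightarrow> (\<forall>w\<in>Dom d a \<epsilon>.
            set_integrable lborel {0..}
              (\<lambda>s. Utilde ut (Suc j) k (w - of_real s) / ut j (w - of_real s))))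
       \<and> GL_Aring m (d - \<epsilon>) (d + \<epsilon>) (Utilde_mat m ut)
       \<and> (\<forall>j<m. \<forall>k<m. lim_on_compacts d a \<epsilon> (\<lambda>q z. U q z $$ (j,k)) (\<lambda>w. Utilde_mat m ut w $$ (j,k)))"
proof -
  interpret q_family m f lam d a \<epsilon> Lam U ut
    by unfold_locales (fact nonzero H2 pos(1) Lam U H4 H5)+
  have entry: "Utilde_mat m ut w $$ (j,k) = Utilde ut j k w" if "j < m" "k < m" for j k w
    unfolding Utilde_mat_def using that by simp
  have lower: "Utilde_mat m ut w $$ (j,k) = 0" if "k < j" "j < m" for j k w
  proof -
    have "k < m" using that by simp
    then show ?thesis using entry[OF that(2)] Utilde_greater[OF that(1)] by simp
  qed
  have "GL_Aring m (d - \<epsilon>) (d + \<epsilon>) (Utilde_mat m ut)"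
  proof (rule GL_Aring_upper_triangular[where a = a])
    show "Utilde_mat m ut w \<in> carrier_mat m m" for w by (simp add: Utilde_mat_def)
    have "dim_row (Utilde_mat m ut w) = m" for w by (simp add: Utilde_mat_def)
    then show "upper_triangular (Utilde_mat m ut w)" for w
      unfolding upper_triangular_def using lower by auto
    show "(\<lambda>w. Utilde_mat m ut w $$ (i,j)) analytic_on D" if ij: "i < m" "j < m" for i j
    proof (cases "i \<le> j")
      case True
      have "Utilde ut i j analytic_on D" by (rule entry_limit(1)[OF True ij(2)])
      then show ?thesis unfolding entry[OF ij] .
    next
      case False
      then have "j < i" by simp
      then show ?thesis unfolding lower[OF \<open>j < i\<close> ij(1)] by simp
    qed
    show "Utilde_mat m ut w $$ (i,i) \<noteq> 0" if "i < m" "w \<in> D" for i w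
      unfolding entry[OF that(1) that(1)] Utilde_eq by (rule ut_nonzero[OF that])
  qed (rule pos(1))
  moreover have "lim_on_compacts d a \<epsilon> (\<lambda>q z. U q z $$ (j,k)) (\<lambda>w. Utilde_mat m ut w $$ (j,k))"
    if jk: "j < m" "k < m" for j k
  proof (cases "j \<le> k")
    case True
    then show ?thesis unfolding entry[OF jk] by (rule entry_limit(2)[OF _ jk(2)])
  next
    case False
    then have "k < j" by simp
    then show ?thesis unfolding lower[OF \<open>k < j\<close> jk(1)] by (rule lower_entry_limit[OF _ jk(1)])
  qed
  ultimately show ?thesis using quotient_integrable by blast
qed

end
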